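(* Let $U$ be a $\mathrm{GL}(m)$-module and let $$F:\mathbf{Con}(M)\to\Gamma(\mathbf{Ass}_M(U))$$ be a natural differential operation of order $k$. Then $$F(\theta)=\widetilde F(\Psi_0(\theta),\dots,\Psi_k(\theta)),$$ where $\widetilde F$ corresponds to (is induced fibrewise by) some polynomial $\mathrm{GL}(m)$-equivariant mapping $$\widetilde f:C_0\times C_1\times\dots\times C_k\to U.$$
   Context: $\mathrm{GL}(m)=\mathrm{GL}(m,\mathbb{R})$. For a real finite-dimensional representation $\sigma:\mathrm{GL}(m)\to\mathrm{GL}(U)$ and an $m$-dimensional smooth manifold $M$, $\mathbf{Ass}_M(U)$ is the bundle associated via $\sigma$ to the frame bundle, $\Gamma$ denotes smooth sections; $\mathbf{Con}(M)$ is the set of all (linear) connections on $M$, torsion allowed. In a chart a connection is presented by a smooth map $\theta(x)=\theta^l_{ij}(x)\,e_l\otimes u^i\otimes v^j\in\mathbb{R}^m\otimes\mathbb{R}^{m*}\otimes\mathbb{R}^{m*}$ with $D_{\partial_i}\partial_j=\theta^l_{ij}\partial_l$; here $e_l$ is the standard basis of $\mathbb{R}^m$, and $u^i$, $v^j$, $z^i$ are copies of the dual basis. Natural differential operation of order $k$: a family $F=F_M$ of maps over all $m$-dimensional manifolds with $F_M(\phi^*\theta)=\phi^*(F_N(\theta))$ for every diffeomorphism $\phi$ of $M$ onto an open submanifold of $N$, given in all charts by one fixed polynomial (without explicit dependence on the point) in the partial derivatives of orders $\le k$ of the components $\theta^l_{ij}$ at the point. $\mathbf{Con}(m)_k$ is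 the space of $k$-jets at $0\in\mathbb{R}^m$ of connections; an element is written $\theta=(\theta_0,\dots,\theta_k)$ with $\theta_n\in S^n(\mathbb{R}^{m*})\otimes\mathbb{R}^m\otimes\mathbb{R}^{m*}\otimes\mathbb{R}^{m*}$ the part homogeneous of degree $n$ in $z$. $\mathrm{GL}(m)_{k+2}$ is the group of $(k+2)$-jets at $0$ of local diffeomorphisms of $\mathbb{R}^m$ fixing $0$; it acts on $\mathbf{Con}(m)_k$ by the transition rule for connections: $g\cdot\theta$ is the $k$-jet at $0$ of $$y\mapsto\Big(J^l_a\frac{\partial (J^{-1})^a_j}{\partial y^i}+J^l_a\,(J^{-1})^c_i\,(J^{-1})^b_j\,\theta^a_{cb}(g^{-1}(y))\Big)e_l\otimes u^i\otimes v^j,$$ where $J=J_g(g^{-1}(y))$ is the Jacobi matrix of $g$ and $J^{-1}$ is the Jacobi matrix of $g^{-1}$ at $y$. $\mathrm{N}(m)_{k+2}$ is the subgroup of jets with identity Jacobi matrix at $0$. $C_n=\ker\gamma_n$, where $\gamma_n:S^n(\mathbb{R}^{m*})\otimes\mathbb{R}^m\otimes\mathbb{R}^{m*}\otimes\mathbb{R}^{m*}\to S^{n+2}\mathbb{R}^{m*}\otimes\mathbb{R}^m$, $\gamma_n(f(z)\otimes e_l\otimes u^i\otimes v^j)=f(z)z^iz^j\otimes e_l$. Let $\mathbb{C}_k=C_0\times\dots\times C_k\subset\mathbf{Con}(m)_k$ (not the complex numbers). Every $\mathrm{N}(m)_{k+2}$-orbit in $\mathbf{Con}(m)_k$ meets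 $\mathbb{C}_k$ in exactly one point; let $\widetilde\psi_k(\theta)=(\mathrm{N}(m)_{k+2}\cdot\theta)\cap\mathbb{C}_k$, and for $0\le n\le k$ let $\psi_n:\mathbf{Con}(m)_k\to C_n$ be the composition of $\widetilde\psi_k$ with the projection to $C_n$. It is $\mathrm{GL}(m)_{k+2}$-equivariant ($\mathrm{N}(m)_{k+2}$ acting trivially on $C_n$), so it defines a natural differential operation $\Psi_n:\mathbf{Con}(M)\to\Gamma(\mathbf{Ass}_M(C_n))$, given in a chart by applying $\psi_n$ to the $k$-jet of $\theta$ at each point. *)

theory Defs
  imports "HOL-Analysis.Analysis"
begin

section \<open>Calculus preliminaries\<close>

(* Meant for open S. *)
primrec Ck_on ::
  "nat \<Rightarrow> 'a::real_normed_vector set \<Rightarrow> ('a \<Rightarrow> 'b::real_normed_vector) \<Rightarrow> bool"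
where
  "Ck_on 0 S f \<longleftrightarrow> continuous_on S f"
| "Ck_on (Suc n) S f \<longleftrightarrow>
     (\<forall>x\<in>S. f differentiable (at x)) \<and>
     (\<forall>v. Ck_on n S (\<lambda>x. frechet_derivative f (at x) v))"

definition smooth_on ::
  "'a::real_normed_vector set \<Rightarrow> ('a \<Rightarrow> 'b::real_normed_vector) \<Rightarrow> bool"
where "smooth_on S f \<longleftrightarrow> (\<forall>n. Ck_on n S f)"

primrec pderivs ::
  "'m list \<Rightarrow> (real^'m::finite \<Rightarrow> 'b::real_normed_vector) \<Rightarrow> real^'m \<Rightarrow> 'b"
where
  "pderivs [] f = f"
| "pderivs (i # is) f = (\<lambda>x. frechet_derivative (pderivs is f) (at x) (axis i 1))"

(* The k-jet of f at x, as the family of homogeneous parts (n = 0, ..., k) of the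
   Taylor polynomial of f at x, which are functions of the increment z.  The sum runs
   over index lists rather than multi-indices, hence the factor 1/n!. *)
definition jet ::
  "nat \<Rightarrow> (real^'m::finite \<Rightarrow> 'b::real_normed_vector) \<Rightarrow> real^'m \<Rightarrow> nat \<Rightarrow> real^'m \<Rightarrow> 'b"
where
  "jet k f x =
     (\<lambda>n\<in>{..k}. \<lambda>z. (1 / fact n) *\<^sub>R
        (\<Sum>is | length is = n. prod_list (map (($) z) is) *\<^sub>R pderivs is f x))"

(* The algebra of functions generated by the constants and the coordinate functions in X. *)
inductive polynomial_in :: "('a \<Rightarrow> real) set \<Rightarrow> ('a \<Rightarrow> real) \<Rightarrow> bool"
  for X :: "('a \<Rightarrow> real) set"
where
  coord: "\<xi> \<in> X \<Longrightarrow> polynomial_in X \<xi>"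
| const: "polynomial_in X (\<lambda>_. c)"
| add: "polynomial_in X f \<Longrightarrow> polynomial_in X g \<Longrightarrow> polynomial_in X (\<lambda>x. f x + g x)"
| mult: "polynomial_in X f \<Longrightarrow> polynomial_in X g \<Longrightarrow> polynomial_in X (\<lambda>x. f x * g x)"

definition polynomial_map_in ::
  "('a \<Rightarrow> real) set \<Rightarrow> ('a \<Rightarrow> 'u::real_normed_vector) \<Rightarrow> bool"
where
  "polynomial_map_in X f \<longleftrightarrow> (\<forall>l. bounded_linear l \<longrightarrow> polynomial_in X (l \<circ> f))"


section \<open>Representations of the general linear group\<close>

definition GL :: "(real^'m^'m::finite) set"
  where "GL = {A. invertible A}"

(* In finite dimension all norms on U are equivalent; the norm of the type only supplies
   the usual topology. *)
definition GL_module :: "(real^'m^'m::finite \<Rightarrow> 'u::real_normed_vector \<Rightarrow> 'u) \<Rightarrow> bool"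
where
  "GL_module \<sigma> \<longleftrightarrow>
     (\<exists>B::'u set. finite B \<and> span B = UNIV) \<and>
     (\<forall>A\<in>GL. linear (\<sigma> A)) \<and>
     \<sigma> (mat 1) = id \<and>
     (\<forall>A\<in>GL. \<forall>B\<in>GL. \<sigma> (A ** B) = \<sigma> A \<circ> \<sigma> B) \<and>
     (\<forall>u. continuous_on GL (\<lambda>A. \<sigma> A u))"


section \<open>Jets of connections and their normal forms\<close>

(* The component with upper index l and lower indices i, j of t is t $ l $ i $ j. *)
type_synonym 'm chr = "real^'m^'m^'m"

(* The transition rule for a connection under the diffeomorphism g with inverse h:
   the presentation at the point y of the image of g. *)
definition transform ::
  "(real^'m::finite \<Rightarrow> real^'m) \<Rightarrow> (real^'m \<Rightarrow> real^'m) \<Rightarrow> (real^'m \<Rightarrow> 'm chr)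
     \<Rightarrow> real^'m \<Rightarrow> 'm chr"
where
  "transform g h \<theta> y =
     (let J = jacobian g (at (h y)); K = jacobian h (at y) in
      \<chi> l i j.
        (\<Sum>a\<in>UNIV. J $ l $ a *
           frechet_derivative (\<lambda>y'. jacobian h (at y') $ a $ j) (at y) (axis i 1)) +
        (\<Sum>a\<in>UNIV. \<Sum>c\<in>UNIV. \<Sum>b\<in>UNIV.
           J $ l $ a * K $ c $ i * K $ b $ j * \<theta> (h y) $ a $ c $ b))"

(* Symmetric tensors of degree n are represented as homogeneous polynomial functions of z. *)
definition con_hom :: "nat \<Rightarrow> (real^'m::finite \<Rightarrow> 'm chr) set"
where
  "con_hom n = {p. polynomial_function p \<and> (\<forall>c z. p (c *\<^sub>R z) = c ^ n *\<^sub>R p z)}"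

definition gamma :: "(real^'m::finite \<Rightarrow> 'm chr) \<Rightarrow> real^'m \<Rightarrow> real^'m"
where
  "gamma p = (\<lambda>z. \<chi> l. \<Sum>i\<in>UNIV. \<Sum>j\<in>UNIV. p z $ l $ i $ j * z $ i * z $ j)"

definition C_space :: "nat \<Rightarrow> (real^'m::finite \<Rightarrow> 'm chr) set"
where "C_space n = {p \<in> con_hom n. gamma p = (\<lambda>z. 0)}"

definition C_prod :: "nat \<Rightarrow> (nat \<Rightarrow> real^'m::finite \<Rightarrow> 'm chr) set"
where "C_prod k = (\<Pi>\<^sub>E n\<in>{..k}. C_space n)"

definition local_diffeo_at_0 ::
  "(real^'m::finite) set \<Rightarrow> (real^'m \<Rightarrow> real^'m) \<Rightarrow> (real^'m \<Rightarrow> real^'m) \<Rightarrow> bool"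
where
  "local_diffeo_at_0 S g h \<longleftrightarrow>
     open S \<and> 0 \<in> S \<and> g 0 = 0 \<and> open (g ` S) \<and> (\<forall>x\<in>S. h (g x) = x) \<and>
     smooth_on S g \<and> smooth_on (g ` S) h"

(* The action on k-jets of connections at 0.  The jet of order k + 2 acting is given by a
   representative g with local inverse h; the result depends on that jet only. *)
definition jet_act ::
  "nat \<Rightarrow> (real^'m::finite \<Rightarrow> real^'m) \<Rightarrow> (real^'m \<Rightarrow> real^'m)
     \<Rightarrow> (nat \<Rightarrow> real^'m \<Rightarrow> 'm chr) \<Rightarrow> nat \<Rightarrow> real^'m \<Rightarrow> 'm chr"
where
  "jet_act k g h \<theta> = jet k (transform g h (\<lambda>z. \<Sum>n\<le>k. \<theta> n z)) 0"

definition N_orbit ::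
  "nat \<Rightarrow> (nat \<Rightarrow> real^'m::finite \<Rightarrow> 'm chr) \<Rightarrow> (nat \<Rightarrow> real^'m \<Rightarrow> 'm chr) set"
where
  "N_orbit k \<theta> =
     {jet_act k g h \<theta> | S g h. local_diffeo_at_0 S g h \<and> jacobian g (at 0) = mat 1}"

definition psi_tilde ::
  "nat \<Rightarrow> (nat \<Rightarrow> real^'m::finite \<Rightarrow> 'm chr) \<Rightarrow> nat \<Rightarrow> real^'m \<Rightarrow> 'm chr"
where "psi_tilde k \<theta> = the_elem (N_orbit k \<theta> \<inter> C_prod k)"

definition psi ::
  "nat \<Rightarrow> nat \<Rightarrow> (nat \<Rightarrow> real^'m::finite \<Rightarrow> 'm chr) \<Rightarrow> real^'m \<Rightarrow> 'm chr"
where "psi k n \<theta> = psi_tilde k \<theta> n"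

(* The tensor representation on con_hom n, of which C_space n is a submodule. *)
definition tensor_act ::
  "real^'m^'m::finite \<Rightarrow> (real^'m \<Rightarrow> 'm chr) \<Rightarrow> real^'m \<Rightarrow> 'm chr"
where
  "tensor_act A p =
     (let B = matrix_inv A in
      (\<lambda>z. \<chi> l i j. \<Sum>a\<in>UNIV. \<Sum>c\<in>UNIV. \<Sum>b\<in>UNIV.
        A $ l $ a * B $ c $ i * B $ b $ j * p (B *v z) $ a $ c $ b))"

(* Linear coordinates on the space of k-jets of connections at 0: the coefficients of the
   homogeneous parts, up to positive integer factors. *)
definition jet_coords :: "nat \<Rightarrow> ((nat \<Rightarrow> real^'m::finite \<Rightarrow> 'm chr) \<Rightarrow> real) set"
where
  "jet_coords k =
     {\<lambda>\<theta>. pderivs is (\<theta> (length is)) 0 $ l $ i $ j | is l i j. length is \<le> k}"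


section \<open>Smooth manifolds\<close>

type_synonym ('p, 'm) chart = "'p set \<times> ('p \<Rightarrow> real^'m)"

definition is_chart :: "'p topology \<Rightarrow> ('p, 'm::finite) chart \<Rightarrow> bool"
where
  "is_chart X c \<longleftrightarrow>
     openin X (fst c) \<and> snd c \<in> extensional (fst c) \<and> open (snd c ` fst c) \<and>
     homeomorphic_map (subtopology X (fst c)) (top_of_set (snd c ` fst c)) (snd c)"

definition transition ::
  "('p, 'm::finite) chart \<Rightarrow> ('p, 'm) chart \<Rightarrow> real^'m \<Rightarrow> real^'m"
where "transition c d = snd d \<circ> inv_into (fst c) (snd c)"

definition compatible :: "('p, 'm::finite) chart \<Rightarrow> ('p, 'm) chart \<Rightarrow> bool"
where
  "compatible c d \<longleftrightarrow>
     smooth_on (snd c ` (fst c \<inter> fst d)) (transition c d) \<and>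
     smooth_on (snd d ` (fst c \<inter> fst d)) (transition d c)"

record ('p, 'm) mfd =
  top_of :: "'p topology"
  atlas :: "('p set \<times> ('p \<Rightarrow> real^'m)) set"

abbreviation points :: "('p, 'm::finite) mfd \<Rightarrow> 'p set"
  where "points M \<equiv> topspace (top_of M)"

(* The atlas is the maximal one, i.e. the set of all smooth charts. *)
definition manifold :: "('p, 'm::finite) mfd \<Rightarrow> bool"
where
  "manifold M \<longleftrightarrow>
     Hausdorff_space (top_of M) \<and> second_countable (top_of M) \<and>
     (\<forall>c\<in>atlas M. is_chart (top_of M) c) \<and>
     points M = (\<Union>c\<in>atlas M. fst c) \<and>
     (\<forall>c\<in>atlas M. \<forall>d\<in>atlas M. compatible c d) \<and>
     (\<forall>c. is_chart (top_of M) c \<and> (\<forall>d\<in>atlas M. compatible c d) \<longrightarrow> c \<in> atlas M)"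

definition open_submanifold :: "('p, 'm::finite) mfd \<Rightarrow> 'p set \<Rightarrow> ('p, 'm) mfd"
where
  "open_submanifold N W =
     \<lparr>top_of = subtopology (top_of N) W, atlas = {c \<in> atlas N. fst c \<subseteq> W}\<rparr>"

definition smooth_map ::
  "('p, 'm::finite) mfd \<Rightarrow> ('p, 'm) mfd \<Rightarrow> ('p \<Rightarrow> 'p) \<Rightarrow> bool"
where
  "smooth_map M N \<phi> \<longleftrightarrow>
     continuous_map (top_of M) (top_of N) \<phi> \<and>
     (\<forall>c\<in>atlas M. \<forall>d\<in>atlas N.
        smooth_on (snd c ` {p \<in> fst c. \<phi> p \<in> fst d}) (snd d \<circ> \<phi> \<circ> inv_into (fst c) (snd c)))"

definition diffeomorphism ::
  "('p, 'm::finite) mfd \<Rightarrow> ('p, 'm) mfd \<Rightarrow> ('p \<Rightarrow> 'p) \<Rightarrow> bool"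
where
  "diffeomorphism M N \<phi> \<longleftrightarrow>
     bij_betw \<phi> (points M) (points N) \<and>
     smooth_map M N \<phi> \<and> smooth_map N M (inv_into (points M) \<phi>)"

definition push_chart :: "('p \<Rightarrow> 'p) \<Rightarrow> ('p, 'm::finite) chart \<Rightarrow> ('p, 'm) chart"
where
  "push_chart \<phi> c =
     (\<phi> ` fst c, restrict (snd c \<circ> inv_into (fst c) \<phi>) (\<phi> ` fst c))"


section \<open>Connections\<close>

(* A connection is given by its presentations in all charts, as functions on the images of
   the charts; they are related by the transition rule. *)
type_synonym ('p, 'm) connection = "('p, 'm) chart \<Rightarrow> real^'m \<Rightarrow> 'm chr"

definition Con :: "('p, 'm::finite) mfd \<Rightarrow> ('p, 'm) connection set"
where
  "Con M =
     {\<theta> \<in> (\<Pi>\<^sub>E c\<in>atlas M. extensional (snd c ` fst c)).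
        (\<forall>c\<in>atlas M. smooth_on (snd c ` fst c) (\<theta> c)) \<and>
        (\<forall>c\<in>atlas M. \<forall>d\<in>atlas M. \<forall>y\<in>snd d ` (fst c \<inter> fst d).
           \<theta> d y = transform (transition c d) (transition d c) (\<theta> c) y)}"

definition pull_con ::
  "('p, 'm::finite) mfd \<Rightarrow> ('p \<Rightarrow> 'p) \<Rightarrow> ('p, 'm) connection \<Rightarrow> ('p, 'm) connection"
where "pull_con M \<phi> \<theta> = (\<lambda>c\<in>atlas M. \<theta> (push_chart \<phi> c))"


section \<open>The frame bundle and its associated bundles\<close>

definition charts_at :: "('p, 'm::finite) mfd \<Rightarrow> 'p \<Rightarrow> ('p, 'm) chart set"
where "charts_at M p = {c \<in> atlas M. p \<in> fst c}"

definition jac ::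
  "('p, 'm::finite) chart \<Rightarrow> ('p, 'm) chart \<Rightarrow> 'p \<Rightarrow> real^'m^'m"
where "jac c d p = jacobian (transition c d) (at (snd c p))"

(* A frame at p is given by its matrix in each chart c around p: column j consists of the
   components, in the basis of coordinate vectors of c, of the j-th vector of the frame. *)
type_synonym ('p, 'm) frame = "('p, 'm) chart \<Rightarrow> real^'m^'m"

definition frames :: "('p, 'm::finite) mfd \<Rightarrow> 'p \<Rightarrow> ('p, 'm) frame set"
where
  "frames M p =
     {b \<in> (\<Pi>\<^sub>E c\<in>charts_at M p. GL).
        \<forall>c\<in>charts_at M p. \<forall>d\<in>charts_at M p. b d = jac c d p ** b c}"

definition frame_act ::
  "('p, 'm::finite) mfd \<Rightarrow> 'p \<Rightarrow> ('p, 'm) frame \<Rightarrow> real^'m^'m \<Rightarrow> ('p, 'm) frame"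
where "frame_act M p b A = (\<lambda>c\<in>charts_at M p. b c ** A)"

definition coord_frame ::
  "('p, 'm::finite) mfd \<Rightarrow> ('p, 'm) chart \<Rightarrow> 'p \<Rightarrow> ('p, 'm) frame"
where "coord_frame M c p = (\<lambda>d\<in>charts_at M p. jac c d p)"

(* (b A, u) is identified with (b, \<sigma>(A) u). *)
definition ass_rel ::
  "('p, 'm::finite) mfd \<Rightarrow> 'v set \<Rightarrow> (real^'m^'m \<Rightarrow> 'v \<Rightarrow> 'v) \<Rightarrow> 'p
     \<Rightarrow> ((('p, 'm) frame \<times> 'v) \<times> (('p, 'm) frame \<times> 'v)) set"
where
  "ass_rel M U \<sigma> p =
     {((frame_act M p b A, u), (b, \<sigma> A u)) | b A u. b \<in> frames M p \<and> A \<in> GL \<and> u \<in> U}"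

definition ass_fibre ::
  "('p, 'm::finite) mfd \<Rightarrow> 'v set \<Rightarrow> (real^'m^'m \<Rightarrow> 'v \<Rightarrow> 'v) \<Rightarrow> 'p
     \<Rightarrow> (('p, 'm) frame \<times> 'v) set set"
where "ass_fibre M U \<sigma> p = (frames M p \<times> U) // ass_rel M U \<sigma> p"

type_synonym ('p, 'm, 'v) ass_section = "'p \<Rightarrow> (('p, 'm) frame \<times> 'v) set"

(* The presentation in the chart c, by means of the frame of coordinate vectors. *)
definition ass_comp ::
  "('p, 'm::finite) mfd \<Rightarrow> ('p, 'm) chart \<Rightarrow> ('p, 'm, 'v) ass_section \<Rightarrow> 'p \<Rightarrow> 'v"
where "ass_comp M c s p = (THE u. (coord_frame M c p, u) \<in> s p)"

definition smooth_sections ::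
  "('p, 'm::finite) mfd \<Rightarrow> (real^'m^'m \<Rightarrow> 'u \<Rightarrow> 'u)
     \<Rightarrow> ('p, 'm, 'u::real_normed_vector) ass_section set"
where
  "smooth_sections M \<sigma> =
     {s \<in> (\<Pi>\<^sub>E p\<in>points M. ass_fibre M UNIV \<sigma> p).
        \<forall>c\<in>atlas M. smooth_on (snd c ` fst c) (ass_comp M c s \<circ> inv_into (fst c) (snd c))}"

(* The pullback of a frame b of N at \<phi>(p) has in a chart c around p the matrix of b in the
   chart of N obtained by transporting c along \<phi>. *)
definition pull_section ::
  "('p, 'm::finite) mfd \<Rightarrow> ('p \<Rightarrow> 'p) \<Rightarrow> ('p, 'm, 'v) ass_section
     \<Rightarrow> ('p, 'm, 'v) ass_section"
where
  "pull_section M \<phi> s =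
     (\<lambda>p\<in>points M. {(\<lambda>c\<in>charts_at M p. b (push_chart \<phi> c), u) | b u. (b, u) \<in> s (\<phi> p)})"

(* The map of sections induced fibrewise by f: the tuple of classes of (b, u n) is sent
   to the class of (b, f u); for an equivariant f the set below is this whole class. *)
definition induced ::
  "nat \<Rightarrow> ((nat \<Rightarrow> 'v) \<Rightarrow> 'u) \<Rightarrow> ('p, 'm::finite) mfd
     \<Rightarrow> (nat \<Rightarrow> ('p, 'm, 'v) ass_section) \<Rightarrow> ('p, 'm, 'u) ass_section"
where
  "induced k f M s =
     (\<lambda>p\<in>points M. {(b, f u) | b u. b \<in> frames M p \<and> u \<in> extensional {..k} \<and>
        (\<forall>n\<le>k. (b, u n) \<in> s n p)})"


section \<open>Natural differential operations\<close>

(* The variables of a polynomial in the partial derivatives of orders up to k of the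
   components of a connection; D is holds the partial derivative along the index list is. *)
definition deriv_vars :: "nat \<Rightarrow> (('m::finite list \<Rightarrow> 'm chr) \<Rightarrow> real) set"
where "deriv_vars k = {\<lambda>D. D is $ l $ i $ j | is l i j. length is \<le> k}"

definition natural_operation ::
  "nat \<Rightarrow> (real^'m^'m::finite \<Rightarrow> 'u::real_normed_vector \<Rightarrow> 'u)
     \<Rightarrow> (('p, 'm) mfd \<Rightarrow> ('p, 'm) connection \<Rightarrow> ('p, 'm, 'u) ass_section) \<Rightarrow> bool"
where
  "natural_operation k \<sigma> F \<longleftrightarrow>
     (\<forall>M. manifold M \<longrightarrow> (\<forall>\<theta>\<in>Con M. F M \<theta> \<in> smooth_sections M \<sigma>)) \<and>
     (\<forall>M N W \<phi>. manifold M \<and> manifold N \<and> openin (top_of N) W \<and>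
        diffeomorphism M (open_submanifold N W) \<phi> \<longrightarrow>
        (\<forall>\<theta>\<in>Con N. F M (pull_con M \<phi> \<theta>) = pull_section M \<phi> (F N \<theta>))) \<and>
     (\<exists>P. polynomial_map_in (deriv_vars k) P \<and>
        (\<forall>M. manifold M \<longrightarrow> (\<forall>\<theta>\<in>Con M. \<forall>c\<in>atlas M. \<forall>p\<in>fst c.
           ass_comp M c (F M \<theta>) p = P (\<lambda>is. pderivs is (\<theta> c) (snd c p)))))"

(* By equivariance of psi, every chart c around p contributes the same class. *)
definition Psi ::
  "nat \<Rightarrow> nat \<Rightarrow> ('p, 'm::finite) mfd \<Rightarrow> ('p, 'm) connection
     \<Rightarrow> ('p, 'm, real^'m \<Rightarrow> 'm chr) ass_section"
where
  "Psi k n M \<theta> =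
     (\<lambda>p\<in>points M. \<Union>c\<in>charts_at M p.
        ass_rel M (C_space n) tensor_act p ``
          {(coord_frame M c p, psi k n (jet k (\<theta> c) (snd c p)))})"

end

theory Submission
  imports Defs
begin

text \<open>
  A change of coordinates g = id + r with r vanishing to order n + 2 changes the components of a
  connection, up to order n + 1, by minus the second derivatives of r.  By Euler's identity, gamma
  maps the second derivatives of r to (n + 2)(n + 1) r modulo terms of higher order.  Hence r can be
  chosen so that gamma of the connection vanishes to one order more, and r is determined to one
  order more by the requirement that gamma vanishes: every orbit of jets contains exactly one
  normal form, and two normal forms related by a local diffeomorphism with Jacobi matrix A at 0 are
  related by the tensor action of A.

  The polynomial P presenting F in charts is invariant under changes of coordinates, because the
  component of a section of an associated bundle transforms by the Jacobi matrix; to apply this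
  to an arbitrary polynomial connection, one needs a manifold on the given type of points which
  carries it.  If the type has no room for a copy of Euclidean space, all manifolds are empty and
  there is nothing to prove; otherwise such a manifold is transported from Euclidean space.  So P
  takes the same value at a jet and at its normal form, and its restriction to the normal forms is
  the required equivariant map.
\<close>

section \<open>Calculus of smooth functions\<close>

text \<open>Jets are awkward to compose and invert, so the argument runs on germs: a k-jet is a germ
  modulo the power k + 1 of the ideal of germs vanishing at 0. Orders balance as follows. Taking
  second derivatives of a displacement costs two orders, and the two factors of z in
  \<open>gamma\<close> regain them; hence \<open>gamma\<close> of a connection and the displacement
  of a coordinate change can be compared in the same order, and each step gains exactly one. The
  constant (n + 2)(n + 1) is N * N - N for N = n + 2; it arises from applying the Euler operator
  twice and is nonzero since N is at least 2.

  The map f must be polynomial in the coordinates of arbitrary families of homogeneous parts,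
  although only its values on normal forms matter. Feeding P with the derivatives of order n of the
  n-th part makes this automatic, and no extension from a subspace is required.

  The module U lives in an arbitrary normed space with a finite spanning set. Polynomial maps are
  tested there by bounded linear functionals, so it has to be shown that these separate
  points.\<close>

lemma has_frechet_derivative:
  "f differentiable (at x) \<Longrightarrow> (f has_derivative frechet_derivative f (at x)) (at x)"
  by (simp add: frechet_derivative_works)

text \<open>\<open>Ck_on\<close> uses derivatives at points of the ambient space, so agreement on S
  passes on to the derivatives because S is open.\<close>

lemma Ck_on_cong:
  assumes "open S" "\<And>x. x \<in> S \<Longrightarrow> f x = g x" "Ck_on n S f"
  shows "Ck_on n S g"
  using assms(2,3)
proof (induction n arbitrary: f g)
  case 0
  then show ?case using continuous_on_cong[of S S f g] by auto
next
  case (Suc n)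
  have d: "g differentiable at x" "frechet_derivative f (at x) = frechet_derivative g (at x)" if "x \<in> S" for x
  proof -
    have f: "f differentiable at x" using Suc.prems that by auto
    then show "frechet_derivative f (at x) = frechet_derivative g (at x)"
      using frechet_derivative_transform_within_open assms(1) that Suc.prems(1) by blast
    from f show "g differentiable at x"
      by (meson assms(1) differentiable_def has_derivative_transform_within_open Suc.prems(1) that)
  qed
  have "Ck_on n S (\<lambda>x. frechet_derivative g (at x) v)" for v
    using Suc.IH[of "\<lambda>x. frechet_derivative f (at x) v" "\<lambda>x. frechet_derivative g (at x) v"] d Suc.prems
    by auto
  then show ?case using d by auto
qed

text \<open>A derivative at a point is unique, so an explicit formula f' may take the place of the
  chosen \<open>frechet_derivative\<close>; most inductions below go through this rule.\<close>

lemma Ck_on_SucI: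
  assumes "\<And>v. Ck_on n S (\<lambda>x. f' x v)" "open S" "\<And>x. x \<in> S \<Longrightarrow> (f has_derivative f' x) (at x)"
  shows "Ck_on (Suc n) S f"
proof -
  have "Ck_on n S (\<lambda>x. frechet_derivative f (at x) v)" for v
    by (rule Ck_on_cong[OF assms(2) _ assms(1)[of v]]) (simp add: frechet_derivative_at[OF assms(3), symmetric])
  then show ?thesis using assms(3) by (auto simp: differentiable_def)
qed

lemma Ck_on_Suc_imp: "Ck_on (Suc n) S f \<Longrightarrow> Ck_on n S f"
proof (induction n arbitrary: f)
  case 0
  then show ?case
    by (auto intro!: continuous_at_imp_continuous_on differentiable_imp_continuous_within)
next
  case (Suc n)
  then show ?case by (metis Ck_on.simps(2))
qed

lemma Ck_on_subset: "Ck_on n S f \<Longrightarrow> T \<subseteq> S \<Longrightarrow> Ck_on n T f"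
  by (induction n arbitrary: f) (auto intro: continuous_on_subset)

lemma Ck_on_const: "Ck_on n S (\<lambda>x. c)"
  by (induction n arbitrary: c) auto

lemma Ck_on_bounded_linear: "bounded_linear L \<Longrightarrow> Ck_on n S L"
proof (cases n)
  case 0
  assume "bounded_linear L"
  then show ?thesis using 0 by (simp add: linear_continuous_on)
next
  case (Suc k)
  assume L: "bounded_linear L"
  then have "frechet_derivative L (at x) = L" for x
    by (metis bounded_linear_imp_has_derivative frechet_derivative_at)
  then show ?thesis using Suc L by (auto simp: Ck_on_const bounded_linear_imp_differentiable)
qed

lemma Ck_on_linear_comp:
  assumes "open S" "bounded_linear L" "Ck_on n S f"
  shows "Ck_on n S (\<lambda>x. L (f x))"
  using assms(3)
proof (induction n arbitrary: f)
  case 0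
  then show ?case using assms(2)
    by (simp add: bounded_linear.continuous_on)
next
  case (Suc n)
  have d: "((\<lambda>x. L (f x)) has_derivative (\<lambda>v. L (frechet_derivative f (at x) v))) (at x)" if "x \<in> S" for x
    using Suc.prems that by (intro bounded_linear.has_derivative[OF assms(2)] has_frechet_derivative) auto
  have "Ck_on n S (\<lambda>x. L (frechet_derivative f (at x) v))" for v
    using Suc by auto
  then show ?case by (rule Ck_on_SucI[OF _ assms(1) d])
qed

lemma Ck_on_add:
  assumes "open S" "Ck_on n S f" "Ck_on n S g"
  shows "Ck_on n S (\<lambda>x. f x + g x)"
  using assms(2,3)
proof (induction n arbitrary: f g)
  case 0
  then show ?case by (simp add: continuous_on_add)
next
  case (Suc n)
  have d: "((\<lambda>x. f x + g x) has_derivative (\<lambda>v. frechet_derivative f (at x) v + frechet_derivative g (at x) v)) (at x)" if "x \<in> S" for x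
    using Suc.prems that by (intro has_derivative_add has_frechet_derivative) auto
  have "Ck_on n S (\<lambda>x. frechet_derivative f (at x) v + frechet_derivative g (at x) v)" for v
    using Suc by auto
  then show ?case by (rule Ck_on_SucI[OF _ assms(1) d])
qed

lemma Ck_on_sum:
  assumes "open S" "\<And>i. i \<in> I \<Longrightarrow> Ck_on n S (f i)"
  shows "Ck_on n S (\<lambda>x. \<Sum>i\<in>I. f i x)"
  using assms(2) by (induction I rule: infinite_finite_induct) (auto simp: Ck_on_const intro!: Ck_on_add assms(1))

lemma Ck_on_scaleR:
  fixes f :: "'a::real_normed_vector \<Rightarrow> real" and g :: "'a \<Rightarrow> 'b::real_normed_vector"
  assumes "open S" "Ck_on n S f" "Ck_on n S g"
  shows "Ck_on n S (\<lambda>x. f x *\<^sub>R g x)"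
  using assms(2,3)
proof (induction n arbitrary: f g)
  case 0
  then show ?case by (simp add: continuous_on_scaleR)
next
  case (Suc n)
  have d: "((\<lambda>x. f x *\<^sub>R g x) has_derivative (\<lambda>v. f x *\<^sub>R frechet_derivative g (at x) v + frechet_derivative f (at x) v *\<^sub>R g x)) (at x)" if "x \<in> S" for x
    using Suc.prems that by (intro has_derivative_scaleR has_frechet_derivative) auto
  \<comment> \<open>The product rule leaves one factor undifferentiated, and for that factor one
    order of differentiability is given away.\<close>
  have "Ck_on n S (\<lambda>x. f x *\<^sub>R frechet_derivative g (at x) v + frechet_derivative f (at x) v *\<^sub>R g x)" for v
    using Suc.prems Suc.prems[THEN Ck_on_Suc_imp] by (intro Ck_on_add assms(1) Suc.IH) auto
  then show ?case by (rule Ck_on_SucI[OF _ assms(1) d])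
qed

lemma Ck_on_mult:
  fixes f g :: "'a::real_normed_vector \<Rightarrow> real"
  assumes "open S" "Ck_on n S f" "Ck_on n S g"
  shows "Ck_on n S (\<lambda>x. f x * g x)"
  using Ck_on_scaleR[OF assms] by simp

text \<open>In the chain rule the outer map is differentiated in a direction that moves with the
  point, whereas \<open>Ck_on\<close> speaks of fixed directions only. Expanding in basis vectors
  reduces the former to the latter.\<close>

lemma frechet_derivative_expand:
  fixes f :: "real^'m::finite \<Rightarrow> 'b::real_normed_vector"
  assumes "f differentiable at x"
  shows "frechet_derivative f (at x) v = (\<Sum>i\<in>UNIV. v $ i *\<^sub>R frechet_derivative f (at x) (axis i 1))"
proof -
  interpret linear "frechet_derivative f (at x)" using assms by (rule linear_frechet_derivative)
  have "v = (\<Sum>i\<in>UNIV. v $ i *\<^sub>R axis i 1)" by (simp add: basis_expansion flip: scalar_mult_eq_scaleR)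
  then show ?thesis by (metis (no_types, lifting) scale sum sum.cong)
qed

lemma Ck_on_compose:
  fixes f :: "real^'m::finite \<Rightarrow> 'b::real_normed_vector" and g :: "'a::real_normed_vector \<Rightarrow> real^'m"
  assumes "open S" "Ck_on n T f" "Ck_on n S g" "g ` S \<subseteq> T"
  shows "Ck_on n S (\<lambda>x. f (g x))"
  using assms(2,3)
proof (induction n arbitrary: f)
  case 0
  then show ?case using assms(4) continuous_on_compose2 by auto
next
  case (Suc n)
  have d: "((\<lambda>x. f (g x)) has_derivative (\<lambda>v. \<Sum>i\<in>UNIV. frechet_derivative g (at x) v $ i *\<^sub>R frechet_derivative f (at (g x)) (axis i 1))) (at x)"
     if "x \<in> S" for x
  proof -
    have f: "f differentiable at (g x)" and g: "g differentiable at x" using Suc.prems that assms(4) by auto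
    have "((\<lambda>x. f (g x)) has_derivative (\<lambda>v. frechet_derivative f (at (g x)) (frechet_derivative g (at x) v))) (at x)"
      using diff_chain_at[OF has_frechet_derivative[OF g] has_frechet_derivative[OF f]]
      by (simp add: o_def)
    then show ?thesis by (simp only: frechet_derivative_expand[OF f, symmetric])
  qed
  have "Ck_on n S (\<lambda>x. frechet_derivative g (at x) v $ i *\<^sub>R frechet_derivative f (at (g x)) (axis i 1))" for v i
    using Suc.prems Suc.prems[THEN Ck_on_Suc_imp]
    by (intro Ck_on_scaleR assms(1) Suc.IH Ck_on_linear_comp[where L="\<lambda>x. x $ i"] bounded_linear_vec_nth) auto
  then have "Ck_on n S (\<lambda>x. \<Sum>i\<in>UNIV. frechet_derivative g (at x) v $ i *\<^sub>R frechet_derivative f (at (g x)) (axis i 1))" for v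
    by (intro Ck_on_sum assms(1))
  then show ?case by (rule Ck_on_SucI[OF _ assms(1) d])
qed

lemma bounded_linear_axis: "bounded_linear (axis i :: 'b::real_normed_vector \<Rightarrow> 'b^'n::finite)"
proof (rule bounded_linear_intro[where K=1])
  show "norm (axis i x :: 'b^'n) \<le> norm x * 1" for x :: 'b
  proof -
    have "norm (axis i x :: 'b^'n) \<le> (\<Sum>j\<in>UNIV. norm ((axis i x :: 'b^'n) $ j))"
      unfolding norm_vec_def by (rule L2_set_le_sum) simp
    also have "\<dots> = (\<Sum>j\<in>UNIV. if j = i then norm x else 0)"
      by (intro sum.cong) (auto simp: axis_def)
    finally show ?thesis by simp
  qed
qed (auto simp: axis_def vec_eq_iff)

text \<open>The components may lie in any normed space, so that the componentwise criteria can be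
  iterated on nested vectors such as \<open>'m chr\<close>.\<close>

lemma has_derivative_vec_lambda:
  fixes f :: "'a::real_normed_vector \<Rightarrow> 'b::real_normed_vector^'n::finite"
  assumes "\<And>i. ((\<lambda>x. f x $ i) has_derivative (\<lambda>v. f' v $ i)) F"
  shows "(f has_derivative f') F"
proof -
  have eq: "(\<Sum>i\<in>UNIV. axis i (y $ i)) = y" for y :: "'b^'n"
    by (simp add: vec_eq_iff axis_def)
  have "((\<lambda>x. \<Sum>i\<in>UNIV. axis i (f x $ i)) has_derivative (\<lambda>v. \<Sum>i\<in>UNIV. axis i (f' v $ i))) F"
    by (intro has_derivative_sum bounded_linear.has_derivative[OF bounded_linear_axis] assms)
  then show ?thesis by (simp add: eq)
qed

lemma Ck_on_vec_nth:
  fixes f :: "'a::real_normed_vector \<Rightarrow> 'b::real_normed_vector^'n::finite"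
  assumes "open S"
  shows "Ck_on n S f \<longleftrightarrow> (\<forall>i. Ck_on n S (\<lambda>x. f x $ i))"
proof
  assume "Ck_on n S f"
  then show "\<forall>i. Ck_on n S (\<lambda>x. f x $ i)"
    using Ck_on_linear_comp[OF assms bounded_linear_vec_nth] by blast
next
  assume "\<forall>i. Ck_on n S (\<lambda>x. f x $ i)"
  then show "Ck_on n S f"
  proof (induction n arbitrary: f)
    case 0
    then show ?case using continuous_on_vec_lambda[of S "\<lambda>i x. f x $ i"] by auto
  next
    case (Suc n)
    have d: "(f has_derivative (\<lambda>v. \<chi> i. frechet_derivative (\<lambda>x. f x $ i) (at x) v)) (at x)" if "x \<in> S" for x
    proof -
      have "((\<lambda>x. f x $ i) has_derivative frechet_derivative (\<lambda>x. f x $ i) (at x)) (at x)" for i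
        using Suc.prems that by (intro has_frechet_derivative) auto
      then show ?thesis by (intro has_derivative_vec_lambda) simp
    qed
    have "Ck_on n S (\<lambda>x. \<chi> i. frechet_derivative (\<lambda>x. f x $ i) (at x) v)" for v
      using Suc by (intro Suc.IH) auto
    then show ?case by (rule Ck_on_SucI[OF _ assms(1) d])
  qed
qed

lemma Ck_on_inverse:
  fixes f :: "'a::real_normed_vector \<Rightarrow> real"
  assumes "open S" "Ck_on n S f" "\<And>x. x \<in> S \<Longrightarrow> f x \<noteq> 0"
  shows "Ck_on n S (\<lambda>x. inverse (f x))"
  using assms(2)
proof (induction n)
  case 0
  then show ?case using assms(3) by (simp add: continuous_on_inverse)
next
  case (Suc n)
  have d: "((\<lambda>x. inverse (f x)) has_derivative (\<lambda>v. (-1) * (inverse (f x) * frechet_derivative f (at x) v * inverse (f x)))) (at x)" if "x \<in> S" for x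
  proof -
    have "(f has_derivative frechet_derivative f (at x)) (at x)"
      using Suc.prems that by (intro has_frechet_derivative) auto
    from Deriv.has_derivative_inverse[OF assms(3)[OF that] this] show ?thesis by simp
  qed
  have "Ck_on n S (\<lambda>x. (-1) * (inverse (f x) * frechet_derivative f (at x) v * inverse (f x)))" for v
    using Suc Ck_on_Suc_imp[OF Suc.prems] by (intro Ck_on_mult Ck_on_const assms(1)) auto
  then show ?case by (rule Ck_on_SucI[OF _ assms(1) d])
qed

lemma Ck_on_prod:
  fixes f :: "'i \<Rightarrow> 'a::real_normed_vector \<Rightarrow> real"
  assumes "open S" "\<And>i. i \<in> I \<Longrightarrow> Ck_on n S (f i)"
  shows "Ck_on n S (\<lambda>x. \<Prod>i\<in>I. f i x)"
  using assms(2) by (induction I rule: infinite_finite_induct) (auto simp: Ck_on_const intro!: Ck_on_mult assms(1))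

section \<open>Symmetry of second derivatives\<close>

lemma second_difference_mean_value:
  fixes f :: "real^'m::finite \<Rightarrow> real"
  assumes "Ck_on 2 (ball x e) f" "t > 0" "t * (norm u + norm v) < e"
  shows "\<exists>a b. 0 < a \<and> a < t \<and> 0 < b \<and> b < t \<and>
    f (x + t *\<^sub>R u + t *\<^sub>R v) - f (x + t *\<^sub>R u) - f (x + t *\<^sub>R v) + f x =
      t * t * frechet_derivative (\<lambda>y. frechet_derivative f (at y) u) (at (x + a *\<^sub>R u + b *\<^sub>R v)) v"
proof -
  define D where "D y = frechet_derivative f (at y) u" for y
  have inb: "x + s *\<^sub>R u + r *\<^sub>R v \<in> ball x e" if "0 \<le> s" "s \<le> t" "0 \<le> r" "r \<le> t" for s r
  proof -
    have "norm (s *\<^sub>R u + r *\<^sub>R v) \<le> s * norm u + r * norm v"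
      using norm_triangle_ineq[of "s *\<^sub>R u" "r *\<^sub>R v"] that by simp
    also have "\<dots> \<le> t * norm u + t * norm v" using that by (intro add_mono mult_right_mono) auto
    also have "\<dots> < e" using assms(3) by (simp add: algebra_simps)
    finally have "dist (x + s *\<^sub>R u + r *\<^sub>R v) x < e" by (simp add: dist_norm add.assoc)
    then show ?thesis by (simp add: dist_commute)
  qed
  have fd: "(f has_derivative frechet_derivative f (at y)) (at y)" if "y \<in> ball x e" for y
    using assms(1) that by (intro has_frechet_derivative) (auto simp: numeral_2_eq_2)
  have Dd: "(D has_derivative frechet_derivative D (at y)) (at y)" if "y \<in> ball x e" for y
    using assms(1) that by (intro has_frechet_derivative) (auto simp: numeral_2_eq_2 D_def[abs_def])
  have fu: "((\<lambda>s. f (x + s *\<^sub>R u + r *\<^sub>R v)) has_real_derivative D (x + s *\<^sub>R u + r *\<^sub>R v)) (at s)"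
    if "0 \<le> s" "s \<le> t" "0 \<le> r" "r \<le> t" for s r
  proof -
    have i: "((\<lambda>s. x + s *\<^sub>R u + r *\<^sub>R v) has_derivative (\<lambda>h. h *\<^sub>R u)) (at s)"
      by (auto intro!: derivative_eq_intros)
    have "linear (frechet_derivative f (at (x + s *\<^sub>R u + r *\<^sub>R v)))"
      using fd[OF inb[OF that]] has_derivative_linear by blast
    then have l: "frechet_derivative f (at (x + s *\<^sub>R u + r *\<^sub>R v)) (h *\<^sub>R u) = h * D (x + s *\<^sub>R u + r *\<^sub>R v)" for h
      by (simp add: D_def linear_cmul)
    have "(\<lambda>h. h * D (x + s *\<^sub>R u + r *\<^sub>R v)) = (*) (D (x + s *\<^sub>R u + r *\<^sub>R v))"
      by (simp add: fun_eq_iff)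
    then show ?thesis using diff_chain_at[OF i fd[OF inb[OF that]]]
      by (simp add: has_field_derivative_def o_def l)
  qed
  \<comment> \<open>First mean value theorem, in the direction u, for the difference of f under the
    shift by t v. The terms \<open>0 *\<^sub>R v\<close> are kept so that \<open>fu\<close> applies
    to both summands.\<close>
  have "\<exists>a. 0 < a \<and> a < t \<and>
     (f (x + t *\<^sub>R u + t *\<^sub>R v) - f (x + t *\<^sub>R u + 0 *\<^sub>R v)) - (f (x + 0 *\<^sub>R u + t *\<^sub>R v) - f (x + 0 *\<^sub>R u + 0 *\<^sub>R v)) = (t - 0) *
       (D (x + a *\<^sub>R u + t *\<^sub>R v) - D (x + a *\<^sub>R u + 0 *\<^sub>R v))"
    by (rule MVT2[OF \<open>t > 0\<close>]) (use assms(2) in \<open>auto intro!: DERIV_diff fu simp del: scaleR_zero_left\<close>)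
  then obtain a where a: "0 < a" "a < t" and
    ae: "(f (x + t *\<^sub>R u + t *\<^sub>R v) - f (x + t *\<^sub>R u)) - (f (x + t *\<^sub>R v) - f x) = t *
       (D (x + a *\<^sub>R u + t *\<^sub>R v) - D (x + a *\<^sub>R u))" by auto
  have Dv: "((\<lambda>s. D (x + a *\<^sub>R u + s *\<^sub>R v)) has_real_derivative frechet_derivative D (at (x + a *\<^sub>R u + s *\<^sub>R v)) v) (at s)"
    if "0 \<le> s" "s \<le> t" for s
  proof -
    have i: "((\<lambda>s. x + a *\<^sub>R u + s *\<^sub>R v) has_derivative (\<lambda>h. h *\<^sub>R v)) (at s)"
      by (auto intro!: derivative_eq_intros)
    have "linear (frechet_derivative D (at (x + a *\<^sub>R u + s *\<^sub>R v)))"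
      using a that by (intro has_derivative_linear[OF Dd] inb) auto
    then have l: "frechet_derivative D (at (x + a *\<^sub>R u + s *\<^sub>R v)) (h *\<^sub>R v) = h * frechet_derivative D (at (x + a *\<^sub>R u + s *\<^sub>R v)) v" for h
      by (simp add: linear_cmul)
    have "(\<lambda>h. h * frechet_derivative D (at (x + a *\<^sub>R u + s *\<^sub>R v)) v) = (*) (frechet_derivative D (at (x + a *\<^sub>R u + s *\<^sub>R v)) v)"
      by (simp add: fun_eq_iff)
    then show ?thesis using diff_chain_at[OF i Dd[OF inb[of a s]]] a that
      by (simp add: has_field_derivative_def o_def l)
  qed
  \<comment> \<open>Second mean value theorem, in the direction v, for the directional derivative
    D.\<close>
  have "\<exists>b. 0 < b \<and> b < t \<and>
     D (x + a *\<^sub>R u + t *\<^sub>R v) - D (x + a *\<^sub>R u + 0 *\<^sub>R v) = (t - 0) * frechet_derivative D (at (x + a *\<^sub>R u + b *\<^sub>R v)) v"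
    by (rule MVT2[OF \<open>t > 0\<close>]) (auto intro!: Dv)
  then obtain b where b: "0 < b" "b < t"
    "D (x + a *\<^sub>R u + t *\<^sub>R v) - D (x + a *\<^sub>R u) = t * frechet_derivative D (at (x + a *\<^sub>R u + b *\<^sub>R v)) v" by auto
  then show ?thesis using a ae by (intro exI[of _ a] exI[of _ b]) (simp add: D_def[abs_def] algebra_simps)
qed

lemma second_difference_limit:
  fixes f :: "real^'m::finite \<Rightarrow> real"
  assumes "open S" "x \<in> S" "Ck_on 2 S f"
  shows "((\<lambda>t. (f (x + t *\<^sub>R u + t *\<^sub>R v) - f (x + t *\<^sub>R u) - f (x + t *\<^sub>R v) + f x) / (t * t)) \<longlongrightarrow>
    frechet_derivative (\<lambda>y. frechet_derivative f (at y) u) (at x) v) (at_right 0)"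
proof -
  obtain e where e: "e > 0" "ball x e \<subseteq> S" using assms openE by blast
  define G where "G y = frechet_derivative (\<lambda>y. frechet_derivative f (at y) u) (at y) v" for y
  have C: "Ck_on 2 (ball x e) f" using assms(3) e Ck_on_subset by blast
  have "continuous_on S G" using assms(3) by (auto simp: G_def[abs_def] numeral_2_eq_2)
  then have G: "(G \<longlongrightarrow> G x) (nhds x)" 
    using assms(1,2) by (metis at_within_open continuous_on_def tendsto_at_iff_tendsto_nhds)
  \<comment> \<open>The summand 1 keeps M positive even for u = v = 0, so that t can be bounded by
    \<open>min e r / M\<close>.\<close>
  define M where "M = norm u + norm v + 1"
  have M: "M > 0" "norm u + norm v < M" by (auto simp: M_def add_nonneg_pos)
  show ?thesis unfolding G_def[symmetric]
  proof (rule tendstoI)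
    fix d :: real assume "d > 0"
    then obtain r where r: "r > 0" "\<And>y. dist y x < r \<Longrightarrow> dist (G y) (G x) < d"
      using G unfolding tendsto_iff eventually_nhds_metric by blast
    have "dist ((f (x + t *\<^sub>R u + t *\<^sub>R v) - f (x + t *\<^sub>R u) - f (x + t *\<^sub>R v) + f x) / (t * t)) (G x) < d"
      if t: "0 < t" "t < min e r / M" for t
    proof -
      have tm: "t * M < min e r" using t M by (simp add: pos_less_divide_eq del: min_less_iff_conj)
      have "t * (norm u + norm v) < t * M" using t M by simp
      then have "t * (norm u + norm v) < e" using tm by linarith
      from second_difference_mean_value[OF C t(1) this] obtain a b where ab: "0 < a" "a < t" "0 < b" "b < t"
        and eq: "f (x + t *\<^sub>R u + t *\<^sub>R v) - f (x + t *\<^sub>R u) - f (x + t *\<^sub>R v) + f x = t * t * G (x + a *\<^sub>R u + b *\<^sub>R v)"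
        unfolding G_def by blast
      have "dist (x + a *\<^sub>R u + b *\<^sub>R v) x = norm (a *\<^sub>R u + b *\<^sub>R v)" by (simp add: dist_norm add.assoc)
      also have "\<dots> \<le> a * norm u + b * norm v"
        using norm_triangle_ineq[of "a *\<^sub>R u" "b *\<^sub>R v"] ab by simp
      also have "\<dots> \<le> t * norm u + t * norm v" using ab by (intro add_mono mult_right_mono) auto
      also have "\<dots> < r" using tm M t \<open>t * (norm u + norm v) < t * M\<close> by (simp add: algebra_simps)
      finally have "dist (G (x + a *\<^sub>R u + b *\<^sub>R v)) (G x) < d" by (rule r)
      then show ?thesis using eq t by simp
    qed
    then show "\<forall>\<^sub>F t in at_right 0. dist ((f (x + t *\<^sub>R u + t *\<^sub>R v) - f (x + t *\<^sub>R u) - f (x + t *\<^sub>R v) + f x) / (t * t)) (G x) < d"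
      using M e r by (auto simp: eventually_at_right intro!: exI[of _ "min e r / M"])
  qed
qed

text \<open>The second difference quotient of f is symmetric in u and v.\<close>

lemma second_derivative_symmetric:
  fixes f :: "real^'m::finite \<Rightarrow> real"
  assumes "open S" "x \<in> S" "Ck_on 2 S f"
  shows "frechet_derivative (\<lambda>y. frechet_derivative f (at y) u) (at x) v =
         frechet_derivative (\<lambda>y. frechet_derivative f (at y) v) (at x) u"
proof -
  note l = second_difference_limit[OF assms]
  have "(\<lambda>t. (f (x + t *\<^sub>R u + t *\<^sub>R v) - f (x + t *\<^sub>R u) - f (x + t *\<^sub>R v) + f x) / (t * t)) =
     (\<lambda>t. (f (x + t *\<^sub>R v + t *\<^sub>R u) - f (x + t *\<^sub>R v) - f (x + t *\<^sub>R u) + f x) / (t * t))"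
    by (auto simp: algebra_simps)
  then show ?thesis
    using tendsto_unique[OF trivial_limit_at_right_real l[of u v]] l[of v u] by simp
qed


section \<open>Germs vanishing to a given order\<close>

text \<open>Germs avoid shrinking domains by hand when maps are composed and inverted: identities
  are only needed eventually in \<open>nhds x\<close>.\<close>

definition smooth_at :: "'a::real_normed_vector \<Rightarrow> ('a \<Rightarrow> 'b::real_normed_vector) \<Rightarrow> bool"
  where "smooth_at x f \<longleftrightarrow> (\<exists>S. open S \<and> x \<in> S \<and> smooth_on S f)"

definition pd :: "'m \<Rightarrow> (real^'m::finite \<Rightarrow> 'b::real_normed_vector) \<Rightarrow> real^'m \<Rightarrow> 'b"
  where "pd i f = (\<lambda>x. frechet_derivative f (at x) (axis i 1))"

lemma smooth_atI: "open S \<Longrightarrow> x \<in> S \<Longrightarrow> smooth_on S f \<Longrightarrow> smooth_at x f"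
  by (auto simp: smooth_at_def)

text \<open>Continuity and differentiability are conditions at single points, so a neighbourhood of
  each point suffices. This identifies \<open>smooth_on\<close> on an open set with
  \<open>smooth_at\<close> at all its points.\<close>

lemma Ck_on_local:
  assumes "\<And>x. x \<in> S \<Longrightarrow> \<exists>T. open T \<and> x \<in> T \<and> Ck_on n T f"
  shows "Ck_on n S f"
  using assms
proof (induction n arbitrary: f)
  case 0
  have "continuous (at x) f" if "x \<in> S" for x
    using 0[OF that] by (auto simp: continuous_on_eq_continuous_at)
  then show ?case by (simp add: continuous_at_imp_continuous_on)
next
  case (Suc n)
  have "f differentiable (at x)" if "x \<in> S" for x using Suc.prems[OF that] by auto
  moreover have "Ck_on n S (\<lambda>x. frechet_derivative f (at x) v)" for v
    using Suc.prems by (intro Suc.IH) (metis Ck_on.simps(2))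
  ultimately show ?case by simp
qed

lemma smooth_on_iff_smooth_at: "open S \<Longrightarrow> smooth_on S f \<longleftrightarrow> (\<forall>x\<in>S. smooth_at x f)"
  unfolding smooth_on_def
  by (auto simp: smooth_at_def smooth_on_def intro!: Ck_on_local)

lemma smooth_on_subset: "smooth_on S f \<Longrightarrow> T \<subseteq> S \<Longrightarrow> smooth_on T f"
  using Ck_on_subset unfolding smooth_on_def by blast

lemma smooth_on_frechet: "smooth_on S f \<Longrightarrow> smooth_on S (\<lambda>x. frechet_derivative f (at x) v)"
  unfolding smooth_on_def by (metis Ck_on.simps(2))

lemma smooth_at_frechet: "smooth_at x f \<Longrightarrow> smooth_at x (\<lambda>x. frechet_derivative f (at x) v)"
  unfolding smooth_at_def using smooth_on_frechet by blast

lemma smooth_at_pd: "smooth_at x f \<Longrightarrow> smooth_at x (pd i f)"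
  unfolding pd_def by (rule smooth_at_frechet)

lemma smooth_at_differentiable: "smooth_at x f \<Longrightarrow> f differentiable (at x)"
  unfolding smooth_at_def smooth_on_def by (metis Ck_on.simps(2))

lemma smooth_at_continuous: "smooth_at x f \<Longrightarrow> isCont f x"
  by (simp add: differentiable_imp_continuous_within smooth_at_differentiable)

lemma smooth_at_eventually: "smooth_at x f \<Longrightarrow> \<forall>\<^sub>F y in nhds x. smooth_at y f"
  unfolding smooth_at_def eventually_nhds by auto

lemma smooth_at_cong:
  assumes "smooth_at x f" "\<forall>\<^sub>F y in nhds x. f y = g y"
  shows "smooth_at x g"
proof -
  obtain S where S: "open S" "x \<in> S" "smooth_on S f" using assms(1) by (auto simp: smooth_at_def)
  obtain T where T: "open T" "x \<in> T" "\<And>y. y \<in> T \<Longrightarrow> f y = g y"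
    using assms(2) by (auto simp: eventually_nhds)
  have "Ck_on n (S \<inter> T) g" for n
    by (rule Ck_on_cong[where f = f]) (use S T Ck_on_subset[of n S f "S \<inter> T"] in \<open>auto simp: smooth_on_def\<close>)
  then show ?thesis using S T by (intro smooth_atI[of "S \<inter> T"]) (auto simp: smooth_on_def)
qed

lemma smooth_at_const: "smooth_at x (\<lambda>_. c)"
  by (rule smooth_atI[of UNIV]) (auto simp: smooth_on_def Ck_on_const)

lemma smooth_at_bounded_linear: "bounded_linear L \<Longrightarrow> smooth_at x L"
  by (rule smooth_atI[of UNIV]) (auto simp: smooth_on_def Ck_on_bounded_linear)

lemma smooth_at_nth: "smooth_at x (\<lambda>z. z $ i)"
  by (rule smooth_at_bounded_linear[OF bounded_linear_vec_nth])

lemma smooth_at_ident: "smooth_at x (\<lambda>z. z)"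
  by (rule smooth_at_bounded_linear[OF bounded_linear_ident])

lemma smooth_at_linear_comp:
  assumes "bounded_linear L" "smooth_at x f"
  shows "smooth_at x (\<lambda>x. L (f x))"
proof -
  obtain S where S: "open S" "x \<in> S" "smooth_on S f" using assms(2) by (auto simp: smooth_at_def)
  then show ?thesis
    by (intro smooth_atI[of S]) (auto simp: smooth_on_def intro: Ck_on_linear_comp[OF S(1) assms(1)])
qed

lemma smooth_at_common_nhd:
  assumes "smooth_at x f" "smooth_at x g"
  obtains S where "open S" "x \<in> S" "smooth_on S f" "smooth_on S g"
proof -
  obtain S T where S: "open S" "x \<in> S" "smooth_on S f" and T: "open T" "x \<in> T" "smooth_on T g"
    using assms by (auto simp: smooth_at_def)
  show thesis
    by (rule that[of "S \<inter> T"]) (use S T in \<open>auto intro: smooth_on_subset\<close>)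
qed

lemma smooth_at_add:
  assumes "smooth_at x f" "smooth_at x g"
  shows "smooth_at x (\<lambda>y. f y + g y)"
  by (rule smooth_at_common_nhd[OF assms]) (auto simp: smooth_on_def intro!: smooth_atI Ck_on_add)

lemma smooth_at_scaleR:
  assumes "smooth_at x f" "smooth_at x g"
  shows "smooth_at x (\<lambda>y. f y *\<^sub>R g y)"
  by (rule smooth_at_common_nhd[OF assms]) (auto simp: smooth_on_def intro!: smooth_atI Ck_on_scaleR)

lemma smooth_at_mult:
  fixes f g :: "_ \<Rightarrow> real"
  assumes "smooth_at x f" "smooth_at x g"
  shows "smooth_at x (\<lambda>y. f y * g y)"
  using smooth_at_scaleR[OF assms] by simp

lemma smooth_at_uminus: "smooth_at x f \<Longrightarrow> smooth_at x (\<lambda>y. - f y)"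
  using smooth_at_scaleR[OF smooth_at_const[of x "-1"], of f] by simp

lemma smooth_at_diff:
  assumes "smooth_at x f" "smooth_at x g"
  shows "smooth_at x (\<lambda>y. f y - g y)"
  using smooth_at_add[OF assms(1) smooth_at_uminus[OF assms(2)]] by simp

lemma smooth_at_sum: "(\<And>i. i \<in> I \<Longrightarrow> smooth_at x (f i)) \<Longrightarrow> smooth_at x (\<lambda>y. \<Sum>i\<in>I. f i y)"
  by (induction I rule: infinite_finite_induct) (auto simp: smooth_at_const intro!: smooth_at_add)

lemma smooth_at_compose:
  fixes f :: "real^'m::finite \<Rightarrow> 'b::real_normed_vector" and g :: "'a::real_normed_vector \<Rightarrow> real^'m"
  assumes "smooth_at x g" "smooth_at (g x) f"
  shows "smooth_at x (\<lambda>y. f (g y))"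
proof -
  obtain S where S: "open S" "x \<in> S" "smooth_on S g" using assms by (auto simp: smooth_at_def)
  obtain T where T: "open T" "g x \<in> T" "smooth_on T f" using assms by (auto simp: smooth_at_def)
  have "continuous_on S g" using S(3) by (metis Ck_on.simps(1) smooth_on_def)
  then have o: "open (S \<inter> g -` T)" using continuous_open_preimage S(1) T(1) by blast
  have "Ck_on n (S \<inter> g -` T) (\<lambda>y. f (g y))" for n
  proof (rule Ck_on_compose[OF o])
    show "Ck_on n T f" using T(3) by (simp add: smooth_on_def)
    show "Ck_on n (S \<inter> g -` T) g" using S(3) by (auto simp: smooth_on_def intro: Ck_on_subset)
  qed auto
  then show ?thesis using S T by (intro smooth_atI[OF o]) (auto simp: smooth_on_def)
qed

lemma smooth_at_vec_iff:
  fixes f :: "'a::real_normed_vector \<Rightarrow> 'b::real_normed_vector^'n::finite"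
  shows "smooth_at x f \<longleftrightarrow> (\<forall>i. smooth_at x (\<lambda>x. f x $ i))"
proof
  assume "smooth_at x f"
  then show "\<forall>i. smooth_at x (\<lambda>x. f x $ i)"
    using smooth_at_linear_comp[OF bounded_linear_vec_nth] by blast
next
  assume "\<forall>i. smooth_at x (\<lambda>x. f x $ i)"
  then obtain S where S: "\<And>i. open (S i) \<and> x \<in> S i \<and> smooth_on (S i) (\<lambda>x. f x $ i)"
    unfolding smooth_at_def by metis
  \<comment> \<open>The index type is finite, so one open neighbourhood serves all
    components.\<close>
  have o: "open (\<Inter>i. S i)" using S by auto
  have "Ck_on n (\<Inter>i. S i) (\<lambda>x. f x $ i)" for n i
    using S[of i] by (auto simp: smooth_on_def intro: Ck_on_subset)
  then show "smooth_at x f" using S by (intro smooth_atI[OF o]) (auto simp: smooth_on_def Ck_on_vec_nth[OF o])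
qed

lemma smooth_at_polynomial:
  fixes p :: "'a::real_normed_vector \<Rightarrow> real"
  shows "real_polynomial_function p \<Longrightarrow> smooth_at x p"
  by (induction rule: real_polynomial_function.induct)
    (auto intro: smooth_at_bounded_linear smooth_at_const smooth_at_add smooth_at_mult)

section \<open>Partial derivatives of germs\<close>

lemma frechet_derivative_cong:
  assumes "\<forall>\<^sub>F y in nhds x. f y = g y"
  shows "frechet_derivative f (at x) = frechet_derivative g (at x)"
proof -
  obtain T where T: "open T" "x \<in> T" "\<And>y. y \<in> T \<Longrightarrow> f y = g y"
    using assms(1) by (auto simp: eventually_nhds)
  have "(f has_derivative D) (at x) \<longleftrightarrow> (g has_derivative D) (at x)" for D
    using T has_derivative_transform_within_open[of f D x UNIV T g] has_derivative_transform_within_open[of g D x UNIV T f] by auto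
  then show ?thesis by (simp add: frechet_derivative_def)
qed

lemma pd_cong: "\<forall>\<^sub>F y in nhds x. f y = g y \<Longrightarrow> pd i f x = pd i g x"
  by (simp add: pd_def frechet_derivative_cong)

text \<open>Agreement near x is also agreement near each point close to x; hence it survives any
  number of derivatives.\<close>

lemma pd_cong_eventually:
  assumes "\<forall>\<^sub>F y in nhds x. f y = g y"
  shows "\<forall>\<^sub>F y in nhds x. pd i f y = pd i g y"
proof -
  have "\<forall>\<^sub>F y in nhds x. \<forall>\<^sub>F y in nhds y. f y = g y" using assms by (simp add: eventually_eventually)
  then show ?thesis by (rule eventually_mono) (rule pd_cong)
qed

lemma has_derivative_imp_pd: "(f has_derivative D) (at x) \<Longrightarrow> pd i f x = D (axis i 1)"
  by (metis frechet_derivative_at pd_def)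

lemma pd_const [simp]: "pd i (\<lambda>_. c) x = 0"
  by (simp add: pd_def)

lemma pd_nth: "pd i (\<lambda>z. z $ j) x = (if i = j then 1 else 0)"
  using has_derivative_imp_pd[OF bounded_linear_imp_has_derivative[OF bounded_linear_vec_nth[of j]], of i x]
  by (simp add: axis_def)

lemma pd_add:
  assumes "smooth_at x f" "smooth_at x g"
  shows "pd i (\<lambda>y. f y + g y) x = pd i f x + pd i g x"
  using has_derivative_imp_pd[OF has_derivative_add[OF assms[THEN smooth_at_differentiable, THEN has_frechet_derivative]]]
  by (simp add: pd_def)

lemma pd_linear_comp:
  assumes "bounded_linear L" "smooth_at x f"
  shows "pd i (\<lambda>y. L (f y)) x = L (pd i f x)"
  using has_derivative_imp_pd[OF bounded_linear.has_derivative[OF assms(1) assms(2)[THEN smooth_at_differentiable, THEN has_frechet_derivative]]]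
  by (simp add: pd_def)

lemma pd_vec_nth: "smooth_at x f \<Longrightarrow> pd i (\<lambda>y. f y $ j) x = pd i f x $ j"
  by (rule pd_linear_comp[OF bounded_linear_vec_nth])

lemma pd_uminus: "smooth_at x f \<Longrightarrow> pd i (\<lambda>y. - f y) x = - pd i f x"
  by (rule pd_linear_comp[OF bounded_linear_minus[OF bounded_linear_ident]])

lemma pd_diff:
  assumes "smooth_at x f" "smooth_at x g"
  shows "pd i (\<lambda>y. f y - g y) x = pd i f x - pd i g x"
  using pd_add[OF assms(1) smooth_at_uminus[OF assms(2)]] pd_uminus[OF assms(2)] by simp

lemma pd_mult:
  fixes f g :: "real^'m::finite \<Rightarrow> real"
  assumes "smooth_at x f" "smooth_at x g"
  shows "pd i (\<lambda>y. f y * g y) x = f x * pd i g x + pd i f x * g x"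
  using has_derivative_imp_pd[OF has_derivative_mult[OF assms[THEN smooth_at_differentiable, THEN has_frechet_derivative]]]
  by (simp add: pd_def)

lemma pd_sum:
  assumes "\<And>j. j \<in> I \<Longrightarrow> smooth_at x (f j)"
  shows "pd i (\<lambda>y. \<Sum>j\<in>I. f j y) x = (\<Sum>j\<in>I. pd i (f j) x)"
  using has_derivative_imp_pd[OF has_derivative_sum[of I f, OF assms[THEN smooth_at_differentiable, THEN has_frechet_derivative]]]
  by (simp add: pd_def)

lemma frechet_derivative_pd:
  fixes f :: "real^'m::finite \<Rightarrow> 'b::real_normed_vector"
  assumes "smooth_at x f"
  shows "frechet_derivative f (at x) v = (\<Sum>i\<in>UNIV. v $ i *\<^sub>R pd i f x)"
  unfolding pd_def by (rule frechet_derivative_expand[OF smooth_at_differentiable[OF assms]])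

lemma pd_compose:
  fixes f :: "real^'m::finite \<Rightarrow> real" and g :: "real^'k::finite \<Rightarrow> real^'m"
  assumes "smooth_at x g" "smooth_at (g x) f"
  shows "pd i (\<lambda>y. f (g y)) x = (\<Sum>j\<in>UNIV. pd j f (g x) * pd i (\<lambda>y. g y $ j) x)"
proof -
  have "pd i (f \<circ> g) x = frechet_derivative f (at (g x)) (pd i g x)"
    using has_derivative_imp_pd[OF diff_chain_at[OF assms[THEN smooth_at_differentiable, THEN has_frechet_derivative]]]
    by (simp add: pd_def)
  also have "\<dots> = (\<Sum>j\<in>UNIV. pd j f (g x) * pd i (\<lambda>y. g y $ j) x)"
    by (simp add: frechet_derivative_pd[OF assms(2)] pd_vec_nth[OF assms(1)] mult.commute)
  finally show ?thesis by (simp add: o_def)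
qed

lemma pd_commute:
  fixes f :: "real^'m::finite \<Rightarrow> real"
  assumes "smooth_at x f"
  shows "pd i (pd j f) x = pd j (pd i f) x"
proof -
  obtain S where "open S" "x \<in> S" "smooth_on S f" using assms by (auto simp: smooth_at_def)
  then show ?thesis unfolding pd_def by (intro second_derivative_symmetric[of S]) (auto simp: smooth_on_def)
qed

text \<open>The definition of \<open>pderivs\<close> peels off the outermost derivative, whereas the
  recursions of \<open>vanish\<close> and \<open>taylor_sum\<close> peel off the innermost
  one.\<close>

lemma pderivs_snoc: "pderivs (is @ [i]) f = pderivs is (pd i f)"
  by (induction "is") (auto simp: pd_def)

lemma pderivs_Cons: "pderivs (i # is) f = pd i (pderivs is f)"
  by (auto simp: pd_def)

text \<open>Membership of a germ in the n-th power of the ideal of germs vanishing at x. The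
  recursion through first partial derivatives turns the product and chain rules into inductions,
  without multi-indices or estimates of remainders.\<close>

primrec vanish :: "nat \<Rightarrow> real^'m::finite \<Rightarrow> (real^'m \<Rightarrow> real) \<Rightarrow> bool" where
  "vanish 0 x f \<longleftrightarrow> smooth_at x f"
| "vanish (Suc n) x f \<longleftrightarrow> smooth_at x f \<and> f x = 0 \<and> (\<forall>i. vanish n x (pd i f))"

lemma vanish_smooth: "vanish n x f \<Longrightarrow> smooth_at x f"
  by (cases n) auto

lemma vanish_Suc_imp: "vanish (Suc n) x f \<Longrightarrow> vanish n x f"
  by (induction n arbitrary: f) auto

lemma vanish_mono: "vanish n x f \<Longrightarrow> m \<le> n \<Longrightarrow> vanish m x f"
  by (rotate_tac, induction rule: inc_induct) (blast intro: vanish_Suc_imp)+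

lemma vanish_pd: "vanish n x f \<Longrightarrow> vanish (n - 1) x (pd i f)"
  by (cases n) (auto intro: smooth_at_pd)

lemma vanish_value: "vanish n x f \<Longrightarrow> 0 < n \<Longrightarrow> f x = 0"
  by (cases n) auto

lemma vanish_cong:
  assumes "vanish n x f" "\<forall>\<^sub>F y in nhds x. f y = g y"
  shows "vanish n x g"
  using assms
proof (induction n arbitrary: f g)
  case 0
  then show ?case by (auto intro: smooth_at_cong)
next
  case (Suc n)
  have "vanish n x (pd i g)" for i
    by (rule Suc.IH[of "pd i f"]) (use Suc.prems pd_cong_eventually in auto)
  then show ?case using Suc.prems eventually_nhds_x_imp_x[OF Suc.prems(2)] by (auto intro: smooth_at_cong)
qed

lemma vanish_zero: "vanish n x (\<lambda>_. 0)"
  by (induction n) (auto simp: smooth_at_const pd_const[abs_def])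

lemma vanish_add:
  assumes "vanish n x f" "vanish n x g"
  shows "vanish n x (\<lambda>y. f y + g y)"
  using assms
proof (induction n arbitrary: f g)
  case 0
  then show ?case by (auto intro: smooth_at_add)
next
  case (Suc n)
  have sm: "smooth_at x f" "smooth_at x g" using Suc.prems by auto
  have "\<forall>\<^sub>F y in nhds x. pd i f y + pd i g y = pd i (\<lambda>y. f y + g y) y" for i
    using sm[THEN smooth_at_eventually] by eventually_elim (simp add: pd_add)
  moreover have "vanish n x (\<lambda>y. pd i f y + pd i g y)" for i
    using Suc by simp
  ultimately have "vanish n x (pd i (\<lambda>y. f y + g y))" for i
    using vanish_cong by blast
  then show ?case using Suc.prems by (simp add: smooth_at_add)
qed

lemma vanish_sum: "(\<And>i. i \<in> I \<Longrightarrow> vanish n x (f i)) \<Longrightarrow> vanish n x (\<lambda>y. \<Sum>i\<in>I. f i y)"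
  by (induction I rule: infinite_finite_induct) (auto simp: vanish_zero intro!: vanish_add)

text \<open>By the Leibniz rule a derivative lowers the order of the factor it hits by one. A factor
  of order 0 has nothing to lose; in that case the order of the other factor is weakened
  instead.\<close>

lemma vanish_mult:
  assumes "vanish a x f" "vanish b x g"
  shows "vanish (a + b) x (\<lambda>y. f y * g y)"
proof -
  have "vanish n x (\<lambda>y. f y * g y)" if "n = a + b" for n
    using assms that
  proof (induction n arbitrary: a b f g)
    case 0
    then show ?case by (auto intro: smooth_at_mult)
  next
    case (Suc n)
    have sm: "smooth_at x f" "smooth_at x g" using Suc.prems vanish_smooth by auto
    have "\<forall>\<^sub>F y in nhds x. f y * pd i g y + pd i f y * g y = pd i (\<lambda>y. f y * g y) y" for i
      using sm[THEN smooth_at_eventually] by eventually_elim (simp add: pd_mult)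
    moreover have "vanish n x (\<lambda>y. f y * pd i g y)" for i
    proof (cases b)
      case 0
      then have "vanish n x f" using Suc.prems by (auto dest: vanish_Suc_imp simp del: vanish.simps)
      from Suc.IH[OF this, of 0 "pd i g"] show ?thesis using sm by (simp add: smooth_at_pd)
    next
      case (Suc c)
      then show ?thesis using Suc.prems by (intro Suc.IH[of a f c "pd i g"]) auto
    qed
    moreover have "vanish n x (\<lambda>y. pd i f y * g y)" for i
    proof (cases a)
      case 0
      then have "vanish n x g" using Suc.prems by (auto dest: vanish_Suc_imp simp del: vanish.simps)
      from Suc.IH[OF _ this, of 0 "pd i f"] show ?thesis using sm by (simp add: smooth_at_pd)
    next
      case (Suc c)
      then show ?thesis using Suc.prems by (intro Suc.IH[of c "pd i f" b g]) auto
    qed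
    ultimately have "vanish n x (pd i (\<lambda>y. f y * g y))" for i
      using vanish_cong[OF vanish_add] by blast
    moreover have "f x * g x = 0"
      using Suc.prems vanish_value[of a x f] vanish_value[of b x g] by (cases "a = 0") auto
    ultimately show ?case using sm by (auto intro: smooth_at_mult)
  qed
  then show ?thesis by simp
qed

lemma vanish_cmult: "vanish n x f \<Longrightarrow> vanish n x (\<lambda>y. c * f y)"
  using vanish_mult[of 0 x "\<lambda>_. c" n f] by (simp add: smooth_at_const)

lemma vanish_smooth_mult:
  assumes "vanish n x f" "smooth_at x g"
  shows "vanish n x (\<lambda>y. f y * g y)" "vanish n x (\<lambda>y. g y * f y)"
  using vanish_mult[of n x f 0 g] vanish_mult[of 0 x g n f] assms by auto

lemma vanish_uminus: "vanish n x f \<Longrightarrow> vanish n x (\<lambda>y. - f y)"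
  using vanish_cmult[of n x f "-1"] by simp

lemma vanish_diff:
  assumes "vanish n x f" "vanish n x g"
  shows "vanish n x (\<lambda>y. f y - g y)"
  using vanish_add[OF assms(1) vanish_uminus[OF assms(2)]] by simp

lemma eventually_smooth_at_compose:
  assumes "isCont g x" "smooth_at (g x) f"
  shows "\<forall>\<^sub>F y in nhds x. smooth_at (g y) f"
  using eventually_compose_filterlim[OF smooth_at_eventually[OF assms(2)], of g "nhds x"] assms(1)
  by (simp add: isCont_def tendsto_at_iff_tendsto_nhds)

lemma vanish_compose:
  fixes f :: "real^'m::finite \<Rightarrow> real" and g :: "real^'k::finite \<Rightarrow> real^'m"
  assumes "smooth_at x g" "vanish n (g x) f"
  shows "vanish n x (\<lambda>y. f (g y))"
  using assms(2)
proof (induction n arbitrary: f)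
  case 0
  then show ?case using smooth_at_compose[OF assms(1)] by simp
next
  case (Suc n)
  have sm: "smooth_at (g x) f" using Suc.prems by auto
  have "\<forall>\<^sub>F y in nhds x. smooth_at (g y) f"
    using eventually_smooth_at_compose smooth_at_continuous assms(1) sm by blast
  then have "\<forall>\<^sub>F y in nhds x. (\<Sum>j\<in>UNIV. pd j f (g y) * pd i (\<lambda>y. g y $ j) y) = pd i (\<lambda>y. f (g y)) y" for i
    using smooth_at_eventually[OF assms(1)] by eventually_elim (simp add: pd_compose)
  moreover have "vanish n x (\<lambda>y. \<Sum>j\<in>UNIV. pd j f (g y) * pd i (\<lambda>y. g y $ j) y)" for i
    using Suc assms(1) by (intro vanish_sum vanish_smooth_mult Suc.IH smooth_at_pd) (auto simp: smooth_at_vec_iff)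
  ultimately have "vanish n x (pd i (\<lambda>y. f (g y)))" for i
    using vanish_cong by blast
  then show ?case using Suc.prems smooth_at_compose[OF assms(1) sm] by simp
qed

text \<open>The derivative of the difference splits into (f'(g) - f'(h)) g' and f'(h) (g' - h'). The
  first term is covered by induction, applied to the partial derivatives of f, the second by the
  assumption on g - h.\<close>

lemma vanish_compose_diff:
  fixes f :: "real^'m::finite \<Rightarrow> real" and g h :: "real^'k::finite \<Rightarrow> real^'m"
  assumes "smooth_at x g" "smooth_at x h" "g x = h x" "\<And>j. vanish n x (\<lambda>y. g y $ j - h y $ j)" "smooth_at (g x) f"
  shows "vanish n x (\<lambda>y. f (g y) - f (h y))"
  using assms(4,5)
proof (induction n arbitrary: f)
  case 0
  then show ?case using assms(3) smooth_at_compose[OF assms(1), of f] smooth_at_compose[OF assms(2), of f]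
    by (simp add: smooth_at_diff)
next
  case (Suc n)
  note sm = assms(1,2) Suc.prems(2)
  have c: "\<forall>\<^sub>F y in nhds x. smooth_at (g y) f" "\<forall>\<^sub>F y in nhds x. smooth_at (h y) f"
    using eventually_smooth_at_compose[OF smooth_at_continuous[OF assms(1)], of f]
      eventually_smooth_at_compose[OF smooth_at_continuous[OF assms(2)], of f] sm assms(3) by simp_all
  have sc: "smooth_at x (\<lambda>y. g y $ j)" "smooth_at x (\<lambda>y. h y $ j)" for j
    using sm by (auto simp: smooth_at_vec_iff)
  have "\<forall>\<^sub>F y in nhds x. (\<Sum>j\<in>UNIV. (pd j f (g y) - pd j f (h y)) * pd i (\<lambda>y. g y $ j) y
      + pd j f (h y) * pd i (\<lambda>y. g y $ j - h y $ j) y) = pd i (\<lambda>y. f (g y) - f (h y)) y" for i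
    using c smooth_at_eventually[OF sm(1)] smooth_at_eventually[OF sm(2)]
  proof eventually_elim
    case (elim y)
    have s: "smooth_at y (\<lambda>y. g y $ j)" "smooth_at y (\<lambda>y. h y $ j)" for j
      using elim by (auto simp: smooth_at_vec_iff)
    have "pd i (\<lambda>y. f (g y) - f (h y)) y = (\<Sum>j\<in>UNIV. pd j f (g y) * pd i (\<lambda>y. g y $ j) y) - (\<Sum>j\<in>UNIV. pd j f (h y) * pd i (\<lambda>y. h y $ j) y)"
      using elim by (simp add: pd_diff smooth_at_compose pd_compose)
    also have "\<dots> = (\<Sum>j\<in>UNIV. (pd j f (g y) - pd j f (h y)) * pd i (\<lambda>y. g y $ j) y
      + pd j f (h y) * pd i (\<lambda>y. g y $ j - h y $ j) y)"
      by (simp add: pd_diff s sum_subtractf[symmetric] algebra_simps)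
    finally show ?case by simp
  qed
  moreover have "vanish n x (\<lambda>y. \<Sum>j\<in>UNIV. (pd j f (g y) - pd j f (h y)) * pd i (\<lambda>y. g y $ j) y
      + pd j f (h y) * pd i (\<lambda>y. g y $ j - h y $ j) y)" for i
  proof (intro vanish_sum vanish_add)
    fix j
    have "vanish n x (\<lambda>y. pd j f (g y) - pd j f (h y))"
      by (rule Suc.IH[OF Suc.prems(1)[THEN vanish_Suc_imp] smooth_at_pd[OF Suc.prems(2)]])
    then show "vanish n x (\<lambda>y. (pd j f (g y) - pd j f (h y)) * pd i (\<lambda>y. g y $ j) y)"
      by (intro vanish_smooth_mult smooth_at_pd sc)
    have "smooth_at x (\<lambda>y. pd j f (h y))"
      using smooth_at_compose[OF assms(2), of "pd j f"] smooth_at_pd[OF sm(3)] assms(3) by simp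
    then show "vanish n x (\<lambda>y. pd j f (h y) * pd i (\<lambda>y. g y $ j - h y $ j) y)"
      using Suc.prems by (intro vanish_smooth_mult(2)) auto
  qed
  ultimately have "vanish n x (pd i (\<lambda>y. f (g y) - f (h y)))" for i
    using vanish_cong by blast
  then show ?case using sm assms(3) smooth_at_compose[OF assms(1), of f] smooth_at_compose[OF assms(2), of f]
    by (simp add: smooth_at_diff)
qed

lemma vanish_iff_pderivs:
  "vanish n x f \<longleftrightarrow> smooth_at x f \<and> (\<forall>is. length is < n \<longrightarrow> pderivs is f x = 0)"
proof (induction n arbitrary: f)
  case 0
  then show ?case by simp
next
  case (Suc n)
  have "(\<forall>is. length is < Suc n \<longrightarrow> pderivs is f x = 0) \<longleftrightarrow>
     f x = 0 \<and> (\<forall>i is. length is < n \<longrightarrow> pderivs is (pd i f) x = 0)" (is "?L \<longleftrightarrow> ?R")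
  proof
    assume ?L
    then show ?R
      by (metis Suc_mono length_append_singleton list.size(3) pderivs.simps(1) pderivs_snoc zero_less_Suc)
  next
    assume R: ?R
    show ?L
    proof (intro allI impI)
      fix "is" :: "'a list" assume "length is < Suc n"
      then show "pderivs is f x = 0" using R
        by (cases "is" rule: rev_cases) (auto simp: pderivs_snoc)
    qed
  qed
  then show ?case using Suc smooth_at_pd by auto
qed

section \<open>Iterated partial derivatives\<close>

lemma smooth_at_pderivs: "smooth_at x f \<Longrightarrow> smooth_at x (pderivs is f)"
  by (induction "is") (auto simp: smooth_at_frechet)

text \<open>Stated on a neighbourhood because the next derivative in the induction sees one; the
  version at the point alone would not be inductive.\<close>

lemma pderivs_linear_comp:
  assumes "bounded_linear L" "smooth_at x f"
  shows "\<forall>\<^sub>F y in nhds x. pderivs is (\<lambda>y. L (f y)) y = L (pderivs is f y)"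
proof (induction "is")
  case (Cons i "is")
  have "\<forall>\<^sub>F y in nhds x. smooth_at y (pderivs is f)"
    using assms by (intro smooth_at_eventually smooth_at_pderivs)
  then show ?case using pd_cong_eventually[OF Cons, of i] unfolding pderivs_Cons
    by eventually_elim (simp add: pd_linear_comp assms(1))
qed simp

lemma pderivs_add:
  assumes "smooth_at x f" "smooth_at x g"
  shows "\<forall>\<^sub>F y in nhds x. pderivs is (\<lambda>y. f y + g y) y = pderivs is f y + pderivs is g y"
proof (induction "is")
  case (Cons i "is")
  have "\<forall>\<^sub>F y in nhds x. smooth_at y (pderivs is f)" "\<forall>\<^sub>F y in nhds x. smooth_at y (pderivs is g)"
    using assms by (auto intro: smooth_at_eventually smooth_at_pderivs)
  then show ?case using pd_cong_eventually[OF Cons, of i] unfolding pderivs_Cons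
    by eventually_elim (simp add: pd_add)
qed simp

lemma pderivs_linear_comp': "bounded_linear L \<Longrightarrow> smooth_at x f \<Longrightarrow> pderivs is (\<lambda>y. L (f y)) x = L (pderivs is f x)"
  by (rule eventually_nhds_x_imp_x[OF pderivs_linear_comp])

lemma pderivs_add': "smooth_at x f \<Longrightarrow> smooth_at x g \<Longrightarrow> pderivs is (\<lambda>y. f y + g y) x = pderivs is f x + pderivs is g x"
  by (rule eventually_nhds_x_imp_x[OF pderivs_add])

lemma pderivs_diff:
  assumes "smooth_at x f" "smooth_at x g"
  shows "pderivs is (\<lambda>y. f y - g y) x = pderivs is f x - pderivs is g x"
  using pderivs_add'[OF assms(1) smooth_at_uminus[OF assms(2)]]
    pderivs_linear_comp'[OF bounded_linear_minus[OF bounded_linear_ident] assms(2)] by simp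

lemma pderivs_const_zero: "pderivs is (\<lambda>_. 0) = (\<lambda>_. 0)"
  by (induction "is") auto

lemma pderivs_sum:
  assumes "\<And>j. j \<in> I \<Longrightarrow> smooth_at x (f j)"
  shows "pderivs is (\<lambda>y. \<Sum>j\<in>I. f j y) x = (\<Sum>j\<in>I. pderivs is (f j) x)"
  using assms
  by (induction I rule: infinite_finite_induct) (auto simp: pderivs_const_zero pderivs_add' smooth_at_sum)

lemma pderivs_cong:
  assumes "\<forall>\<^sub>F y in nhds x. f y = g y"
  shows "\<forall>\<^sub>F y in nhds x. pderivs is f y = pderivs is g y"
  by (induction "is") (auto simp: pderivs_Cons assms simp del: pderivs.simps(2) intro: pd_cong_eventually)


section \<open>Taylor polynomials and homogeneous functions\<close>

text \<open>n! times the part of degree n of the Taylor polynomial. Without the denominator the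
  recursion \<open>taylor_sum_Suc\<close> is a plain sum over first derivatives.\<close>

definition taylor_sum :: "nat \<Rightarrow> (real^'m::finite \<Rightarrow> real) \<Rightarrow> real^'m \<Rightarrow> real^'m \<Rightarrow> real"
  where "taylor_sum n f x z = (\<Sum>is | length is = n. prod_list (map (($) z) is) * pderivs is f x)"

lemma sum_mult_delta [simp]:
  fixes F :: "'i::finite \<Rightarrow> real"
  shows "(\<Sum>j\<in>UNIV. (if i = j then 1 else 0) * F j) = F i" "(\<Sum>j\<in>UNIV. F j * (if i = j then 1 else 0)) = F i"
    "(\<Sum>j\<in>UNIV. (if j = i then 1 else 0) * F j) = F i" "(\<Sum>j\<in>UNIV. F j * (if j = i then 1 else 0)) = F i"
  by (simp_all add: if_distrib[of "\<lambda>x. x * _"] if_distrib[of "(*) _"] cong: if_cong)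

lemma finite_lists_length: "finite {is :: 'm::finite list. length is = n}"
  using finite_lists_length_eq[of "UNIV :: 'm set" n] by simp

text \<open>The last index is split off since \<open>pderivs\<close> applies it first.\<close>

lemma sum_lists_Suc:
  fixes F :: "'m::finite list \<Rightarrow> 'b::comm_monoid_add"
  shows "(\<Sum>is | length is = Suc n. F is) = (\<Sum>i\<in>UNIV. \<Sum>is | length is = n. F (is @ [i]))"
proof -
  have "(\<Sum>is | length is = Suc n. F is) = (\<Sum>(i, is)\<in>UNIV \<times> {is. length is = n}. F (is @ [i]))"
  proof (rule sum.reindex_bij_witness[where i = "\<lambda>(i, is). is @ [i]" and j = "\<lambda>is. (last is, butlast is)"], goal_cases)
    case (1 a)
    then show ?case by (cases a rule: rev_cases) auto
  next
    case (5 a)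
    then show ?case by (cases a rule: rev_cases) auto
  qed (auto split: prod.splits)
  then show ?thesis by (simp add: sum.cartesian_product)
qed

lemma taylor_sum_0: "taylor_sum 0 f x z = f x"
  by (simp add: taylor_sum_def)

lemma taylor_sum_Suc: "taylor_sum (Suc n) f x z = (\<Sum>i\<in>UNIV. z $ i * taylor_sum n (pd i f) x z)"
  by (simp add: taylor_sum_def sum_lists_Suc pderivs_snoc sum_distrib_left mult.assoc mult.left_commute)

lemma taylor_sum_cong: "\<forall>\<^sub>F y in nhds x. f y = g y \<Longrightarrow> taylor_sum n f x z = taylor_sum n g x z"
  unfolding taylor_sum_def using eventually_nhds_x_imp_x[OF pderivs_cong] by (intro sum.cong) auto

lemma taylor_sum_sum:
  assumes "\<And>j. j \<in> I \<Longrightarrow> smooth_at x (f j)"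
  shows "taylor_sum n (\<lambda>y. \<Sum>j\<in>I. f j y) x z = (\<Sum>j\<in>I. taylor_sum n (f j) x z)"
  unfolding taylor_sum_def by (subst sum.swap) (simp add: pderivs_sum[OF assms] sum_distrib_left)

lemma smooth_at_taylor_sum: "smooth_at z (taylor_sum n f x)"
proof (induction n arbitrary: f)
  case 0
  then show ?case by (simp add: taylor_sum_0[abs_def] smooth_at_const)
next
  case (Suc n)
  then show ?case unfolding taylor_sum_Suc[abs_def]
    by (intro smooth_at_sum smooth_at_mult smooth_at_nth)
qed

lemma pd_sum_nth_mult:
  fixes T :: "'m::finite \<Rightarrow> real^'m \<Rightarrow> real"
  assumes "\<And>j. smooth_at z (T j)"
  shows "pd i (\<lambda>z. \<Sum>j\<in>UNIV. z $ j * T j z) z = (\<Sum>j\<in>UNIV. z $ j * pd i (T j) z) + T i z"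
proof -
  have "pd i (\<lambda>z. \<Sum>j\<in>UNIV. z $ j * T j z) z = (\<Sum>j\<in>UNIV. pd i (\<lambda>z. z $ j * T j z) z)"
    by (rule pd_sum) (rule smooth_at_mult[OF smooth_at_nth assms])
  also have "\<dots> = (\<Sum>j\<in>UNIV. z $ j * pd i (T j) z + (if i = j then 1 else 0) * T j z)"
    by (simp only: pd_mult[OF smooth_at_nth assms] pd_nth)
  finally show ?thesis by (simp only: sum.distrib sum_mult_delta)
qed

text \<open>Each of the n + 1 factors of z contributes the same term, because partial derivatives
  commute.\<close>

lemma pd_taylor_sum:
  assumes "smooth_at x f"
  shows "pd i (taylor_sum (Suc n) f x) z = Suc n * taylor_sum n (pd i f) x z"
  using assms
proof (induction n arbitrary: f)
  case 0
  show ?case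
    unfolding taylor_sum_Suc[abs_def] taylor_sum_0 by (simp add: pd_sum_nth_mult smooth_at_const)
next
  case (Suc n)
  have c: "taylor_sum n (pd i (pd j f)) x z = taylor_sum n (pd j (pd i f)) x z" for j
    by (rule taylor_sum_cong, rule eventually_mono[OF smooth_at_eventually[OF Suc.prems]], rule pd_commute)
  have "pd i (taylor_sum (Suc (Suc n)) f x) z =
      (\<Sum>j\<in>UNIV. z $ j * pd i (taylor_sum (Suc n) (pd j f) x) z) + taylor_sum (Suc n) (pd i f) x z"
    unfolding taylor_sum_Suc[abs_def, of "Suc n"] by (rule pd_sum_nth_mult[OF smooth_at_taylor_sum])
  also have "\<dots> = (\<Sum>j\<in>UNIV. z $ j * (Suc n * taylor_sum n (pd j (pd i f)) x z)) + taylor_sum (Suc n) (pd i f) x z"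
    by (simp only: Suc.IH[OF smooth_at_pd[OF Suc.prems]] c)
  also have "\<dots> = Suc (Suc n) * taylor_sum (Suc n) (pd i f) x z"
  proof -
    have "(\<Sum>j\<in>UNIV. z $ j * (Suc n * taylor_sum n (pd j (pd i f)) x z)) = Suc n * taylor_sum (Suc n) (pd i f) x z"
      unfolding taylor_sum_Suc[of n "pd i f"] sum_distrib_left by (intro sum.cong) auto
    then show ?thesis by (simp add: algebra_simps)
  qed
  finally show ?case .
qed

lemma taylor_sum_at_0: "taylor_sum (Suc n) f x 0 = 0"
  by (simp add: taylor_sum_Suc)

lemma smooth_at_shift:
  fixes f :: "real^'m::finite \<Rightarrow> 'b::real_normed_vector"
  assumes "smooth_at (x + z) f"
  shows "smooth_at z (\<lambda>z. f (x + z))"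
  using smooth_at_compose[of z "\<lambda>z. x + z" f] assms
  by (simp add: smooth_at_add smooth_at_const smooth_at_ident)

lemma pd_shift:
  fixes f :: "real^'m::finite \<Rightarrow> real"
  assumes "smooth_at (x + z) f"
  shows "pd i (\<lambda>z. f (x + z)) z = pd i f (x + z)"
proof -
  have "pd i (\<lambda>z. f (x + z)) z = (\<Sum>j\<in>UNIV. pd j f (x + z) * pd i (\<lambda>z. (x + z) $ j) z)"
    using assms by (intro pd_compose smooth_at_add smooth_at_const smooth_at_ident)
  also have "\<dots> = (\<Sum>j\<in>UNIV. pd j f (x + z) * (if i = j then 1 else 0))"
    by (simp add: pd_add smooth_at_const smooth_at_nth pd_nth)
  finally show ?thesis by simp
qed

lemma eventually_shift: "\<forall>\<^sub>F y in nhds x. P y \<Longrightarrow> \<forall>\<^sub>F z in nhds 0. P (x + z)" for x :: "'a::real_normed_vector"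
  by (rule eventually_compose_filterlim[of P "nhds x"]) (auto intro!: tendsto_eq_intros filterlim_ident)

text \<open>The partial derivatives of a Taylor remainder of f are the Taylor remainders, of one
  degree less, of the partial derivatives of f. This fits the recursion of \<open>vanish\<close>, so
  no estimate is involved.\<close>

lemma taylor_remainder_vanish:
  fixes f :: "real^'m::finite \<Rightarrow> real"
  assumes "smooth_at x f"
  shows "vanish (Suc k) 0 (\<lambda>z. f (x + z) - (\<Sum>n\<le>k. taylor_sum n f x z / fact n))"
  using assms
proof (induction k arbitrary: f)
  case 0
  have "smooth_at 0 (\<lambda>z. f (x + z) - f x)"
    using 0 by (intro smooth_at_diff[OF smooth_at_shift smooth_at_const]) simp
  then show ?case by (auto simp: taylor_sum_0 smooth_at_pd)
next
  case (Suc k)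
  have smT: "smooth_at z (\<lambda>z. taylor_sum n f x z / fact n)" for n z
    using smooth_at_mult[OF smooth_at_const[of z "1 / fact n"] smooth_at_taylor_sum[of z n f x]] by simp
  have sm: "smooth_at 0 (\<lambda>z. f (x + z) - (\<Sum>n\<le>Suc k. taylor_sum n f x z / fact n))"
    using Suc.prems by (intro smooth_at_diff[OF smooth_at_shift smooth_at_sum[OF smT]]) simp
  have "pd i (\<lambda>z. taylor_sum n f x z / fact n) z = (if n = 0 then 0 else taylor_sum (n - 1) (pd i f) x z / fact (n - 1))" for n i z
  proof -
    have "pd i (\<lambda>z. taylor_sum n f x z / fact n) z = pd i (taylor_sum n f x) z / fact n"
      using pd_mult[OF smooth_at_const[of z "1 / fact n"] smooth_at_taylor_sum[of z n f x], of i] by simp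
    then show ?thesis
      by (cases n) (simp_all add: taylor_sum_0[abs_def] pd_taylor_sum[OF Suc.prems] del: of_nat_Suc)
  qed
  then have D: "(\<Sum>n\<le>Suc k. pd i (\<lambda>z. taylor_sum n f x z / fact n) z) = (\<Sum>n\<le>k. taylor_sum n (pd i f) x z / fact n)" for i z
    by (simp add: sum.atMost_Suc_shift del: sum.atMost_Suc)
  have "\<forall>\<^sub>F z in nhds 0. pd i f (x + z) - (\<Sum>n\<le>k. taylor_sum n (pd i f) x z / fact n) =
     pd i (\<lambda>z. f (x + z) - (\<Sum>n\<le>Suc k. taylor_sum n f x z / fact n)) z" for i
    using eventually_shift[OF smooth_at_eventually[OF Suc.prems]]
  proof eventually_elim
    case (elim z)
    have "pd i (\<lambda>z. f (x + z) - (\<Sum>n\<le>Suc k. taylor_sum n f x z / fact n)) z =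
        pd i (\<lambda>z. f (x + z)) z - pd i (\<lambda>z. \<Sum>n\<le>Suc k. taylor_sum n f x z / fact n) z"
      by (rule pd_diff[OF smooth_at_shift[OF elim] smooth_at_sum[OF smT]])
    then show ?case by (simp only: pd_shift[OF elim] pd_sum[OF smT] D)
  qed
  then have "vanish (Suc k) 0 (pd i (\<lambda>z. f (x + z) - (\<Sum>n\<le>Suc k. taylor_sum n f x z / fact n)))" for i
    using vanish_cong[OF Suc.IH[OF smooth_at_pd[OF Suc.prems]]] by blast
  moreover have "f (x + 0) - (\<Sum>n\<le>Suc k. taylor_sum n f x 0 / fact n) = 0"
    by (simp add: sum.atMost_Suc_shift taylor_sum_0 taylor_sum_at_0 del: sum.atMost_Suc)
  ultimately show ?case using sm by (subst vanish.simps) blast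
qed

lemma taylor_sum_vanish: "vanish n x f \<Longrightarrow> m < n \<Longrightarrow> taylor_sum m f x z = 0"
  by (simp add: taylor_sum_def vanish_iff_pderivs)

text \<open>Smoothness stands in for polynomiality: it is easier to propagate, and a smooth
  homogeneous function turns out to be a polynomial by \<open>homogeneous_con_hom\<close>.\<close>

definition homogeneous :: "nat \<Rightarrow> (real^'m::finite \<Rightarrow> real) \<Rightarrow> bool"
  where "homogeneous n p \<longleftrightarrow> (\<forall>z. smooth_at z p) \<and> (\<forall>c z. p (c *\<^sub>R z) = c ^ n * p z)"

lemma homogeneous_0: "homogeneous 0 p \<Longrightarrow> p = (\<lambda>_. p 0)"
  unfolding homogeneous_def fun_eq_iff by (metis mult_1 power_0 scaleR_zero_left)

lemma homogeneous_value: "homogeneous n p \<Longrightarrow> 0 < n \<Longrightarrow> p 0 = 0"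
  unfolding homogeneous_def by (metis mult_zero_left power_0_left less_numeral_extra(3) scaleR_zero_left)

lemma pd_scale:
  fixes p :: "real^'m::finite \<Rightarrow> real"
  assumes "smooth_at (c *\<^sub>R z) p"
  shows "pd i (\<lambda>z. p (c *\<^sub>R z)) z = c * pd i p (c *\<^sub>R z)"
proof -
  have "pd i (\<lambda>z. p (c *\<^sub>R z)) z = (\<Sum>j\<in>UNIV. pd j p (c *\<^sub>R z) * pd i (\<lambda>z. (c *\<^sub>R z) $ j) z)"
    using assms by (intro pd_compose smooth_at_scaleR smooth_at_const smooth_at_ident)
  also have "\<dots> = (\<Sum>j\<in>UNIV. (pd j p (c *\<^sub>R z) * c) * (if i = j then 1 else 0))"
    by (simp add: pd_mult smooth_at_const smooth_at_nth pd_nth mult.assoc)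
  finally show ?thesis by (simp only: sum_mult_delta mult.commute)
qed

lemma homogeneous_pd:
  assumes "homogeneous (Suc n) p"
  shows "homogeneous n (pd i p)"
proof -
  have sm: "smooth_at z p" and h: "p (c *\<^sub>R z) = c ^ Suc n * p z" for c z
    using assms by (auto simp: homogeneous_def)
  have *: "pd i p (c *\<^sub>R z) = c ^ n * pd i p z" if "c \<noteq> 0" for c z
  proof -
    have "c * pd i p (c *\<^sub>R z) = pd i (\<lambda>z. c ^ Suc n * p z) z"
      using pd_scale[OF sm, of i c z] h by simp
    also have "\<dots> = c * (c ^ n * pd i p z)" by (simp add: pd_mult smooth_at_const sm)
    finally show ?thesis using that by simp
  qed
  \<comment> \<open>Dividing by c fails at c = 0; there the identity is the limit of those for c
    tending to 0.\<close>
  have "pd i p (0 *\<^sub>R z) = 0 ^ n * pd i p z" for z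
  proof (rule tendsto_unique)
    show "((\<lambda>c. pd i p (c *\<^sub>R z)) \<longlongrightarrow> pd i p (0 *\<^sub>R z)) (at 0)"
      by (rule isCont_tendsto_compose[OF smooth_at_continuous[OF smooth_at_pd[OF sm]]]) (auto intro!: tendsto_eq_intros)
    have "((\<lambda>c. c ^ n * pd i p z) \<longlongrightarrow> 0 ^ n * pd i p z) (at 0)"
      by (auto intro!: tendsto_intros)
    then show "((\<lambda>c. pd i p (c *\<^sub>R z)) \<longlongrightarrow> 0 ^ n * pd i p z) (at 0)"
      by (rule Lim_transform_eventually) (auto simp: eventually_at_filter *)
  qed simp
  with * have "pd i p (c *\<^sub>R z) = c ^ n * pd i p z" for c z by (cases "c = 0") auto
  then show ?thesis unfolding homogeneous_def using smooth_at_pd[OF sm] by auto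
qed

text \<open>Differentiate c \<mapsto> p (c z) at c = 1, once by the chain rule and once through
  homogeneity.\<close>

lemma homogeneous_Euler:
  assumes "homogeneous n p"
  shows "(\<Sum>i\<in>UNIV. z $ i * pd i p z) = n * p z"
proof -
  have sm: "smooth_at z p" and h: "p (c *\<^sub>R z) = c ^ n * p z" for c z
    using assms by (auto simp: homogeneous_def)
  have i: "((\<lambda>c. c *\<^sub>R z) has_derivative (\<lambda>h. h *\<^sub>R z)) (at 1)"
    by (auto intro!: derivative_eq_intros)
  have "((\<lambda>c. p (c *\<^sub>R z)) has_derivative (\<lambda>h. \<Sum>i\<in>UNIV. (h *\<^sub>R z) $ i *\<^sub>R pd i p z)) (at 1)"
    using diff_chain_at[OF i has_frechet_derivative[OF smooth_at_differentiable[OF sm]]]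
    by (simp add: o_def frechet_derivative_pd sm)
  moreover have "((\<lambda>c. c ^ n * p z) has_derivative (\<lambda>h. (real n * h) * p z)) (at 1)"
    by (auto intro!: derivative_eq_intros)
  ultimately have "(\<lambda>h. \<Sum>i\<in>UNIV. (h *\<^sub>R z) $ i *\<^sub>R pd i p z) = (\<lambda>h. (real n * h) * p z)"
    unfolding h by (rule has_derivative_unique)
  from fun_cong[OF this, of 1] show ?thesis by simp
qed

text \<open>Induction through Euler's identity: n + 1 from Euler times n! gives the next factorial.
  So such a function is its own Taylor polynomial at 0.\<close>

lemma taylor_sum_homogeneous:
  "homogeneous n p \<Longrightarrow> taylor_sum m p 0 z = (if m = n then fact n * p z else 0)"
proof (induction n arbitrary: m p)
  case 0
  then obtain c where p: "p = (\<lambda>_. c)" using homogeneous_0 by blast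
  have "taylor_sum m (\<lambda>_. 0) 0 z = 0" for m by (simp add: taylor_sum_def pderivs_const_zero)
  moreover have "pd i p = (\<lambda>_. 0)" for i using p pd_const[abs_def] by auto
  ultimately show ?case using p by (cases m) (auto simp: taylor_sum_0 taylor_sum_Suc)
next
  case (Suc n)
  show ?case
  proof (cases m)
    case 0
    then show ?thesis using homogeneous_value[OF Suc.prems] by (simp add: taylor_sum_0)
  next
    case (Suc l)
    have "taylor_sum m p 0 z = (\<Sum>i\<in>UNIV. z $ i * (if l = n then fact n * pd i p z else 0))"
      using Suc.IH[OF homogeneous_pd[OF Suc.prems]] by (simp add: Suc taylor_sum_Suc)
    also have "\<dots> = (if m = Suc n then fact n * (\<Sum>i\<in>UNIV. z $ i * pd i p z) else 0)"
      using Suc by (simp add: sum_distrib_left mult.left_commute)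
    finally show ?thesis using homogeneous_Euler[OF Suc.prems] by (simp add: algebra_simps)
  qed
qed

lemma pderivs_homogeneous:
  "homogeneous n p \<Longrightarrow> length is \<noteq> n \<Longrightarrow> pderivs is p 0 = 0"
proof (induction n arbitrary: p "is")
  case 0
  then obtain c where p: "p = (\<lambda>_. c)" using homogeneous_0 by blast
  then have "pd i p = (\<lambda>_. 0)" for i using pd_const[abs_def] by auto
  then show ?case using 0 by (cases "is" rule: rev_cases) (auto simp: pderivs_snoc pderivs_const_zero)
next
  case (Suc n)
  then show ?case using homogeneous_value[OF Suc.prems(1)]
    by (cases "is" rule: rev_cases) (auto simp: pderivs_snoc homogeneous_pd)
qed


section \<open>Jets of connections\<close>

text \<open>Congruence modulo the n-th power of the ideal in every component. For smooth connections
  \<open>con_eqv (Suc k)\<close> is equality of k-jets, hence the recurring offset by one.\<close>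

definition con_eqv :: "nat \<Rightarrow> real^'m::finite \<Rightarrow> (real^'m \<Rightarrow> 'm chr) \<Rightarrow> (real^'m \<Rightarrow> 'm chr) \<Rightarrow> bool"
  where "con_eqv n x \<theta> \<theta>' \<longleftrightarrow> (\<forall>l i j. vanish n x (\<lambda>z. \<theta> z $ l $ i $ j - \<theta>' z $ l $ i $ j))"

text \<open>The polynomial representative of a jet, the same sum as in
  \<open>jet_act\<close>.\<close>

definition con_poly :: "nat \<Rightarrow> (nat \<Rightarrow> real^'m::finite \<Rightarrow> 'm chr) \<Rightarrow> real^'m \<Rightarrow> 'm chr"
  where "con_poly k c = (\<lambda>z. \<Sum>n\<le>k. c n z)"

lemma bounded_linear_chr: "bounded_linear (\<lambda>t :: 'm::finite chr. t $ l $ i $ j)"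
  by (rule bounded_linear_compose[OF bounded_linear_vec_nth[of j]
      bounded_linear_compose[OF bounded_linear_vec_nth[of i] bounded_linear_vec_nth[of l]]])

lemma smooth_at_chr_iff:
  fixes \<theta> :: "'a::real_normed_vector \<Rightarrow> 'm::finite chr"
  shows "smooth_at x \<theta> \<longleftrightarrow> (\<forall>l i j. smooth_at x (\<lambda>z. \<theta> z $ l $ i $ j))"
  by (simp only: smooth_at_vec_iff[of x \<theta>] smooth_at_vec_iff[of x "\<lambda>z. \<theta> z $ _"] smooth_at_vec_iff[of x "\<lambda>z. \<theta> z $ _ $ _"])

lemma pderivs_chr:
  fixes \<theta> :: "real^'k::finite \<Rightarrow> 'm::finite chr"
  shows "smooth_at x \<theta> \<Longrightarrow> pderivs is \<theta> x $ l $ i $ j = pderivs is (\<lambda>z. \<theta> z $ l $ i $ j) x"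
  using pderivs_linear_comp'[OF bounded_linear_chr[of l i j], of x \<theta> "is"] by simp

lemma con_eqv_refl: "smooth_at x \<theta> \<Longrightarrow> con_eqv n x \<theta> \<theta>"
  by (simp add: con_eqv_def vanish_zero)

lemma con_eqv_sym: "con_eqv n x \<theta> \<theta>' \<Longrightarrow> con_eqv n x \<theta>' \<theta>"
  unfolding con_eqv_def
proof (intro allI)
  fix l i j
  assume "\<forall>l i j. vanish n x (\<lambda>z. \<theta> z $ l $ i $ j - \<theta>' z $ l $ i $ j)"
  then show "vanish n x (\<lambda>z. \<theta>' z $ l $ i $ j - \<theta> z $ l $ i $ j)"
    using vanish_uminus[of n x "\<lambda>z. \<theta> z $ l $ i $ j - \<theta>' z $ l $ i $ j"] by simp
qed

lemma con_eqv_trans: "con_eqv n x \<theta> \<theta>' \<Longrightarrow> con_eqv n x \<theta>' \<theta>'' \<Longrightarrow> con_eqv n x \<theta> \<theta>''"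
  unfolding con_eqv_def
proof (intro allI)
  fix l i j
  assume "\<forall>l i j. vanish n x (\<lambda>z. \<theta> z $ l $ i $ j - \<theta>' z $ l $ i $ j)"
    "\<forall>l i j. vanish n x (\<lambda>z. \<theta>' z $ l $ i $ j - \<theta>'' z $ l $ i $ j)"
  then show "vanish n x (\<lambda>z. \<theta> z $ l $ i $ j - \<theta>'' z $ l $ i $ j)"
    using vanish_add[of n x "\<lambda>z. \<theta> z $ l $ i $ j - \<theta>' z $ l $ i $ j" "\<lambda>z. \<theta>' z $ l $ i $ j - \<theta>'' z $ l $ i $ j"] by simp
qed

lemma con_eqv_mono: "con_eqv n x \<theta> \<theta>' \<Longrightarrow> m \<le> n \<Longrightarrow> con_eqv m x \<theta> \<theta>'"
  unfolding con_eqv_def using vanish_mono by blast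

lemma con_eqv_eventually:
  assumes "smooth_at x \<theta>" "\<forall>\<^sub>F z in nhds x. \<theta> z = \<theta>' z"
  shows "con_eqv n x \<theta> \<theta>'"
  unfolding con_eqv_def
proof (intro allI)
  fix l i j
  show "vanish n x (\<lambda>z. \<theta> z $ l $ i $ j - \<theta>' z $ l $ i $ j)"
    by (rule vanish_cong[OF vanish_zero]) (use assms(2) in eventually_elim, simp)
qed

lemma con_eqv_smooth:
  assumes "con_eqv n x \<theta> \<theta>'" "smooth_at x \<theta>"
  shows "smooth_at x \<theta>'"
proof -
  have "smooth_at x (\<lambda>z. \<theta> z $ l $ i $ j - (\<theta> z $ l $ i $ j - \<theta>' z $ l $ i $ j))" for l i j
    using assms by (intro smooth_at_diff[OF _ vanish_smooth[of n]]) (auto simp: con_eqv_def smooth_at_chr_iff)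
  then show ?thesis by (simp add: smooth_at_chr_iff)
qed

lemma con_eqv_pderivs:
  assumes "con_eqv n x \<theta> \<theta>'" "smooth_at x \<theta>" "length is < n"
  shows "pderivs is \<theta> x = pderivs is \<theta>' x"
proof -
  have sm: "smooth_at x \<theta>'" using con_eqv_smooth assms by blast
  have "pderivs is (\<lambda>z. \<theta> z $ l $ i $ j) x - pderivs is (\<lambda>z. \<theta>' z $ l $ i $ j) x = 0" for l i j
    using assms sm pderivs_diff[of x "\<lambda>z. \<theta> z $ l $ i $ j" "\<lambda>z. \<theta>' z $ l $ i $ j" "is"]
    by (auto simp: con_eqv_def vanish_iff_pderivs smooth_at_chr_iff)
  then show ?thesis by (simp add: vec_eq_iff pderivs_chr assms sm)
qed

lemma con_eqv_jet:
  assumes "con_eqv (Suc k) x \<theta> \<theta>'" "smooth_at x \<theta>"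
  shows "jet k \<theta> x = jet k \<theta>' x"
  unfolding jet_def using con_eqv_pderivs[OF assms]
  by (intro restrict_ext ext arg_cong[where f = "\<lambda>s. _ *\<^sub>R s"] sum.cong) auto

lemma jet_chr:
  fixes \<theta> :: "real^'m::finite \<Rightarrow> 'm chr"
  assumes "smooth_at x \<theta>" "n \<le> k"
  shows "jet k \<theta> x n z $ l $ i $ j = taylor_sum n (\<lambda>z. \<theta> z $ l $ i $ j) x z / fact n"
  using assms by (simp add: jet_def taylor_sum_def pderivs_chr)

lemma con_poly_chr: "con_poly k c z $ l $ i $ j = (\<Sum>n\<le>k. c n z $ l $ i $ j)"
  by (simp add: con_poly_def)

lemma con_poly_jet_eqv:
  assumes "smooth_at x \<theta>"
  shows "con_eqv (Suc k) 0 (\<lambda>z. \<theta> (x + z)) (con_poly k (jet k \<theta> x))"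
proof -
  have "con_poly k (jet k \<theta> x) z $ l $ i $ j = (\<Sum>n\<le>k. taylor_sum n (\<lambda>z. \<theta> z $ l $ i $ j) x z / fact n)" for l i j z
    by (simp add: con_poly_chr jet_chr assms)
  then show ?thesis
    using taylor_remainder_vanish[of x "\<lambda>z. \<theta> z $ _ $ _ $ _" k] assms
    unfolding con_eqv_def by (simp add: smooth_at_chr_iff)
qed

lemma con_hom_homogeneous:
  assumes "p \<in> con_hom n"
  shows "homogeneous n (\<lambda>z. p z $ l $ i $ j)"
proof -
  have "real_polynomial_function (\<lambda>z. p z $ l $ i $ j)"
    using assms bounded_linear_chr[of l i j] by (auto simp: con_hom_def polynomial_function_def o_def)
  then show ?thesis using assms smooth_at_polynomial by (auto simp: homogeneous_def con_hom_def)
qed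

lemma polynomial_function_monomial: "polynomial_function (\<lambda>z. prod_list (map (($) z) is) :: real)"
proof (induction "is")
  case (Cons i "is")
  have "polynomial_function (\<lambda>z. z $ i)"
    by (rule polynomial_function_bounded_linear[OF bounded_linear_vec_nth])
  from polynomial_function_mult[OF this Cons] show ?case by simp
qed simp

lemma prod_list_scale: "prod_list (map (($) (c *\<^sub>R z)) is) = c ^ length is * prod_list (map (($) z) is)"
  by (induction "is") (auto simp: algebra_simps)

lemma jet_con_hom:
  assumes "n \<le> k"
  shows "jet k \<theta> x n \<in> con_hom n"
proof -
  have "polynomial_function (\<lambda>z. (1 / fact n) *\<^sub>R (\<Sum>is | length is = n. prod_list (map (($) z) is) *\<^sub>R pderivs is \<theta> x))"
    by (intro polynomial_function_cmul polynomial_function_sum finite_lists_length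
        polynomial_function_mult polynomial_function_monomial polynomial_function_const)
  moreover have "(\<Sum>is | length is = n. prod_list (map (($) (c *\<^sub>R z)) is) *\<^sub>R pderivs is \<theta> x) =
     c ^ n *\<^sub>R (\<Sum>is | length is = n. prod_list (map (($) z) is) *\<^sub>R pderivs is \<theta> x)" for c z
    by (simp add: prod_list_scale scaleR_sum_right)
  ultimately show ?thesis using assms by (simp add: con_hom_def jet_def scaleR_left_commute)
qed

lemma smooth_at_con_poly:
  assumes "\<And>n. n \<le> k \<Longrightarrow> c n \<in> con_hom n"
  shows "smooth_at x (con_poly k c)"
  unfolding smooth_at_chr_iff con_poly_chr
  using con_hom_homogeneous[OF assms] by (intro allI smooth_at_sum) (auto simp: homogeneous_def)

text \<open>Each part contributes in its own degree only. Extensionality is assumed because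
  \<open>jet\<close> takes the default value beyond degree k.\<close>

lemma jet_con_poly:
  assumes "\<And>n. n \<le> k \<Longrightarrow> c n \<in> con_hom n" "c \<in> extensional {..k}"
  shows "jet k (con_poly k c) 0 = c"
proof (rule extensionalityI[of _ "{..k}"])
  fix n assume "n \<in> {..k}"
  then have n: "n \<le> k" by simp
  have "jet k (con_poly k c) 0 n z $ l $ i $ j = c n z $ l $ i $ j" for z l i j
  proof -
    note h = con_hom_homogeneous[OF assms(1), of _ l i j]
    have "taylor_sum n (\<lambda>z. con_poly k c z $ l $ i $ j) 0 z = (\<Sum>m\<le>k. taylor_sum n (\<lambda>z. c m z $ l $ i $ j) 0 z)"
      unfolding con_poly_chr by (rule taylor_sum_sum) (use h in \<open>auto simp: homogeneous_def\<close>)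
    also have "\<dots> = (\<Sum>m\<le>k. if m = n then fact n * c n z $ l $ i $ j else 0)"
      by (intro sum.cong) (auto simp: taylor_sum_homogeneous[OF h])
    finally show ?thesis using n by (simp add: jet_chr smooth_at_con_poly assms(1))
  qed
  then show "jet k (con_poly k c) 0 n = c n" by (simp add: fun_eq_iff vec_eq_iff)
qed (use assms(2) in \<open>auto simp: jet_def\<close>)

text \<open>At 0 a derivative of order n sees the part of degree n only. This connects the
  derivatives entering P with the coordinates in \<open>jet_coords\<close>.\<close>

lemma pderivs_con_poly:
  assumes "\<And>n. n \<le> k \<Longrightarrow> c n \<in> con_hom n" "length is \<le> k"
  shows "pderivs is (con_poly k c) 0 = pderivs is (c (length is)) 0"
proof -
  have sm: "smooth_at 0 (c n)" if "n \<le> k" for n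
    using con_hom_homogeneous[OF assms(1)[OF that]] by (simp add: smooth_at_chr_iff homogeneous_def)
  have "pderivs is (c n) 0 = 0" if "n \<le> k" "n \<noteq> length is" for n
    using pderivs_homogeneous[OF con_hom_homogeneous[OF assms(1)[OF that(1)]]] that sm
    by (simp add: vec_eq_iff pderivs_chr)
  then have "(\<Sum>n\<le>k. pderivs is (c n) 0) = (\<Sum>n\<le>k. if n = length is then pderivs is (c n) 0 else 0)"
    by (intro sum.cong) auto
  then show ?thesis using assms(2) sm pderivs_sum[of "{..k}" 0 c "is"] by (simp add: con_poly_def)
qed

section \<open>The map gamma on germs of connections\<close>

lemma vanish_nth: "vanish 1 0 (\<lambda>z. z $ i)"
  by (simp add: smooth_at_nth smooth_at_pd)

lemma gamma_nth: "gamma \<theta> z $ l = (\<Sum>i\<in>UNIV. \<Sum>j\<in>UNIV. \<theta> z $ l $ i $ j * z $ i * z $ j)"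
  by (simp add: gamma_def)

text \<open>The two factors of z in \<open>gamma\<close> gain two orders.\<close>

lemma con_eqv_gamma:
  assumes "con_eqv n 0 \<theta> \<theta>'"
  shows "vanish (n + 2) 0 (\<lambda>z. gamma \<theta> z $ l - gamma \<theta>' z $ l)"
proof -
  have "vanish (n + 1 + 1) 0 (\<lambda>z. (\<theta> z $ l $ i $ j - \<theta>' z $ l $ i $ j) * z $ i * z $ j)" for i j
    using assms by (intro vanish_mult vanish_nth) (simp add: con_eqv_def)
  then have "vanish (n + 1 + 1) 0 (\<lambda>z. \<Sum>i\<in>UNIV. \<Sum>j\<in>UNIV. (\<theta> z $ l $ i $ j - \<theta>' z $ l $ i $ j) * z $ i * z $ j)"
    by (intro vanish_sum)
  then show ?thesis by (simp add: gamma_nth sum_subtractf left_diff_distrib)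
qed

lemma homogeneous_gamma:
  assumes "p \<in> con_hom n"
  shows "homogeneous (n + 2) (\<lambda>z. gamma p z $ l)"
  unfolding homogeneous_def gamma_nth
proof (intro conjI allI)
  show "smooth_at z (\<lambda>z. \<Sum>i\<in>UNIV. \<Sum>j\<in>UNIV. p z $ l $ i $ j * z $ i * z $ j)" for z
    using con_hom_homogeneous[OF assms] by (intro smooth_at_sum smooth_at_mult smooth_at_nth) (simp add: homogeneous_def)
  have h: "p (c *\<^sub>R z) = c ^ n *\<^sub>R p z" for c z using assms by (simp add: con_hom_def)
  show "(\<Sum>i\<in>UNIV. \<Sum>j\<in>UNIV. p (c *\<^sub>R z) $ l $ i $ j * (c *\<^sub>R z) $ i * (c *\<^sub>R z) $ j) =
     c ^ (n + 2) * (\<Sum>i\<in>UNIV. \<Sum>j\<in>UNIV. p z $ l $ i $ j * z $ i * z $ j)" for c z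
    by (simp add: h sum_distrib_left power2_eq_square algebra_simps power_add)
qed

lemma gamma_con_poly: "gamma (con_poly k c) z $ l = (\<Sum>n\<le>k. gamma (c n) z $ l)"
proof -
  have "gamma (con_poly k c) z $ l = (\<Sum>i\<in>UNIV. \<Sum>j\<in>UNIV. \<Sum>n\<le>k. c n z $ l $ i $ j * z $ i * z $ j)"
    by (simp add: gamma_nth con_poly_chr sum_distrib_right)
  also have "\<dots> = (\<Sum>i\<in>UNIV. \<Sum>n\<le>k. \<Sum>j\<in>UNIV. c n z $ l $ i $ j * z $ i * z $ j)"
    by (intro sum.cong sum.swap refl)
  also have "\<dots> = (\<Sum>n\<le>k. gamma (c n) z $ l)"
    unfolding gamma_nth by (rule sum.swap)
  finally show ?thesis .
qed

lemma C_prodD: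
  assumes "c \<in> C_prod k"
  shows "c \<in> extensional {..k}" "n \<le> k \<Longrightarrow> c n \<in> con_hom n" "n \<le> k \<Longrightarrow> gamma (c n) = (\<lambda>_. 0)"
  using assms by (auto simp: C_prod_def C_space_def PiE_def Pi_def)

lemma gamma_C_prod: "c \<in> C_prod k \<Longrightarrow> gamma (con_poly k c) z $ l = 0"
  by (simp add: gamma_con_poly C_prodD)

text \<open>Up to order k + 3, \<open>gamma\<close> of the connection is \<open>gamma\<close> of its
  polynomial truncation, whose parts have degrees n + 2 with n \<le> k. Vanishing to order k + 3
  therefore kills each of these parts.\<close>

lemma jet_in_C_prod:
  assumes "smooth_at 0 \<theta>" "\<And>l. vanish (k + 3) 0 (\<lambda>z. gamma \<theta> z $ l)"
  shows "jet k \<theta> 0 \<in> C_prod k"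
proof -
  let ?c = "jet k \<theta> 0"
  have h: "?c n \<in> con_hom n" if "n \<le> k" for n by (rule jet_con_hom[OF that])
  have "con_eqv (Suc k) 0 \<theta> (con_poly k ?c)" using con_poly_jet_eqv[OF assms(1)] by simp
  from con_eqv_gamma[OF this]
  have "vanish (k + 3) 0 (\<lambda>z. gamma \<theta> z $ l - gamma (con_poly k ?c) z $ l)" for l
    by (simp add: numeral_3_eq_3)
  from vanish_diff[OF assms(2) this] have "vanish (k + 3) 0 (\<lambda>z. gamma \<theta> z $ l - (gamma \<theta> z $ l - gamma (con_poly k ?c) z $ l))" for l .
  then have v: "vanish (k + 3) 0 (\<lambda>z. gamma (con_poly k ?c) z $ l)" for l by simp
  have "gamma (?c n) z $ l = 0" if n: "n \<le> k" for n z l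
  proof -
    note g = homogeneous_gamma[OF h, of _ l]
    have "taylor_sum (n + 2) (\<lambda>z. gamma (con_poly k ?c) z $ l) 0 z = (\<Sum>m\<le>k. taylor_sum (n + 2) (\<lambda>z. gamma (?c m) z $ l) 0 z)"
      unfolding gamma_con_poly by (rule taylor_sum_sum) (use g in \<open>auto simp: homogeneous_def\<close>)
    also have "\<dots> = (\<Sum>m\<le>k. if m = n then fact (n + 2) * gamma (?c n) z $ l else 0)"
      by (intro sum.cong refl) (subst taylor_sum_homogeneous[OF g], auto)
    finally have "fact (n + 2) * gamma (?c n) z $ l = 0"
      using n taylor_sum_vanish[OF v, of "n + 2" l z] by simp
    then show ?thesis by simp
  qed
  then have "gamma (?c n) = (\<lambda>_. 0)" if "n \<le> k" for n using that by (simp add: fun_eq_iff vec_eq_iff)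
  then show ?thesis using h by (auto simp: C_prod_def C_space_def jet_def[of k \<theta>] PiE_def)
qed


section \<open>Germs of diffeomorphisms and the transition rule\<close>

text \<open>The inverse germ is carried along because \<open>transform\<close> refers to it, and the
  base points are arbitrary because \<open>transform\<close> near y involves the germs at all nearby
  points.\<close>

definition germ_diffeo :: "real^'m::finite \<Rightarrow> real^'m \<Rightarrow> (real^'m \<Rightarrow> real^'m) \<Rightarrow> (real^'m \<Rightarrow> real^'m) \<Rightarrow> bool"
  where "germ_diffeo x y g h \<longleftrightarrow> smooth_at x g \<and> smooth_at y h \<and> g x = y \<and> h y = x \<and>
    (\<forall>\<^sub>F z in nhds x. h (g z) = z) \<and> (\<forall>\<^sub>F w in nhds y. g (h w) = w)"

lemma germ_diffeoD:
  assumes "germ_diffeo x y g h"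
  shows "smooth_at x g" "smooth_at y h" "g x = y" "h y = x"
    "\<forall>\<^sub>F z in nhds x. h (g z) = z" "\<forall>\<^sub>F w in nhds y. g (h w) = w"
  using assms by (auto simp: germ_diffeo_def)

lemma germ_diffeo_sym: "germ_diffeo x y g h \<Longrightarrow> germ_diffeo y x h g"
  by (auto simp: germ_diffeo_def)

lemma eventually_smooth_compose:
  assumes "smooth_at y h" "\<forall>\<^sub>F z in nhds (h y). P z"
  shows "\<forall>\<^sub>F w in nhds y. P (h w)"
  using eventually_compose_filterlim[OF assms(2), of h "nhds y"] smooth_at_continuous[OF assms(1)]
  by (simp add: isCont_def tendsto_at_iff_tendsto_nhds)

lemma germ_diffeo_compose:
  assumes "germ_diffeo x y g1 h1" "germ_diffeo y z g2 h2"
  shows "germ_diffeo x z (\<lambda>u. g2 (g1 u)) (\<lambda>w. h1 (h2 w))"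
proof -
  note 1 = germ_diffeoD[OF assms(1)] and 2 = germ_diffeoD[OF assms(2)]
  have "\<forall>\<^sub>F u in nhds x. h2 (g2 (g1 u)) = g1 u"
    using eventually_smooth_compose[OF 1(1), of "\<lambda>u. h2 (g2 u) = u"] 1 2 by simp
  then have a: "\<forall>\<^sub>F u in nhds x. h1 (h2 (g2 (g1 u))) = u"
    using 1(5) by eventually_elim simp
  have "\<forall>\<^sub>F w in nhds z. g1 (h1 (h2 w)) = h2 w"
    using eventually_smooth_compose[OF 2(2), of "\<lambda>u. g1 (h1 u) = u"] 1 2 by simp
  then have b: "\<forall>\<^sub>F w in nhds z. g2 (g1 (h1 (h2 w))) = w"
    using 2(6) by eventually_elim simp
  show ?thesis unfolding germ_diffeo_def
    using a b 1 2 smooth_at_compose[of x g1 g2] smooth_at_compose[of z h2 h1] by simp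
qed

text \<open>With this, pointwise identities for \<open>transform\<close>, such as the composition
  law, become identities of germs and can be differentiated.\<close>

lemma germ_diffeo_eventually:
  assumes "germ_diffeo x y g h"
  shows "\<forall>\<^sub>F w in nhds y. germ_diffeo (h w) w g h"
proof -
  note 1 = germ_diffeoD[OF assms]
  have "\<forall>\<^sub>F w in nhds y. smooth_at (h w) g"
    by (rule eventually_smooth_compose[OF 1(2)]) (simp add: 1 smooth_at_eventually)
  moreover have "\<forall>\<^sub>F w in nhds y. \<forall>\<^sub>F z in nhds (h w). h (g z) = z"
    by (rule eventually_smooth_compose[OF 1(2)]) (simp add: 1 eventually_eventually)
  moreover have "\<forall>\<^sub>F w in nhds y. \<forall>\<^sub>F w in nhds w. g (h w) = w"
    by (simp add: 1 eventually_eventually)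
  ultimately show ?thesis using smooth_at_eventually[OF 1(2)] 1(6)
    by eventually_elim (simp add: germ_diffeo_def)
qed

section \<open>Jacobi matrices and the transition rule\<close>

lemma jacobian_nth: "jacobian g (at x) $ l $ a = pd a g x $ l"
  by (simp add: jacobian_def matrix_def pd_def)

lemma jacobian_cong: "\<forall>\<^sub>F y in nhds x. f y = g y \<Longrightarrow> jacobian f (at x) = jacobian g (at x)"
  by (simp add: jacobian_def frechet_derivative_cong)

lemma jacobian_compose:
  fixes f :: "real^'b::finite \<Rightarrow> real^'c::finite" and g :: "real^'a::finite \<Rightarrow> real^'b"
  assumes "smooth_at x g" "smooth_at (g x) f"
  shows "jacobian (\<lambda>y. f (g y)) (at x) = jacobian f (at (g x)) ** jacobian g (at x)"
proof -
  have "pd a (\<lambda>y. f (g y)) x $ l = (\<Sum>j\<in>UNIV. pd j f (g x) $ l * pd a g x $ j)" for a l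
  proof -
    have "smooth_at (g x) (\<lambda>y. f y $ l)" using assms(2) by (simp add: smooth_at_vec_iff)
    from pd_compose[OF assms(1) this, of a] show ?thesis
      using assms smooth_at_compose[OF assms] by (simp add: pd_vec_nth)
  qed
  then show ?thesis by (simp add: vec_eq_iff jacobian_nth matrix_matrix_mult_def)
qed

lemma jacobian_ident: "jacobian (\<lambda>x::real^'m::finite. x) (at x) = mat 1"
proof -
  have "pd a (\<lambda>x::real^'m. x) x $ l = pd a (\<lambda>x. x $ l) x" for a l
    by (rule pd_vec_nth[OF smooth_at_ident, symmetric])
  then show ?thesis by (simp add: vec_eq_iff jacobian_nth pd_nth mat_def)
qed

lemma germ_diffeo_jacobian:
  assumes "germ_diffeo x y g h"
  shows "jacobian h (at y) ** jacobian g (at x) = mat 1" "jacobian g (at x) ** jacobian h (at y) = mat 1"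
proof -
  note 1 = germ_diffeoD[OF assms]
  show "jacobian h (at y) ** jacobian g (at x) = mat 1"
    using jacobian_compose[of x g h] jacobian_cong[OF 1(5)] 1 by (simp add: jacobian_ident)
  show "jacobian g (at x) ** jacobian h (at y) = mat 1"
    using jacobian_compose[of y h g] jacobian_cong[OF 1(6)] 1 by (simp add: jacobian_ident)
qed

lemma frechet_derivative_jacobian:
  fixes g :: "real^'a::finite \<Rightarrow> real^'b::finite"
  shows "smooth_at x g \<Longrightarrow> frechet_derivative g (at x) v = jacobian g (at x) *v v"
  by (simp add: jacobian_def matrix_works linear_frechet_derivative smooth_at_differentiable)

lemma transform_cong:
  assumes "\<forall>\<^sub>F z in nhds (h y). g z = g' z" "\<forall>\<^sub>F w in nhds y. h w = h' w" "\<theta> (h y) = \<theta>' (h y)"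
  shows "transform g h \<theta> y = transform g' h' \<theta>' y"
proof -
  have y: "h' y = h y" using eventually_nhds_x_imp_x[OF assms(2)] by simp
  have "\<forall>\<^sub>F w in nhds y. \<forall>\<^sub>F w in nhds w. h w = h' w" using assms(2) by (simp add: eventually_eventually)
  then have "\<forall>\<^sub>F w in nhds y. jacobian h (at w) $ a $ j = jacobian h' (at w) $ a $ j" for a j
    by eventually_elim (simp add: jacobian_cong)
  from frechet_derivative_cong[OF this] show ?thesis
    using jacobian_cong[OF assms(1)] jacobian_cong[OF assms(2)] by (simp add: transform_def y assms(3) Let_def)
qed

lemma transform_nth:
  assumes "smooth_at (h y) g" "smooth_at y h"
  shows "transform g h \<theta> y $ l $ i $ j =
    (\<Sum>a\<in>UNIV. pd a (\<lambda>z. g z $ l) (h y) * pd i (pd j (\<lambda>z. h z $ a)) y) +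
    (\<Sum>a\<in>UNIV. \<Sum>c\<in>UNIV. \<Sum>b\<in>UNIV. pd a (\<lambda>z. g z $ l) (h y) * pd i (\<lambda>z. h z $ c) y * pd j (\<lambda>z. h z $ b) y * \<theta> (h y) $ a $ c $ b)"
proof -
  have "\<forall>\<^sub>F w in nhds y. jacobian h (at w) $ a $ j = pd j (\<lambda>z. h z $ a) w" for a
    using smooth_at_eventually[OF assms(2)] by eventually_elim (simp add: jacobian_nth pd_vec_nth)
  from frechet_derivative_cong[OF this]
  have "frechet_derivative (\<lambda>y'. jacobian h (at y') $ a $ j) (at y) (axis i 1) = pd i (pd j (\<lambda>z. h z $ a)) y" for a
    by (simp add: pd_def[of i])
  then show ?thesis by (simp add: transform_def Let_def jacobian_nth pd_vec_nth assms)
qed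

lemma smooth_at_transform:
  assumes "smooth_at (h y) g" "smooth_at y h" "smooth_at (h y) \<theta>"
  shows "smooth_at y (transform g h \<theta>)"
  unfolding smooth_at_chr_iff
proof (intro allI)
  fix l i j
  have g: "smooth_at (h y) (\<lambda>z. g z $ l)" for l using assms by (simp add: smooth_at_vec_iff)
  have h: "smooth_at y (\<lambda>z. h z $ l)" for l using assms by (simp add: smooth_at_vec_iff)
  have t: "smooth_at (h y) (\<lambda>z. \<theta> z $ a $ c $ b)" for a b c using assms by (simp add: smooth_at_chr_iff)
  have "smooth_at y (\<lambda>y. (\<Sum>a\<in>UNIV. pd a (\<lambda>z. g z $ l) (h y) * pd i (pd j (\<lambda>z. h z $ a)) y) +
    (\<Sum>a\<in>UNIV. \<Sum>c\<in>UNIV. \<Sum>b\<in>UNIV. pd a (\<lambda>z. g z $ l) (h y) * pd i (\<lambda>z. h z $ c) y * pd j (\<lambda>z. h z $ b) y * \<theta> (h y) $ a $ c $ b))"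
    by (intro smooth_at_add smooth_at_sum smooth_at_mult smooth_at_compose[OF assms(2)] t smooth_at_pd[OF g] smooth_at_pd[OF h] smooth_at_pd[OF smooth_at_pd[OF h]])
  moreover have "\<forall>\<^sub>F w in nhds y. smooth_at (h w) g"
    by (rule eventually_smooth_compose[OF assms(2) smooth_at_eventually[OF assms(1)]])
  then have "\<forall>\<^sub>F w in nhds y. (\<Sum>a\<in>UNIV. pd a (\<lambda>z. g z $ l) (h w) * pd i (pd j (\<lambda>z. h z $ a)) w) +
    (\<Sum>a\<in>UNIV. \<Sum>c\<in>UNIV. \<Sum>b\<in>UNIV. pd a (\<lambda>z. g z $ l) (h w) * pd i (\<lambda>z. h z $ c) w * pd j (\<lambda>z. h z $ b) w * \<theta> (h w) $ a $ c $ b)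
    = transform g h \<theta> w $ l $ i $ j"
    using smooth_at_eventually[OF assms(2)] by eventually_elim (simp add: transform_nth)
  ultimately show "smooth_at y (\<lambda>y. transform g h \<theta> y $ l $ i $ j)"
    by (rule smooth_at_cong)
qed

text \<open>The components of a connection as a vector-valued bilinear map. In this form the
  transition rule can be composed without juggling sums over indices.\<close>

definition bil :: "'m::finite chr \<Rightarrow> real^'m \<Rightarrow> real^'m \<Rightarrow> real^'m"
  where "bil t u v = (\<Sum>i\<in>UNIV. \<Sum>j\<in>UNIV. (u $ i * v $ j) *\<^sub>R (\<chi> l. t $ l $ i $ j))"

lemma bil_nth: "bil t u v $ l = (\<Sum>i\<in>UNIV. \<Sum>j\<in>UNIV. u $ i * v $ j * t $ l $ i $ j)"
  by (simp add: bil_def)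

lemma bil_axis: "bil t (axis i 1) (axis j 1) $ l = t $ l $ i $ j"
proof -
  have "bil t (axis i 1) (axis j 1) $ l = (\<Sum>i'\<in>UNIV. if i' = i then (\<Sum>j'\<in>UNIV. if j' = j then t $ l $ i' $ j' else 0) else 0)"
    unfolding bil_nth by (intro sum.cong refl) (auto simp: axis_def intro!: sum.cong)
  then show ?thesis by simp
qed

lemma bil_sum:
  "bil t (\<Sum>i\<in>I. f i) v = (\<Sum>i\<in>I. bil t (f i) v)" "bil t u (\<Sum>i\<in>I. f i) = (\<Sum>i\<in>I. bil t u (f i))"
  "bil t (c *\<^sub>R u) v = c *\<^sub>R bil t u v" "bil t u (c *\<^sub>R v) = c *\<^sub>R bil t u v"
proof -
  have 1: "linear (\<lambda>u. bil t u v)" for v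
    by (rule linearI) (simp_all add: vec_eq_iff bil_nth sum.distrib sum_distrib_left distrib_right mult.assoc)
  have 2: "linear (bil t u)" for u
    by (rule linearI) (simp_all add: vec_eq_iff bil_nth sum.distrib sum_distrib_left distrib_right distrib_left mult_ac)
  show "bil t (\<Sum>i\<in>I. f i) v = (\<Sum>i\<in>I. bil t (f i) v)" by (rule linear_sum[OF 1])
  show "bil t u (\<Sum>i\<in>I. f i) = (\<Sum>i\<in>I. bil t u (f i))" by (rule linear_sum[OF 2])
  show "bil t (c *\<^sub>R u) v = c *\<^sub>R bil t u v" by (rule linear_cmul[OF 1])
  show "bil t u (c *\<^sub>R v) = c *\<^sub>R bil t u v" by (rule linear_cmul[OF 2])
qed

lemma bil_lincomb:
  "bil t (\<Sum>i\<in>I. u i *\<^sub>R f i) (\<Sum>j\<in>J. v j *\<^sub>R g j) = (\<Sum>i\<in>I. \<Sum>j\<in>J. (u i * v j) *\<^sub>R bil t (f i) (g j))"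
  by (simp only: bil_sum(1,3)) (simp only: bil_sum(2,4) scaleR_sum_right scaleR_scaleR)

lemma bil_cong: "(\<And>i j. bil t (axis i 1) (axis j 1) = bil t' (axis i 1) (axis j 1)) \<Longrightarrow> t = t'"
  by (metis bil_axis vec_eq_iff)

lemma bil_expand: "bil t u v = (\<Sum>i\<in>UNIV. \<Sum>j\<in>UNIV. (u $ i * v $ j) *\<^sub>R bil t (axis i 1) (axis j 1))"
  by (simp add: vec_eq_iff bil_axis) (simp add: bil_nth)

definition hess :: "(real^'m::finite \<Rightarrow> real^'m) \<Rightarrow> real^'m \<Rightarrow> real^'m \<Rightarrow> real^'m \<Rightarrow> real^'m"
  where "hess h y = bil (\<chi> l i j. pd i (pd j h) y $ l)"

lemma hess_expand: "hess h y u v = (\<Sum>i\<in>UNIV. \<Sum>j\<in>UNIV. (u $ i * v $ j) *\<^sub>R pd i (pd j h) y)"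
  by (simp add: hess_def bil_def)

lemma matrix_vector_sum: "(A :: real^'n::finite^'m::finite) *v (\<Sum>i\<in>I. f i) = (\<Sum>i\<in>I. A *v f i)"
  by (rule linear_sum[OF matrix_vector_mul_linear])

lemma matrix_vector_scaleR: "(A :: real^'n::finite^'m::finite) *v (c *\<^sub>R f) = c *\<^sub>R (A *v f)"
  by (rule linear_cmul[OF matrix_vector_mul_linear])

text \<open>The transition rule free of indices: with J and K the Jacobi matrices of g and h, the
  value at (u, v) is J applied to h''(u, v) + \<theta>(K u, K v). Both sides are bilinear, so basis
  vectors suffice.\<close>

lemma bil_transform:
  assumes "smooth_at (h y) g" "smooth_at y h"
  shows "bil (transform g h \<theta> y) u v = jacobian g (at (h y)) *v
    (hess h y u v + bil (\<theta> (h y)) (jacobian h (at y) *v u) (jacobian h (at y) *v v))"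
proof -
  have ax: "bil (transform g h \<theta> y) (axis i 1) (axis j 1) = jacobian g (at (h y)) *v
    (pd i (pd j h) y + bil (\<theta> (h y)) (pd i h y) (pd j h y))" for i j
  proof -
    have "pd i (pd j (\<lambda>z. h z $ a)) y = pd i (pd j h) y $ a" for a
    proof -
      have "\<forall>\<^sub>F z in nhds y. pd j (\<lambda>z. h z $ a) z = pd j h z $ a"
        using smooth_at_eventually[OF assms(2)] by eventually_elim (rule pd_vec_nth)
      then have "pd i (pd j (\<lambda>z. h z $ a)) y = pd i (\<lambda>z. pd j h z $ a) y" by (rule pd_cong)
      then show ?thesis by (simp add: pd_vec_nth smooth_at_pd assms)
    qed
    then show ?thesis
      unfolding vec_eq_iff bil_axis transform_nth[OF assms] pd_vec_nth[OF assms(1)] pd_vec_nth[OF assms(2)]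
      by (simp add: matrix_vector_mult_def jacobian_nth bil_nth sum_distrib_left distrib_left sum.distrib mult.assoc)
  qed
  have e: "jacobian h (at y) *v u = (\<Sum>i\<in>UNIV. u $ i *\<^sub>R pd i h y)" for u
    by (simp add: frechet_derivative_jacobian[OF assms(2), symmetric] frechet_derivative_pd[OF assms(2)])
  have "bil (transform g h \<theta> y) u v = (\<Sum>i\<in>UNIV. \<Sum>j\<in>UNIV. (u $ i * v $ j) *\<^sub>R (jacobian g (at (h y)) *v
    (pd i (pd j h) y + bil (\<theta> (h y)) (pd i h y) (pd j h y))))"
    by (subst bil_expand) (simp add: ax)
  also have "\<dots> = jacobian g (at (h y)) *v (\<Sum>i\<in>UNIV. \<Sum>j\<in>UNIV. (u $ i * v $ j) *\<^sub>R 
    (pd i (pd j h) y + bil (\<theta> (h y)) (pd i h y) (pd j h y)))"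
    by (simp only: matrix_vector_sum matrix_vector_scaleR)
  also have "(\<Sum>i\<in>UNIV. \<Sum>j\<in>UNIV. (u $ i * v $ j) *\<^sub>R (pd i (pd j h) y + bil (\<theta> (h y)) (pd i h y) (pd j h y)))
     = hess h y u v + (\<Sum>i\<in>UNIV. \<Sum>j\<in>UNIV. (u $ i * v $ j) *\<^sub>R bil (\<theta> (h y)) (pd i h y) (pd j h y))"
    by (simp add: hess_expand scaleR_add_right sum.distrib)
  also have "(\<Sum>i\<in>UNIV. \<Sum>j\<in>UNIV. (u $ i * v $ j) *\<^sub>R bil (\<theta> (h y)) (pd i h y) (pd j h y)) =
     bil (\<theta> (h y)) (jacobian h (at y) *v u) (jacobian h (at y) *v v)"
    by (simp only: e bil_lincomb)
  finally show ?thesis .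
qed

lemma hess_compose:
  fixes h1 h2 :: "real^'m::finite \<Rightarrow> real^'m"
  assumes "smooth_at z h2" "smooth_at (h2 z) h1"
  shows "hess (\<lambda>w. h1 (h2 w)) z u v = jacobian h1 (at (h2 z)) *v hess h2 z u v +
     hess h1 (h2 z) (jacobian h2 (at z) *v u) (jacobian h2 (at z) *v v)"
proof -
  have e: "jacobian h (at y) *v u = (\<Sum>i\<in>UNIV. u $ i *\<^sub>R pd i h y)" if "smooth_at y h" for h y and u :: "real^'m"
    by (simp add: frechet_derivative_jacobian[OF that, symmetric] frechet_derivative_pd[OF that])
  \<comment> \<open>The outer map is left arbitrary, since the formula is applied to h1 and then to
    its partial derivatives.\<close>
  have pdc: "pd j (\<lambda>w. h1 (h2 w)) w = (\<Sum>b\<in>UNIV. pd j h2 w $ b *\<^sub>R pd b h1 (h2 w))"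
    if "smooth_at w h2" "smooth_at (h2 w) h1" for w j and h1 :: "real^'m \<Rightarrow> real^'m"
  proof -
    have "smooth_at (h2 w) (\<lambda>y. h1 y $ l)" for l using that by (simp add: smooth_at_vec_iff)
    from pd_compose[OF that(1) this, of j]
    show ?thesis using that smooth_at_compose[OF that]
      by (simp add: vec_eq_iff pd_vec_nth mult.commute)
  qed
  have pdpd: "pd i (pd j (\<lambda>w. h1 (h2 w))) z = (\<Sum>b\<in>UNIV. pd i (pd j h2) z $ b *\<^sub>R pd b h1 (h2 z)) +
     (\<Sum>b\<in>UNIV. \<Sum>c\<in>UNIV. (pd i h2 z $ c * pd j h2 z $ b) *\<^sub>R pd c (pd b h1) (h2 z))" for i j
  proof -
    have "\<forall>\<^sub>F w in nhds z. pd j (\<lambda>w. h1 (h2 w)) w = (\<Sum>b\<in>UNIV. pd j h2 w $ b *\<^sub>R pd b h1 (h2 w))"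
      using smooth_at_eventually[OF assms(1)] eventually_smooth_compose[OF assms(1) smooth_at_eventually[OF assms(2)]]
      by eventually_elim (rule pdc)
    then have "pd i (pd j (\<lambda>w. h1 (h2 w))) z = pd i (\<lambda>w. \<Sum>b\<in>UNIV. pd j h2 w $ b *\<^sub>R pd b h1 (h2 w)) z"
      by (rule pd_cong)
    also have "\<dots> = (\<Sum>b\<in>UNIV. pd i (\<lambda>w. pd j h2 w $ b *\<^sub>R pd b h1 (h2 w)) z)"
      using smooth_at_pd[OF assms(1), of j]
      by (intro pd_sum smooth_at_scaleR smooth_at_compose[OF assms(1)] smooth_at_pd assms) (simp add: smooth_at_vec_iff)
    also have "\<dots> = (\<Sum>b\<in>UNIV. pd j h2 z $ b *\<^sub>R pd i (\<lambda>w. pd b h1 (h2 w)) z + pd i (pd j h2) z $ b *\<^sub>R pd b h1 (h2 z))"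
    proof (intro sum.cong refl)
      fix b
      have s: "smooth_at z (\<lambda>w. pd j h2 w $ b)" "smooth_at z (\<lambda>w. pd b h1 (h2 w))"
        using smooth_at_pd[OF assms(1), of j] smooth_at_compose[OF assms(1) smooth_at_pd[OF assms(2)]] by (auto simp: smooth_at_vec_iff)
      have p: "pd i (\<lambda>w. pd j h2 w $ b) z = pd i (pd j h2) z $ b"
        by (rule pd_vec_nth[OF smooth_at_pd[OF assms(1)]])
      from has_derivative_imp_pd[OF has_derivative_scaleR[OF s[THEN smooth_at_differentiable, THEN has_frechet_derivative]], of i]
      show "pd i (\<lambda>w. pd j h2 w $ b *\<^sub>R pd b h1 (h2 w)) z = pd j h2 z $ b *\<^sub>R pd i (\<lambda>w. pd b h1 (h2 w)) z + pd i (pd j h2) z $ b *\<^sub>R pd b h1 (h2 z)"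
        unfolding p[symmetric] by (simp add: pd_def[of i])
    qed
    also have "\<dots> = (\<Sum>b\<in>UNIV. pd i (pd j h2) z $ b *\<^sub>R pd b h1 (h2 z)) +
     (\<Sum>b\<in>UNIV. \<Sum>c\<in>UNIV. (pd i h2 z $ c * pd j h2 z $ b) *\<^sub>R pd c (pd b h1) (h2 z))"
      by (simp add: pdc[OF assms(1) smooth_at_pd[OF assms(2)]] sum.distrib scaleR_sum_right mult.commute add.commute)
    finally show ?thesis .
  qed
  have ij: "pd i (pd j (\<lambda>w. h1 (h2 w))) z = jacobian h1 (at (h2 z)) *v pd i (pd j h2) z + hess h1 (h2 z) (pd i h2 z) (pd j h2 z)" for i j
  proof -
    have "(\<Sum>b\<in>UNIV. \<Sum>c\<in>UNIV. (pd i h2 z $ c * pd j h2 z $ b) *\<^sub>R pd c (pd b h1) (h2 z)) = hess h1 (h2 z) (pd i h2 z) (pd j h2 z)"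
      unfolding hess_expand by (rule sum.swap)
    then show ?thesis using pdpd by (simp add: e[OF assms(2)])
  qed
  have he: "hess h1 (h2 z) (\<Sum>i\<in>UNIV. u $ i *\<^sub>R pd i h2 z) (\<Sum>i\<in>UNIV. v $ i *\<^sub>R pd i h2 z) =
     (\<Sum>i\<in>UNIV. \<Sum>j\<in>UNIV. (u $ i * v $ j) *\<^sub>R hess h1 (h2 z) (pd i h2 z) (pd j h2 z))"
    unfolding hess_def by (rule bil_lincomb)
  show ?thesis
    unfolding e[OF assms(1)] he
    by (simp add: hess_expand[of "\<lambda>w. h1 (h2 w)"] hess_expand[of h2] ij scaleR_add_right sum.distrib matrix_vector_sum matrix_vector_scaleR)
qed

text \<open>The Hessian of the composite inverse has two terms. In one the Jacobi matrices of g1 and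
  h1 cancel, leaving the inhomogeneous term of the outer change; the other is absorbed into the
  inner \<open>transform\<close>.\<close>

lemma transform_compose:
  fixes x y z :: "real^'m::finite"
  assumes "germ_diffeo x y g1 h1" "germ_diffeo y z g2 h2"
  shows "transform (\<lambda>u. g2 (g1 u)) (\<lambda>w. h1 (h2 w)) \<theta> z = transform g2 h2 (transform g1 h1 \<theta>) z"
proof (rule bil_cong)
  fix i j
  let ?u = "axis i 1 :: real^'m" and ?v = "axis j 1 :: real^'m"
  note 1 = germ_diffeoD[OF assms(1)] and 2 = germ_diffeoD[OF assms(2)]
  note 3 = germ_diffeoD[OF germ_diffeo_compose[OF assms]]
  have J: "jacobian (\<lambda>u. g2 (g1 u)) (at x) = jacobian g2 (at y) ** jacobian g1 (at x)"
    using jacobian_compose[of x g1 g2] 1 2 by simp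
  have K: "jacobian (\<lambda>u. h1 (h2 u)) (at z) = jacobian h1 (at y) ** jacobian h2 (at z)"
    using jacobian_compose[of z h2 h1] 1 2 by simp
  have JK: "jacobian g1 (at x) *v (jacobian h1 (at y) *v w) = w" for w
    by (simp add: matrix_vector_mul_assoc germ_diffeo_jacobian[OF assms(1)])
  have "bil (transform (\<lambda>u. g2 (g1 u)) (\<lambda>w. h1 (h2 w)) \<theta> z) ?u ?v = 
    jacobian g2 (at y) *v (jacobian g1 (at x) *v (jacobian h1 (at y) *v hess h2 z ?u ?v + 
       (hess h1 y (jacobian h2 (at z) *v ?u) (jacobian h2 (at z) *v ?v) +
        bil (\<theta> x) (jacobian h1 (at y) *v (jacobian h2 (at z) *v ?u)) (jacobian h1 (at y) *v (jacobian h2 (at z) *v ?v)))))"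
    using bil_transform[of "\<lambda>w. h1 (h2 w)" z "\<lambda>u. g2 (g1 u)" \<theta> ?u ?v] 1 2 3 hess_compose[of z h2 h1 ?u ?v]
    by (simp add: J K matrix_vector_mul_assoc[symmetric] add.assoc)
  also have "\<dots> = jacobian g2 (at y) *v (hess h2 z ?u ?v + bil (transform g1 h1 \<theta> y) (jacobian h2 (at z) *v ?u) (jacobian h2 (at z) *v ?v))"
    using bil_transform[of h1 y g1 \<theta>] 1 by (simp add: matrix_vector_right_distrib[of "jacobian g1 (at x)"] JK)
  also have "\<dots> = bil (transform g2 h2 (transform g1 h1 \<theta>) z) ?u ?v"
    using bil_transform[of h2 z g2 "transform g1 h1 \<theta>"] 2 by simp
  finally show "bil (transform (\<lambda>u. g2 (g1 u)) (\<lambda>w. h1 (h2 w)) \<theta> z) ?u ?v = bil (transform g2 h2 (transform g1 h1 \<theta>) z) ?u ?v" .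
qed


section \<open>Normal forms of germs of connections\<close>

lemma Ck_on_det:
  fixes A :: "'a::real_normed_vector \<Rightarrow> real^'n^'n::finite"
  assumes "open S" "\<And>i j. Ck_on n S (\<lambda>x. A x $ i $ j)"
  shows "Ck_on n S (\<lambda>x. det (A x))"
  unfolding det_def by (intro Ck_on_sum Ck_on_mult Ck_on_prod Ck_on_const assms)

text \<open>The inverse function theorem supplies a differentiable inverse h. Its smoothness is
  bootstrapped: the derivative of h is expressed through h and the derivatives of g, so if h is C^n,
  then so is its derivative.\<close>

lemma exists_germ_inverse:
  fixes g :: "real^'m::finite \<Rightarrow> real^'m"
  assumes "smooth_at x g" "det (jacobian g (at x)) \<noteq> 0"
  obtains h where "germ_diffeo x (g x) g h"
proof -
  obtain U where U: "open U" "x \<in> U" "smooth_on U g" using assms by (auto simp: smooth_at_def)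
  have sm: "smooth_at y g" if "y \<in> U" for y using U that by (intro smooth_atI[of U])
  define f' where "f' y = Blinfun (frechet_derivative g (at y))" for y
  have app: "blinfun_apply (f' y) = frechet_derivative g (at y)" if "y \<in> U" for y
    unfolding f'_def by (rule bounded_linear_Blinfun_apply)
      (rule has_derivative_bounded_linear[OF has_frechet_derivative[OF smooth_at_differentiable[OF sm[OF that]]]])
  define invf where "invf = Blinfun (\<lambda>v. matrix_inv (jacobian g (at x)) *v v)"
  have appi: "blinfun_apply invf = (\<lambda>v. matrix_inv (jacobian g (at x)) *v v)"
    unfolding invf_def by (rule bounded_linear_Blinfun_apply) (rule matrix_vector_mul_bounded_linear)
  have "invertible (jacobian g (at x))" using assms(2) by (simp add: invertible_det_nz)
  then have "matrix_inv (jacobian g (at x)) ** jacobian g (at x) = mat 1" unfolding invertible_def matrix_inv_def by (rule someI2_ex) simp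
  then have i: "invf o\<^sub>L f' x = id_blinfun"
    by (intro blinfun_eqI) (simp add: app[OF U(2)] appi frechet_derivative_jacobian[OF sm[OF U(2)]] matrix_vector_mul_assoc)
  have c: "continuous_on U f'"
  proof (rule continuous_on_blinfun_componentwise)
    fix b :: "real^'m" assume "b \<in> Basis"
    have "Ck_on 0 U (\<lambda>y. frechet_derivative g (at y) b)"
      using smooth_on_frechet[OF U(3)] unfolding smooth_on_def by blast
    then show "continuous_on U (\<lambda>y. blinfun_apply (f' y) b)" by (simp add: app)
  qed
  have d: "(g has_derivative blinfun_apply (f' y)) (at y)" if "y \<in> U" for y
    using has_frechet_derivative[OF smooth_at_differentiable[OF sm[OF that]]] by (simp add: app[OF that])
  obtain U' V h h' where U': "open U'" "U' \<subseteq> U" "x \<in> U'" and V: "open V" "g x \<in> V" and hom: "homeomorphism U' V g h"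
    and hd: "\<And>y. y \<in> V \<Longrightarrow> (h has_derivative (h' y)) (at y)"
    and hi: "\<And>y. y \<in> V \<Longrightarrow> h' y = inv (blinfun_apply (f' (h y)))"
    and bi: "\<And>y. y \<in> V \<Longrightarrow> bij (blinfun_apply (f' (h y)))"
  proof (rule inverse_function_theorem[OF U(1) d c U(2) i], goal_cases)
    case (2 U' V h h')
    show ?case by (rule 2(1)) (fact 2)+
  qed
  have hU: "h y \<in> U" if "y \<in> V" for y using homeomorphism_image2[OF hom] that U' by blast
  define A where "A y = jacobian g (at (h y))" for y
  have Ah: "A y *v frechet_derivative h (at y) v = v" if "y \<in> V" for y v
  proof -
    have "frechet_derivative h (at y) = h' y" using hd[OF that] by (metis frechet_derivative_at)
    then have "frechet_derivative g (at (h y)) (frechet_derivative h (at y) v) = v"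
      using hi[OF that] bi[OF that] app[OF hU[OF that]] by (simp add: bij_is_surj surj_f_inv_f)
    then show ?thesis by (simp add: frechet_derivative_jacobian[OF sm[OF hU[OF that]]] A_def)
  qed
  have dA: "det (A y) \<noteq> 0" if "y \<in> V" for y
  proof -
    have "h differentiable at y" using hd[OF that] by (auto simp: differentiable_def)
    then have "(h has_derivative (\<lambda>v. jacobian h (at y) *v v)) (at y)" by (simp add: jacobian_works)
    from frechet_derivative_at[OF this] have "A y ** jacobian h (at y) = mat 1"
      using Ah[OF that] by (simp add: matrix_eq matrix_vector_mul_assoc[symmetric])
    then have "invertible (A y)" using invertible_right_inverse by blast
    then show ?thesis by (simp add: invertible_det_nz)
  qed
  have "Ck_on n V h" for n
  proof (induction n)
    case 0
    then show ?case using homeomorphism_cont2[OF hom] by simp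
  next
    case (Suc n)
    have a: "Ck_on n V (\<lambda>y. A y $ i $ j)" for i j
    proof -
      have "smooth_on U (pd j g)" unfolding pd_def by (rule smooth_on_frechet[OF U(3)])
      then have "Ck_on n V (\<lambda>y. pd j g (h y))"
        using hU by (intro Ck_on_compose[OF V(1) _ Suc, of U]) (auto simp: smooth_on_def)
      then show ?thesis using Ck_on_vec_nth[OF V(1), of n "\<lambda>y. pd j g (h y)"] by (simp add: A_def jacobian_nth)
    qed
    \<comment> \<open>By Cramer's rule the derivative of h is a rational function of the derivatives of g at h y.\<close>
    have cr: "frechet_derivative h (at y) v = (\<chi> k. det (\<chi> i j. if j = k then v $ i else A y $ i $ j) * inverse (det (A y)))" if "y \<in> V" for y v
      using cramer[OF dA[OF that]] Ah[OF that] by (metis (no_types, lifting) divide_inverse vec_lambda_unique)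
    have "Ck_on n V (\<lambda>y. \<chi> k. det (\<chi> i j. if j = k then v $ i else A y $ i $ j) * inverse (det (A y)))" for v
      unfolding Ck_on_vec_nth[OF V(1)]
    proof (intro allI)
      fix k
      have "Ck_on n V (\<lambda>y. (\<chi> i j. if j = k then v $ i else A y $ i $ j) $ i' $ j')" for i' j'
        using a by (cases "j' = k") (simp_all add: Ck_on_const)
      then show "Ck_on n V (\<lambda>y. (\<chi> k. det (\<chi> i j. if j = k then v $ i else A y $ i $ j) * inverse (det (A y))) $ k)"
        using dA by (simp, intro Ck_on_mult Ck_on_inverse Ck_on_det V(1) a) auto
    qed
    then have "Ck_on n V (\<lambda>y. frechet_derivative h (at y) v)" for v
      by (rule Ck_on_cong[OF V(1), rotated]) (simp add: cr)
    then show ?case using hd by (auto simp: differentiable_def)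
  qed
  then have "smooth_at (g x) h" using V by (intro smooth_atI[of V]) (auto simp: smooth_on_def)
  moreover have "\<forall>\<^sub>F z in nhds x. h (g z) = z" "\<forall>\<^sub>F w in nhds (g x). g (h w) = w"
    using eventually_nhds_in_open[OF U'(1,3)] eventually_nhds_in_open[OF V]
    by (auto elim!: eventually_mono intro: homeomorphism_apply1[OF hom] homeomorphism_apply2[OF hom])
  ultimately have "germ_diffeo x (g x) g h"
    using assms(1) homeomorphism_apply1[OF hom U'(3)] by (simp add: germ_diffeo_def)
  then show thesis by (rule that)
qed

text \<open>Smoothness of both germs is included so that the congruence respects products; the
  formula for \<open>transform\<close> can then be simplified factor by factor.\<close>

definition germ_eqv :: "nat \<Rightarrow> (real^'m::finite \<Rightarrow> real) \<Rightarrow> (real^'m \<Rightarrow> real) \<Rightarrow> bool"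
  where "germ_eqv n f g \<longleftrightarrow> smooth_at 0 f \<and> smooth_at 0 g \<and> vanish n 0 (\<lambda>z. f z - g z)"

lemma germ_eqv_refl: "smooth_at 0 f \<Longrightarrow> germ_eqv n f f"
  by (simp add: germ_eqv_def vanish_zero)

lemma germ_eqv_add: 
  assumes "germ_eqv n f f'" "germ_eqv n g g'"
  shows "germ_eqv n (\<lambda>z. f z + g z) (\<lambda>z. f' z + g' z)"
  using assms vanish_add[of n 0 "\<lambda>z. f z - f' z" "\<lambda>z. g z - g' z"]
  by (auto simp: germ_eqv_def smooth_at_add algebra_simps)

lemma germ_eqv_sum: "(\<And>i. i \<in> I \<Longrightarrow> germ_eqv n (f i) (g i)) \<Longrightarrow> germ_eqv n (\<lambda>z. \<Sum>i\<in>I. f i z) (\<lambda>z. \<Sum>i\<in>I. g i z)"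
  by (induction I rule: infinite_finite_induct) (auto simp: germ_eqv_refl smooth_at_const germ_eqv_add)

lemma germ_eqv_mult: 
  assumes "germ_eqv n f f'" "germ_eqv n g g'"
  shows "germ_eqv n (\<lambda>z. f z * g z) (\<lambda>z. f' z * g' z)"
proof -
  have "vanish n 0 (\<lambda>z. (f z - f' z) * g z + f' z * (g z - g' z))"
    using assms by (intro vanish_add vanish_smooth_mult(1) vanish_smooth_mult(2)) (auto simp: germ_eqv_def)
  then show ?thesis using assms by (simp add: germ_eqv_def smooth_at_mult algebra_simps)
qed

text \<open>Euler's identity for the leading part of r. If E denotes the Euler operator, then pd_j E
  = E pd_j + pd_j; differentiating thus turns the claim for N + 1 into the claim for N and the
  partial derivatives.\<close>

lemma euler_vanish:
  assumes "vanish N 0 r"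
  shows "vanish (Suc N) 0 (\<lambda>z. (\<Sum>i\<in>UNIV. z $ i * pd i r z) - N * r z)"
  using assms
proof (induction N arbitrary: r)
  case 0
  have "smooth_at 0 (\<lambda>z. \<Sum>i\<in>UNIV. z $ i * pd i r z)"
    using 0 by (intro smooth_at_sum smooth_at_mult smooth_at_nth smooth_at_pd) simp
  then show ?case by (simp add: smooth_at_pd)
next
  case (Suc N)
  have sm: "smooth_at 0 r" using Suc.prems by simp
  have "smooth_at 0 (\<lambda>z. (\<Sum>i\<in>UNIV. z $ i * pd i r z) - Suc N * r z)"
    using sm by (intro smooth_at_diff smooth_at_sum smooth_at_mult smooth_at_nth smooth_at_pd smooth_at_const)
  moreover have "vanish (Suc N) 0 (pd j (\<lambda>z. (\<Sum>i\<in>UNIV. z $ i * pd i r z) - Suc N * r z))" for j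
  proof (rule vanish_cong)
    show "vanish (Suc N) 0 (\<lambda>z. (\<Sum>i\<in>UNIV. z $ i * pd i (pd j r) z) - N * pd j r z)"
      using Suc.prems by (intro Suc.IH) simp
    show "\<forall>\<^sub>F z in nhds 0. (\<Sum>i\<in>UNIV. z $ i * pd i (pd j r) z) - N * pd j r z = pd j (\<lambda>z. (\<Sum>i\<in>UNIV. z $ i * pd i r z) - Suc N * r z) z"
      using smooth_at_eventually[OF sm]
    proof eventually_elim
      case (elim z)
      have "pd j (\<lambda>z. (\<Sum>i\<in>UNIV. z $ i * pd i r z) - Suc N * r z) z
         = pd j (\<lambda>z. \<Sum>i\<in>UNIV. z $ i * pd i r z) z - pd j (\<lambda>z. Suc N * r z) z"
        using elim by (intro pd_diff smooth_at_sum smooth_at_mult smooth_at_nth smooth_at_pd smooth_at_const)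
      also have "pd j (\<lambda>z. Suc N * r z) z = Suc N * pd j r z"
        using pd_mult[OF smooth_at_const elim, of j "Suc N"] by simp
      also have "pd j (\<lambda>z. \<Sum>i\<in>UNIV. z $ i * pd i r z) z = (\<Sum>i\<in>UNIV. z $ i * pd j (pd i r) z) + pd j r z"
        by (rule pd_sum_nth_mult[OF smooth_at_pd[OF elim]])
      also have "(\<Sum>i\<in>UNIV. z $ i * pd j (pd i r) z) = (\<Sum>i\<in>UNIV. z $ i * pd i (pd j r) z)"
        by (simp add: pd_commute[OF elim, of j])
      finally show ?case by (simp add: algebra_simps)
    qed
  qed
  ultimately show ?case using Suc.prems by (subst vanish.simps) simp
qed

text \<open>With E the Euler operator, the second order operator is E (E r) - E r, which acts on a
  leading part of degree N as multiplication by N * N - N.\<close>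

lemma euler2_vanish:
  assumes "vanish N 0 r"
  shows "vanish (Suc N) 0 (\<lambda>z. (\<Sum>i\<in>UNIV. \<Sum>j\<in>UNIV. pd i (pd j r) z * z $ i * z $ j) - (real N * N - N) * r z)"
proof -
  let ?E = "\<lambda>r z. \<Sum>i\<in>UNIV. z $ i * pd i r z"
  have sm: "smooth_at 0 r" using assms by (rule vanish_smooth)
  have 1: "vanish (Suc N) 0 (\<lambda>z. ?E r z - N * r z)" by (rule euler_vanish[OF assms])
  have "vanish N 0 (\<lambda>z. (?E r z - N * r z) + N * r z)"
    by (intro vanish_add vanish_Suc_imp[OF 1] vanish_cmult assms)
  then have "vanish N 0 (?E r)" by simp
  then have 2: "vanish (Suc N) 0 (\<lambda>z. ?E (?E r) z - N * ?E r z)" by (rule euler_vanish)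
  \<comment> \<open>The factor N - 1 is chosen so that E (E r) - N E r + (N - 1)(E r - N r)
    collapses to E (E r) - E r - (N * N - N) r.\<close>
  have "vanish (Suc N) 0 (\<lambda>z. (?E (?E r) z - N * ?E r z) + (real N - 1) * (?E r z - N * r z))"
    by (intro vanish_add vanish_cmult 1 2)
  moreover have "\<forall>\<^sub>F z in nhds 0. (?E (?E r) z - N * ?E r z) + (real N - 1) * (?E r z - N * r z) =
     (\<Sum>i\<in>UNIV. \<Sum>j\<in>UNIV. pd i (pd j r) z * z $ i * z $ j) - (real N * N - N) * r z"
    using smooth_at_eventually[OF sm]
  proof eventually_elim
    case (elim z)
    have "?E (?E r) z = (\<Sum>i\<in>UNIV. z $ i * ((\<Sum>j\<in>UNIV. z $ j * pd i (pd j r) z) + pd i r z))"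
      by (intro sum.cong refl arg_cong2[where f = "(*)"] pd_sum_nth_mult smooth_at_pd elim)
    also have "\<dots> = (\<Sum>i\<in>UNIV. \<Sum>j\<in>UNIV. pd i (pd j r) z * z $ i * z $ j) + ?E r z"
      by (simp add: distrib_left sum.distrib sum_distrib_left mult_ac)
    finally show ?case by (simp add: algebra_simps)
  qed
  ultimately show ?thesis by (rule vanish_cong)
qed

definition second_derivs :: "(real^'m::finite \<Rightarrow> real^'m) \<Rightarrow> real^'m \<Rightarrow> 'm chr"
  where "second_derivs r = (\<lambda>z. \<chi> l i j. pd i (pd j (\<lambda>z. r z $ l)) z)"

lemma second_derivs_nth: "second_derivs r z $ l $ i $ j = pd i (pd j (\<lambda>z. r z $ l)) z"
  by (simp add: second_derivs_def)

text \<open>Write g = id + r; then h = id - r \<circ> h, and all Jacobi matrices are the identity to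
  order n + 1. The second derivatives of h must agree with those of -r to the same order, for which
  r \<circ> h and r have to agree to order n + 3, one more than the order to which r itself
  vanishes.\<close>

lemma transform_near_identity:
  assumes gd: "germ_diffeo 0 0 g h" and v: "\<And>l. vanish (n + 2) 0 (\<lambda>z. g z $ l - z $ l)" and th: "smooth_at 0 \<theta>"
  shows "con_eqv (n + 1) 0 (transform g h \<theta>) (\<lambda>z. \<theta> z - second_derivs (\<lambda>z. g z - z) z)"
proof -
  note gd' = germ_diffeoD[OF gd]
  have sg: "smooth_at 0 (\<lambda>z. g z $ l)" and sh: "smooth_at 0 (\<lambda>z. h z $ l)" for l
    using gd' by (simp_all add: smooth_at_vec_iff)
  define r where "r l = (\<lambda>z. g z $ l - z $ l)" for l
  have vr: "vanish (n + 2) 0 (r l)" and sr: "smooth_at 0 (r l)" for l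
    using v[of l] vanish_smooth by (auto simp: r_def)
  have vr': "vanish (n + 1) 0 (pd a (r l))" for a l using vanish_pd[OF vr[of l], of a] by simp
  have rh: "\<forall>\<^sub>F y in nhds 0. - r l (h y) = h y $ l - y $ l" for l
    using gd'(6) by eventually_elim (simp add: r_def)
  have "vanish (n + 2) 0 (\<lambda>y. - r l (h y))" for l
    using vanish_compose[OF gd'(2), of "n + 2" "r l"] vr[of l] gd' by (intro vanish_uminus) simp
  then have vh: "vanish (n + 2) 0 (\<lambda>y. h y $ l - y $ l)" for l by (rule vanish_cong) (rule rh)
  have dh: "vanish (n + 1) 0 (\<lambda>y. pd j (\<lambda>z. h z $ l) y - (if j = l then 1 else 0))" for j l
  proof (rule vanish_cong)
    show "vanish (n + 1) 0 (pd j (\<lambda>y. h y $ l - y $ l))" using vanish_pd[OF vh, of j l] by simp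
    show "\<forall>\<^sub>F y in nhds 0. pd j (\<lambda>y. h y $ l - y $ l) y = pd j (\<lambda>z. h z $ l) y - (if j = l then 1 else 0)"
      using smooth_at_eventually[OF sh[of l]] by eventually_elim (simp add: pd_diff smooth_at_nth pd_nth)
  qed
  have dg: "vanish (n + 1) 0 (\<lambda>y. pd a (\<lambda>z. g z $ l) (h y) - (if a = l then 1 else 0))" for a l
  proof (rule vanish_cong)
    show "vanish (n + 1) 0 (\<lambda>y. pd a (r l) (h y))" using vanish_compose[OF gd'(2), of "n + 1"] vr'[of a l] gd' by simp
    have "\<forall>\<^sub>F z in nhds (h 0). pd a (r l) z = pd a (\<lambda>z. g z $ l) z - (if a = l then 1 else 0)"
      using smooth_at_eventually[OF sg[of l]] unfolding gd'(4) r_def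
      by eventually_elim (simp add: pd_diff smooth_at_nth pd_nth)
    then show "\<forall>\<^sub>F y in nhds 0. pd a (r l) (h y) = pd a (\<lambda>z. g z $ l) (h y) - (if a = l then 1 else 0)"
      by (rule eventually_smooth_compose[OF gd'(2)])
  qed
  have rr: "vanish (n + 3) 0 (\<lambda>y. r l (h y) - r l y)" for l
  proof -
    have srh: "smooth_at 0 (\<lambda>y. r l (h y))" using smooth_at_compose[OF gd'(2), of "r l"] sr gd' by simp
    have "vanish (n + 2) 0 (pd j (\<lambda>y. r l (h y) - r l y))" for j
    proof (rule vanish_cong)
      show "vanish (n + 2) 0 (\<lambda>y. \<Sum>k\<in>UNIV. (pd k (r l) (h y) - pd k (r l) y) * pd j (\<lambda>z. h z $ k) y
          + pd k (r l) y * (pd j (\<lambda>z. h z $ k) y - (if j = k then 1 else 0)))"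
      proof (intro vanish_sum vanish_add)
        fix k
        have "vanish (n + 2) 0 (\<lambda>y. pd k (r l) (h y) - pd k (r l) y)"
          using gd' vh by (intro vanish_compose_diff[of 0 h "\<lambda>y. y" "n + 2" "pd k (r l)"] smooth_at_ident) (auto simp: sr smooth_at_pd)
        then show "vanish (n + 2) 0 (\<lambda>y. (pd k (r l) (h y) - pd k (r l) y) * pd j (\<lambda>z. h z $ k) y)"
          by (rule vanish_smooth_mult(1)) (rule smooth_at_pd[OF sh])
        \<comment> \<open>Two factors of order n + 1 suffice, as 2n + 2 is at least n + 2 even for n
          = 0.\<close>
        have "vanish (n + 1 + (n + 1)) 0 (\<lambda>y. pd k (r l) y * (pd j (\<lambda>z. h z $ k) y - (if j = k then 1 else 0)))"
          by (intro vanish_mult dh vr')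
        then show "vanish (n + 2) 0 (\<lambda>y. pd k (r l) y * (pd j (\<lambda>z. h z $ k) y - (if j = k then 1 else 0)))"
          by (rule vanish_mono) simp
      qed
      have "\<forall>\<^sub>F y in nhds 0. smooth_at (h y) (r l)"
        using eventually_smooth_compose[OF gd'(2), of "\<lambda>y. smooth_at y (r l)"] smooth_at_eventually[OF sr] gd' by simp
      then show "\<forall>\<^sub>F y in nhds 0. (\<Sum>k\<in>UNIV. (pd k (r l) (h y) - pd k (r l) y) * pd j (\<lambda>z. h z $ k) y
          + pd k (r l) y * (pd j (\<lambda>z. h z $ k) y - (if j = k then 1 else 0))) = pd j (\<lambda>y. r l (h y) - r l y) y"
        using smooth_at_eventually[OF gd'(2)] smooth_at_eventually[OF srh] smooth_at_eventually[OF sr[of l]]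
      proof eventually_elim
        case (elim y)
        have "pd j (\<lambda>y. r l (h y) - r l y) y = (\<Sum>k\<in>UNIV. pd k (r l) (h y) * pd j (\<lambda>z. h z $ k) y) - pd j (r l) y"
          using elim by (simp add: pd_diff pd_compose)
        also have "pd j (r l) y = (\<Sum>k\<in>UNIV. pd k (r l) y * (if j = k then 1 else 0))" by simp
        finally have "pd j (\<lambda>y. r l (h y) - r l y) y =
            (\<Sum>k\<in>UNIV. pd k (r l) (h y) * pd j (\<lambda>z. h z $ k) y - pd k (r l) y * (if j = k then 1 else 0))"
          by (simp only: sum_subtractf)
        then show ?case by (rule trans[OF _ sym, rotated]) (rule sum.cong[OF refl], simp add: algebra_simps)
      qed
    qed
    moreover have "vanish (n + 3) 0 (\<lambda>y. r l (h y) - r l y) \<longleftrightarrow> smooth_at 0 (\<lambda>y. r l (h y) - r l y) \<and>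
      r l (h 0) - r l 0 = 0 \<and> (\<forall>j. vanish (n + 2) 0 (pd j (\<lambda>y. r l (h y) - r l y)))"
      using vanish.simps(2)[of "n + 2" 0 "\<lambda>y. r l (h y) - r l y"] by (simp add: numeral_3_eq_3)
    ultimately show ?thesis using gd'(4) srh sr by (simp add: smooth_at_diff)
  qed
  \<comment> \<open>The function - (r (h y) - r y) is h y - y + r y, and two derivatives use up two
    of its n + 3 orders. The shape \<open>- -\<close> matches the difference in
    \<open>germ_eqv\<close>.\<close>
  have ddh: "vanish (n + 1) 0 (\<lambda>y. pd i (pd j (\<lambda>z. h z $ a)) y - - pd i (pd j (r a)) y)" for i j a
  proof (rule vanish_cong)
    have "vanish (n + 3 - 1 - 1) 0 (pd i (pd j (\<lambda>y. - (r a (h y) - r a y))))"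
      by (intro vanish_pd vanish_uminus rr)
    then show "vanish (n + 1) 0 (pd i (pd j (\<lambda>y. - (r a (h y) - r a y))))" by (simp add: numeral_3_eq_3)
    have e1: "\<forall>\<^sub>F y in nhds 0. - (r a (h y) - r a y) = h y $ a - y $ a + r a y"
      using rh[of a] by eventually_elim simp
    have e2: "\<forall>\<^sub>F y in nhds 0. pd j (\<lambda>y. h y $ a - y $ a + r a y) y = pd j (\<lambda>y. h y $ a) y - (if j = a then 1 else 0) + pd j (r a) y"
      using smooth_at_eventually[OF sh[of a]] smooth_at_eventually[OF sr[of a]]
      by eventually_elim (simp add: pd_add pd_diff smooth_at_nth pd_nth smooth_at_diff)
    have e3: "\<forall>\<^sub>F y in nhds 0. pd i (\<lambda>y. pd j (\<lambda>y. h y $ a) y - (if j = a then 1 else 0) + pd j (r a) y) y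
       = pd i (pd j (\<lambda>z. h z $ a)) y - - pd i (pd j (r a)) y"
      using smooth_at_eventually[OF sh[of a]] smooth_at_eventually[OF sr[of a]]
      by eventually_elim (simp add: pd_add pd_diff smooth_at_const smooth_at_diff smooth_at_pd)
    show "\<forall>\<^sub>F y in nhds 0. pd i (pd j (\<lambda>y. - (r a (h y) - r a y))) y = pd i (pd j (\<lambda>z. h z $ a)) y - - pd i (pd j (r a)) y"
      using pd_cong_eventually[OF pd_cong_eventually[OF e1, of j], of i] pd_cong_eventually[OF e2, of i] e3
      by eventually_elim simp
  qed
  have th': "smooth_at 0 (\<lambda>y. \<theta> y $ a $ c $ b)" for a b c using th by (simp add: smooth_at_chr_iff)
  have thh: "vanish (n + 1) 0 (\<lambda>y. \<theta> (h y) $ a $ c $ b - \<theta> y $ a $ c $ b)" for a b c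
    using gd' vanish_mono[OF vh, of "n + 1"] th'[of a c b]
    by (intro vanish_compose_diff[of 0 h "\<lambda>y. y" _ "\<lambda>y. \<theta> y $ a $ c $ b"] smooth_at_ident) auto
  have thsm: "smooth_at 0 (\<lambda>y. \<theta> (h y) $ a $ c $ b)" for a b c
    using smooth_at_compose[OF gd'(2), of "\<lambda>y. \<theta> y $ a $ c $ b"] th'[of a c b] gd' by simp
  have sgh: "smooth_at 0 (\<lambda>y. pd a (\<lambda>z. g z $ l) (h y))" for a l
    using smooth_at_compose[OF gd'(2), of "pd a (\<lambda>z. g z $ l)"] smooth_at_pd[OF sg[of l]] gd' by simp
  have q1: "germ_eqv (n + 1) (\<lambda>y. pd a (\<lambda>z. g z $ l) (h y)) (\<lambda>y. if a = l then 1 else 0)" for a l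
    by (simp only: germ_eqv_def dg sgh smooth_at_const)
  have q2: "germ_eqv (n + 1) (\<lambda>y. pd j (\<lambda>z. h z $ l) y) (\<lambda>y. if j = l then 1 else 0)" for j l
    by (simp only: germ_eqv_def dh smooth_at_pd[OF sh] smooth_at_const)
  have q3: "germ_eqv (n + 1) (\<lambda>y. pd i (pd j (\<lambda>z. h z $ a)) y) (\<lambda>y. - pd i (pd j (r a)) y)" for i j a
    by (simp only: germ_eqv_def ddh smooth_at_pd[OF smooth_at_pd[OF sh]] smooth_at_uminus[OF smooth_at_pd[OF smooth_at_pd[OF sr]]])
  have q4: "germ_eqv (n + 1) (\<lambda>y. \<theta> (h y) $ a $ c $ b) (\<lambda>y. \<theta> y $ a $ c $ b)" for a c b
    by (simp only: germ_eqv_def thh th' thsm)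
  have "vanish (n + 1) 0 (\<lambda>y. transform g h \<theta> y $ l $ i $ j - (\<theta> y - second_derivs (\<lambda>z. g z - z) y) $ l $ i $ j)" for l i j
  proof (rule vanish_cong)
    let ?L = "\<lambda>y. (\<Sum>a\<in>UNIV. pd a (\<lambda>z. g z $ l) (h y) * pd i (pd j (\<lambda>z. h z $ a)) y) +
    (\<Sum>a\<in>UNIV. \<Sum>c\<in>UNIV. \<Sum>b\<in>UNIV. pd a (\<lambda>z. g z $ l) (h y) * pd i (\<lambda>z. h z $ c) y * pd j (\<lambda>z. h z $ b) y * \<theta> (h y) $ a $ c $ b)"
    let ?R = "\<lambda>y. (\<Sum>a\<in>UNIV. (if a = l then 1 else 0) * - pd i (pd j (r a)) y) +
    (\<Sum>a\<in>UNIV. \<Sum>c\<in>UNIV. \<Sum>b\<in>UNIV. (if a = l then 1 else 0) * (if i = c then 1 else 0) * (if j = b then 1 else 0) * \<theta> y $ a $ c $ b)"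
    have "germ_eqv (n + 1) ?L ?R"
      by (intro germ_eqv_add germ_eqv_sum germ_eqv_mult q1 q2 q3 q4)
    then show "vanish (n + 1) 0 (\<lambda>y. ?L y - ?R y)" by (simp only: germ_eqv_def)
    have R: "?R y = (\<theta> y - second_derivs (\<lambda>z. g z - z) y) $ l $ i $ j" for y
    proof -
      have "(\<Sum>a\<in>UNIV. \<Sum>c\<in>UNIV. \<Sum>b\<in>UNIV. (if a = l then 1 else 0) * (if i = c then 1 else 0) * (if j = b then 1 else 0) * \<theta> y $ a $ c $ b)
          = (\<Sum>a\<in>UNIV. (if a = l then 1 else 0) * (\<Sum>c\<in>UNIV. (if i = c then 1 else 0) * (\<Sum>b\<in>UNIV. (if j = b then 1 else 0) * \<theta> y $ a $ c $ b)))"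
        by (simp only: sum_distrib_left mult.assoc)
      then show ?thesis by (simp only: sum_mult_delta) (simp add: second_derivs_nth r_def)
    qed
    have "\<forall>\<^sub>F y in nhds 0. smooth_at (h y) g"
      using eventually_smooth_compose[OF gd'(2), of "\<lambda>y. smooth_at y g"] smooth_at_eventually[OF gd'(1)] gd' by simp
    then show "\<forall>\<^sub>F y in nhds 0. ?L y - ?R y = transform g h \<theta> y $ l $ i $ j - (\<theta> y - second_derivs (\<lambda>z. g z - z) y) $ l $ i $ j"
      unfolding R using smooth_at_eventually[OF gd'(2)] by eventually_elim (simp only: transform_nth)
  qed
  then show ?thesis by (simp only: con_eqv_def) simp
qed

declare vanish.simps(2) [simp del]

lemma transform_compose_eventually:
  assumes "germ_diffeo x y g1 h1" "germ_diffeo y z g2 h2"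
  shows "\<forall>\<^sub>F w in nhds z. transform (\<lambda>u. g2 (g1 u)) (\<lambda>w. h1 (h2 w)) \<theta> w = transform g2 h2 (transform g1 h1 \<theta>) w"
proof -
  note 2 = germ_diffeoD[OF assms(2)]
  have "\<forall>\<^sub>F w in nhds z. germ_diffeo (h1 (h2 w)) (h2 w) g1 h1"
    using eventually_smooth_compose[OF 2(2), of "\<lambda>u. germ_diffeo (h1 u) u g1 h1"] germ_diffeo_eventually[OF assms(1)] 2(4)
    by simp
  then show ?thesis using germ_diffeo_eventually[OF assms(2)]
    by eventually_elim (rule transform_compose)
qed

lemma smooth_at_transform_germ: "germ_diffeo x y g h \<Longrightarrow> smooth_at x \<theta> \<Longrightarrow> smooth_at y (transform g h \<theta>)"
  using smooth_at_transform[of h y g \<theta>] by (auto dest: germ_diffeoD)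

text \<open>The inhomogeneous terms cancel in the difference, which hence transforms as a tensor and
  keeps its order. So the jet of the result depends on the jet of the connection only.\<close>

lemma con_eqv_transform:
  assumes "germ_diffeo x y g h" "con_eqv n x \<theta> \<theta>'"
  shows "con_eqv n y (transform g h \<theta>) (transform g h \<theta>')"
  unfolding con_eqv_def
proof (intro allI)
  fix l i j
  note 1 = germ_diffeoD[OF assms(1)]
  have g: "smooth_at (h y) (\<lambda>z. g z $ l)" using 1 by (simp add: smooth_at_vec_iff)
  have h: "smooth_at y (\<lambda>z. h z $ l)" for l using 1 by (simp add: smooth_at_vec_iff)
  have v: "vanish n y (\<lambda>y. \<theta> (h y) $ a $ c $ b - \<theta>' (h y) $ a $ c $ b)" for a b c
    using vanish_compose[OF 1(2), of n "\<lambda>y. \<theta> y $ a $ c $ b - \<theta>' y $ a $ c $ b"] assms(2) 1(4) by (simp add: con_eqv_def)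
  have "vanish n y (\<lambda>y. \<Sum>a\<in>UNIV. \<Sum>c\<in>UNIV. \<Sum>b\<in>UNIV. pd a (\<lambda>z. g z $ l) (h y) * pd i (\<lambda>z. h z $ c) y * pd j (\<lambda>z. h z $ b) y *
     (\<theta> (h y) $ a $ c $ b - \<theta>' (h y) $ a $ c $ b))"
    by (intro vanish_sum vanish_smooth_mult(2) v smooth_at_mult smooth_at_compose[OF 1(2)] smooth_at_pd[OF g] smooth_at_pd[OF h])
  moreover have "\<forall>\<^sub>F w in nhds y. germ_diffeo (h w) w g h" by (rule germ_diffeo_eventually[OF assms(1)])
  then have "\<forall>\<^sub>F y in nhds y. (\<Sum>a\<in>UNIV. \<Sum>c\<in>UNIV. \<Sum>b\<in>UNIV. pd a (\<lambda>z. g z $ l) (h y) * pd i (\<lambda>z. h z $ c) y * pd j (\<lambda>z. h z $ b) y *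
     (\<theta> (h y) $ a $ c $ b - \<theta>' (h y) $ a $ c $ b)) = transform g h \<theta> y $ l $ i $ j - transform g h \<theta>' y $ l $ i $ j"
  proof eventually_elim
    case (elim y)
    note s = germ_diffeoD(1,2)[OF elim]
    show ?case unfolding transform_nth[OF s] by (simp add: right_diff_distrib sum_subtractf)
  qed
  ultimately show "vanish n y (\<lambda>y. transform g h \<theta> y $ l $ i $ j - transform g h \<theta>' y $ l $ i $ j)"
    by (rule vanish_cong)
qed

section \<open>Linear coordinate changes and the tensor action\<close>

lemma pd_pd_linear: "pd i (pd j (\<lambda>z. (A *v z) $ l)) y = 0" "pd a (\<lambda>z. (A *v z) $ l) y = A $ l $ a"
  for A :: "real^'m::finite^'m"
proof -
  have 1: "pd a (\<lambda>z. (A *v z) $ l) y = A $ l $ a" for a y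
  proof -
    have "((\<lambda>z. (A *v z) $ l) has_derivative (\<lambda>z. (A *v z) $ l)) (at y)"
      by (rule bounded_linear_imp_has_derivative)
        (rule bounded_linear_compose[OF bounded_linear_vec_nth matrix_vector_mul_bounded_linear])
    from has_derivative_imp_pd[OF this] show ?thesis
      by (simp add: matrix_vector_mult_def axis_def if_distrib[of "(*) _"] cong: if_cong)
  qed
  show "pd a (\<lambda>z. (A *v z) $ l) y = A $ l $ a" by (rule 1)
  have "pd j (\<lambda>z. (A *v z) $ l) = (\<lambda>_. A $ l $ j)" by (simp add: 1 fun_eq_iff)
  then show "pd i (pd j (\<lambda>z. (A *v z) $ l)) y = 0" by simp
qed

lemma smooth_at_matrix: "smooth_at x ((*v) (A :: real^'m::finite^'m))"
  by (rule smooth_at_bounded_linear[OF matrix_vector_mul_bounded_linear])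

text \<open>A linear map has no second derivatives, so the inhomogeneous term drops out. The laws of
  \<open>tensor_act\<close> are thereby special cases of those of \<open>transform\<close>.\<close>

lemma tensor_act_transform: "tensor_act A p y = transform ((*v) A) ((*v) (matrix_inv A)) p y"
  by (simp add: vec_eq_iff transform_nth[OF smooth_at_matrix smooth_at_matrix] pd_pd_linear tensor_act_def Let_def)

lemma matrix_inv_GL:
  assumes "A \<in> GL"
  shows "matrix_inv A ** A = mat 1" "A ** matrix_inv A = mat 1"
proof -
  have "\<exists>B. A ** B = mat 1 \<and> B ** A = mat 1" using assms by (simp add: GL_def invertible_def)
  from someI_ex[OF this] show "matrix_inv A ** A = mat 1" "A ** matrix_inv A = mat 1"
    by (auto simp: matrix_inv_def)
qed

lemma matrix_inv_eq:
  fixes A :: "real^'m::finite^'m"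
  assumes "A ** B = mat 1"
  shows "matrix_inv A = B" "A \<in> GL" "B \<in> GL"
proof -
  have "B ** A = mat 1" using assms by (simp add: matrix_left_right_inverse)
  then show A: "A \<in> GL" and "B \<in> GL" using assms by (auto simp: GL_def invertible_def)
  show "matrix_inv A = B"
    by (metis assms matrix_inv_GL(1)[OF A] matrix_mul_assoc matrix_mul_lid matrix_mul_rid)
qed

lemma matrix_inv_mat1: "matrix_inv (mat 1) = (mat 1 :: real^'m::finite^'m)"
  by (rule matrix_inv_eq(1)) simp

lemma germ_diffeo_linear:
  assumes "A \<in> GL"
  shows "germ_diffeo (matrix_inv A *v y) y ((*v) A) ((*v) (matrix_inv A))"
  by (simp add: germ_diffeo_def smooth_at_matrix matrix_vector_mul_assoc matrix_inv_GL[OF assms])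

lemma jacobian_linear: "jacobian ((*v) (A :: real^'m::finite^'m)) (at x) = A"
  by (simp add: vec_eq_iff jacobian_nth pd_vec_nth[OF smooth_at_matrix, symmetric] pd_pd_linear)

lemma transform_ident: "transform (\<lambda>x. x) (\<lambda>x. x) \<theta> y = \<theta> y"
proof -
  have "pd j (\<lambda>z. z $ a) = (\<lambda>_. if j = a then 1 else 0)" for j a :: 'a
    by (simp add: fun_eq_iff pd_nth)
  moreover have "(\<Sum>a\<in>UNIV. \<Sum>c\<in>UNIV. \<Sum>b\<in>UNIV. (if a = l then 1 else 0) * (if i = c then 1 else 0) * (if j = b then 1 else 0) * \<theta> y $ a $ c $ b)
          = (\<Sum>a\<in>UNIV. (if a = l then 1 else 0) * (\<Sum>c\<in>UNIV. (if i = c then 1 else 0) * (\<Sum>b\<in>UNIV. (if j = b then 1 else 0) * \<theta> y $ a $ c $ b)))" for l i j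
        by (simp only: sum_distrib_left mult.assoc)
  ultimately show ?thesis
    by (simp only: vec_eq_iff transform_nth[OF smooth_at_ident smooth_at_ident] sum_mult_delta) simp
qed

lemma tensor_act_mult:
  assumes "A \<in> GL" "B \<in> GL"
  shows "tensor_act (A ** B) p = tensor_act A (tensor_act B p)"
proof
  fix y
  have "A ** B ** (matrix_inv B ** matrix_inv A) = mat 1"
    by (metis assms matrix_inv_GL(2) matrix_mul_assoc matrix_mul_rid)
  note inv = matrix_inv_eq[OF this]
  have "tensor_act (A ** B) p y = transform (\<lambda>u. A *v (B *v u)) (\<lambda>w. matrix_inv B *v (matrix_inv A *v w)) p y"
    by (simp add: tensor_act_transform inv matrix_vector_mul_assoc)
  also have "\<dots> = transform ((*v) A) ((*v) (matrix_inv A)) (transform ((*v) B) ((*v) (matrix_inv B)) p) y"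
    by (rule transform_compose) (rule germ_diffeo_linear assms)+
  also have "\<dots> = tensor_act A (tensor_act B p) y"
    by (simp add: tensor_act_transform[abs_def])
  finally show "tensor_act (A ** B) p y = tensor_act A (tensor_act B p) y" .
qed

lemma tensor_act_mat1:
  fixes p :: "real^'m::finite \<Rightarrow> 'm chr"
  shows "tensor_act (mat 1) p = p"
proof
  fix y
  have e: "(*v) (mat 1 :: real^'m^'m) = (\<lambda>x. x)" by (simp add: fun_eq_iff)
  show "tensor_act (mat 1) p y = p y"
    using transform_ident[of p y] by (simp add: tensor_act_transform matrix_inv_mat1 e)
qed

text \<open>A smooth homogeneous function is its own jet, hence a polynomial.\<close>

lemma homogeneous_con_hom:
  assumes "\<And>l i j. homogeneous n (\<lambda>z. p z $ l $ i $ j)"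
  shows "p \<in> con_hom n"
proof -
  have sm: "smooth_at 0 p" using assms by (simp add: smooth_at_chr_iff homogeneous_def)
  have "jet n p 0 n z $ l $ i $ j = p z $ l $ i $ j" for z l i j
    by (simp add: jet_chr[OF sm] taylor_sum_homogeneous[OF assms])
  then have "jet n p 0 n = p" by (simp add: fun_eq_iff vec_eq_iff)
  then show ?thesis using jet_con_hom[of n n p 0] by simp
qed

lemma tensor_act_nth: "tensor_act A p z $ l $ i $ j = (\<Sum>a\<in>UNIV. \<Sum>c\<in>UNIV. \<Sum>b\<in>UNIV.
    A $ l $ a * matrix_inv A $ c $ i * matrix_inv A $ b $ j * p (matrix_inv A *v z) $ a $ c $ b)"
  by (simp add: tensor_act_def Let_def)

lemma tensor_act_con_hom:
  assumes "p \<in> con_hom n"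
  shows "tensor_act A p \<in> con_hom n"
proof (rule homogeneous_con_hom)
  fix l i j
  have h: "homogeneous n (\<lambda>z. p z $ a $ c $ b)" for a b c by (rule con_hom_homogeneous[OF assms])
  have "smooth_at z (\<lambda>z. tensor_act A p z $ l $ i $ j)" for z
    unfolding tensor_act_nth
    using h by (intro smooth_at_sum smooth_at_mult smooth_at_const smooth_at_compose[OF smooth_at_matrix]) (simp add: homogeneous_def)
  moreover have "tensor_act A p (c *\<^sub>R z) $ l $ i $ j = c ^ n * tensor_act A p z $ l $ i $ j" for c z
    using h by (simp add: tensor_act_nth homogeneous_def matrix_vector_scaleR sum_distrib_left mult.left_commute)
  ultimately show "homogeneous n (\<lambda>z. tensor_act A p z $ l $ i $ j)" by (simp add: homogeneous_def)
qed

lemma gamma_bil: "gamma p z = bil (p z) z z"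
  by (simp add: vec_eq_iff gamma_nth bil_nth mult_ac)

lemma hess_linear: "hess ((*v) A) y u v = 0"
proof -
  have "pd j ((*v) A) = (\<lambda>_. \<chi> l. A $ l $ j)" for j
    by (simp add: fun_eq_iff vec_eq_iff pd_vec_nth[OF smooth_at_matrix, symmetric] pd_pd_linear)
  then have "pd i (pd j ((*v) A)) y = 0" for i j by simp
  then show ?thesis by (simp add: hess_expand)
qed

text \<open>Equivariance of \<open>gamma\<close>, which makes \<open>C_space\<close> stable under
  the tensor action.\<close>

lemma gamma_tensor_act:
  assumes "A \<in> GL"
  shows "gamma (tensor_act A p) z = A *v gamma p (matrix_inv A *v z)"
  by (simp add: gamma_bil tensor_act_transform bil_transform smooth_at_matrix jacobian_linear hess_linear)

lemma tensor_act_C_prod: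
  assumes "A \<in> GL" "c \<in> C_prod k"
  shows "(\<lambda>n\<in>{..k}. tensor_act A (c n)) \<in> C_prod k"
  using assms by (auto simp: C_prod_def C_space_def tensor_act_con_hom gamma_tensor_act fun_eq_iff PiE_def Pi_def)

lemma con_poly_tensor_act:
  "con_poly k (\<lambda>n\<in>{..k}. tensor_act A (c n)) = tensor_act A (con_poly k c)"
proof
  fix z
  have "tensor_act A (con_poly k c) z $ l $ i $ j = (\<Sum>n\<le>k. tensor_act A (c n) z $ l $ i $ j)" for l i j
  proof -
    have "tensor_act A (con_poly k c) z $ l $ i $ j = (\<Sum>a\<in>UNIV. \<Sum>p\<in>UNIV. \<Sum>b\<in>UNIV. \<Sum>n\<le>k.
      A $ l $ a * matrix_inv A $ p $ i * matrix_inv A $ b $ j * c n (matrix_inv A *v z) $ a $ p $ b)"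
      by (simp add: tensor_act_nth con_poly_chr sum_distrib_left)
    also have "\<dots> = (\<Sum>a\<in>UNIV. \<Sum>p\<in>UNIV. \<Sum>n\<le>k. \<Sum>b\<in>UNIV.
      A $ l $ a * matrix_inv A $ p $ i * matrix_inv A $ b $ j * c n (matrix_inv A *v z) $ a $ p $ b)"
      by (intro sum.cong refl sum.swap)
    also have "\<dots> = (\<Sum>a\<in>UNIV. \<Sum>n\<le>k. \<Sum>p\<in>UNIV. \<Sum>b\<in>UNIV.
      A $ l $ a * matrix_inv A $ p $ i * matrix_inv A $ b $ j * c n (matrix_inv A *v z) $ a $ p $ b)"
      by (intro sum.cong refl sum.swap)
    also have "\<dots> = (\<Sum>n\<le>k. tensor_act A (c n) z $ l $ i $ j)"
      unfolding tensor_act_nth by (rule sum.swap)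
    finally show ?thesis .
  qed
  then show "con_poly k (\<lambda>n\<in>{..k}. tensor_act A (c n)) z = tensor_act A (con_poly k c) z"
    by (simp add: vec_eq_iff con_poly_chr)
qed

text \<open>For n = 0 every smooth connection qualifies, thanks to the two factors of z in
  \<open>gamma\<close>. For n = k + 1 the condition places the k-jet in
  \<open>C_prod k\<close>.\<close>

definition normal_con :: "nat \<Rightarrow> (real^'m::finite \<Rightarrow> 'm chr) \<Rightarrow> bool"
  where "normal_con n \<theta> \<longleftrightarrow> (\<forall>l. vanish (n + 2) 0 (\<lambda>z. gamma \<theta> z $ l))"

lemma gamma_second_derivs: "gamma (\<lambda>z. \<theta> z - second_derivs r z) z $ l =
   gamma \<theta> z $ l - (\<Sum>i\<in>UNIV. \<Sum>j\<in>UNIV. pd i (pd j (\<lambda>z. r z $ l)) z * z $ i * z $ j)"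
  by (simp add: gamma_nth second_derivs_nth left_diff_distrib sum_subtractf)

text \<open>One order is gained per step. All of \<open>gamma\<close>, divided by a constant, serves
  as the displacement of the correcting diffeomorphism: its terms of higher order do no harm, so the
  leading part need not be extracted.\<close>

lemma normal_form_exists:
  assumes "smooth_at 0 \<theta>"
  shows "\<exists>g h. germ_diffeo 0 0 g h \<and> jacobian g (at 0) = mat 1 \<and> normal_con n (transform g h \<theta>)"
proof (induction n)
  case 0
  have id: "germ_diffeo 0 0 (\<lambda>x. x) (\<lambda>x. x)" by (simp add: germ_diffeo_def smooth_at_ident)
  \<comment> \<open>Congruence of order 0 to the zero connection only expresses smoothness;
    \<open>gamma\<close> adds the two orders required.\<close>
  have "con_eqv 0 0 (transform (\<lambda>x. x) (\<lambda>x. x) \<theta>) (\<lambda>_. 0)"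
    using assms by (simp add: con_eqv_def transform_ident smooth_at_chr_iff)
  from con_eqv_gamma[OF this] have "normal_con 0 (transform (\<lambda>x. x) (\<lambda>x. x) \<theta>)"
    by (simp add: normal_con_def gamma_nth)
  then show ?case using id jacobian_ident by blast
next
  case (Suc n)
  then obtain g h where gd: "germ_diffeo 0 0 g h" and J: "jacobian g (at 0) = mat 1" and N: "normal_con n (transform g h \<theta>)"
    by blast
  define \<theta>' where "\<theta>' = transform g h \<theta>"
  have sm: "smooth_at 0 \<theta>'" unfolding \<theta>'_def by (rule smooth_at_transform_germ[OF gd assms])
  define N where "N = n + 2"
  \<comment> \<open>The factor from \<open>euler2_vanish\<close> in degree N. Dividing by it makes
    the contracted second derivatives of q agree with \<open>gamma \<theta>'\<close> up to order N +
    1, where they cancel in the transformed connection.\<close>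
  define K where "K = real N * N - N"
  have K: "K > 0" by (simp add: K_def N_def algebra_simps add_pos_nonneg)
  define q where "q z = (1 / K) *\<^sub>R gamma \<theta>' z" for z
  have vg: "vanish N 0 (\<lambda>z. gamma \<theta>' z $ l)" for l using N by (simp add: normal_con_def \<theta>'_def N_def)
  have vq: "vanish N 0 (\<lambda>z. q z $ l)" for l
    using vanish_cmult[OF vg[of l], of "1 / K"] by (simp add: q_def)
  have sq: "smooth_at 0 (\<lambda>z. q z $ l)" for l by (rule vanish_smooth[OF vq])
  define g' where "g' z = z + q z" for z
  have sg': "smooth_at 0 g'"
    unfolding g'_def by (intro smooth_at_add smooth_at_ident) (simp add: smooth_at_vec_iff sq)
  have "pd a g' 0 $ l = (if a = l then 1 else 0)" for a l
  proof -
    have "pd a g' 0 $ l = pd a (\<lambda>z. z $ l + q z $ l) 0"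
      using pd_vec_nth[OF sg', of a l] by (simp add: g'_def)
    also have "\<dots> = (if a = l then 1 else 0) + pd a (\<lambda>z. q z $ l) 0"
      by (simp add: pd_add smooth_at_nth sq pd_nth)
    also have "pd a (\<lambda>z. q z $ l) 0 = 0"
      using vanish_value[OF vanish_pd[OF vq[of l], of a]] by (simp add: N_def)
    finally show ?thesis by simp
  qed
  then have J': "jacobian g' (at 0) = mat 1" by (simp add: vec_eq_iff jacobian_nth mat_def eq_commute)
  have q0: "q 0 = 0" using vanish_value[OF vq] by (simp add: N_def vec_eq_iff)
  then have "g' 0 = 0" by (simp add: g'_def)
  then obtain h' where gd': "germ_diffeo 0 0 g' h'"
    using exists_germ_inverse[OF sg'] J' by auto
  have r: "(\<lambda>z. g' z - z) = q" by (simp add: g'_def fun_eq_iff)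
  have "con_eqv (n + 1) 0 (transform g' h' \<theta>') (\<lambda>z. \<theta>' z - second_derivs q z)"
    using transform_near_identity[OF gd' _ sm, of n] vq by (simp add: g'_def N_def fun_eq_iff)
  from con_eqv_gamma[OF this] have 1: "vanish (Suc N) 0 (\<lambda>z. gamma (transform g' h' \<theta>') z $ l - gamma (\<lambda>z. \<theta>' z - second_derivs q z) z $ l)" for l
    by (simp add: N_def)
  have 2: "vanish (Suc N) 0 (\<lambda>z. gamma (transform g' h' \<theta>') z $ l)" for l
    using vanish_diff[OF 1 euler2_vanish[OF vq], of l l] K
    by (simp add: gamma_second_derivs K_def[symmetric] q_def)
  have "\<forall>\<^sub>F w in nhds 0. transform (\<lambda>u. g' (g u)) (\<lambda>w. h (h' w)) \<theta> w = transform g' h' \<theta>' w"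
    unfolding \<theta>'_def by (rule transform_compose_eventually[OF gd gd'])
  then have ev: "\<forall>\<^sub>F w in nhds 0. gamma (transform g' h' \<theta>') w $ l = gamma (transform (\<lambda>u. g' (g u)) (\<lambda>w. h (h' w)) \<theta>) w $ l" for l
    by eventually_elim (simp add: gamma_nth)
  have "normal_con (Suc n) (transform (\<lambda>u. g' (g u)) (\<lambda>w. h (h' w)) \<theta>)"
    unfolding normal_con_def using vanish_cong[OF 2 ev] by (simp add: N_def)
  moreover have "jacobian (\<lambda>u. g' (g u)) (at 0) = mat 1"
    using jacobian_compose[of 0 g g'] germ_diffeoD[OF gd] germ_diffeoD[OF gd'] J J' by simp
  ultimately show ?case using germ_diffeo_compose[OF gd gd'] by blast
qed

lemma normal_form_unique:
  assumes gd: "germ_diffeo 0 0 g h" and J: "jacobian g (at 0) = mat 1" and th: "smooth_at 0 \<theta>"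
    and N: "normal_con (Suc k) \<theta>" "normal_con (Suc k) \<theta>'"
    and eq: "con_eqv (Suc k) 0 (transform g h \<theta>) \<theta>'"
  shows "con_eqv (Suc k) 0 \<theta> \<theta>'"
proof -
  note 1 = germ_diffeoD[OF gd]
  have sr: "smooth_at 0 (\<lambda>z. g z $ l - z $ l)" for l
    using 1 by (intro smooth_at_diff smooth_at_nth) (simp add: smooth_at_vec_iff)
  have key: "con_eqv (n + 1) 0 (transform g h \<theta>) (\<lambda>z. \<theta> z - second_derivs (\<lambda>z. g z - z) z)"
    if "\<And>l. vanish (n + 2) 0 (\<lambda>z. g z $ l - z $ l)" for n
    by (rule transform_near_identity[OF gd that th])
  \<comment> \<open>For n = k + 1 the displacement vanishes to order k + 3. Its second derivatives
    then vanish to order k + 1 and leave the k-jet unchanged.\<close>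
  have v: "vanish (n + 2) 0 (\<lambda>z. g z $ l - z $ l)" if "n \<le> Suc k" for n l
    using that
  proof (induction n arbitrary: l)
    case 0
    \<comment> \<open>The base case, order 2, is exactly g 0 = 0 together with the identity as
      Jacobi matrix.\<close>
    have "pd i (\<lambda>z. g z $ l - z $ l) 0 = 0" for i
    proof -
      have "pd i (\<lambda>z. g z $ l) 0 = jacobian g (at 0) $ l $ i"
        using 1 by (simp add: jacobian_nth pd_vec_nth)
      then show ?thesis using 1
        by (simp add: J pd_diff smooth_at_nth pd_nth smooth_at_vec_iff mat_def)
    qed
    then show ?case using 1 sr[of l] by (simp add: numeral_2_eq_2 smooth_at_pd vanish.simps(2))
  next
    case (Suc n)
    define r where "r = (\<lambda>z. g z $ l - z $ l)"
    define E2 where "E2 z = (\<Sum>i\<in>UNIV. \<Sum>j\<in>UNIV. pd i (pd j r) z * z $ i * z $ j)" for z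
    have vr: "vanish (n + 2) 0 r" using Suc by (simp add: r_def)
    have "con_eqv (n + 1) 0 (transform g h \<theta>) (\<lambda>z. \<theta> z - second_derivs (\<lambda>z. g z - z) z)"
      using Suc by (intro key) simp
    then have "con_eqv (n + 1) 0 (\<lambda>z. \<theta> z - second_derivs (\<lambda>z. g z - z) z) \<theta>'"
      using con_eqv_trans[OF con_eqv_sym con_eqv_mono[OF eq]] Suc.prems by simp
    from con_eqv_gamma[OF this, of l]
    have "vanish (n + 3) 0 (\<lambda>z. gamma \<theta> z $ l - E2 z - gamma \<theta>' z $ l)"
      by (simp add: gamma_second_derivs E2_def r_def numeral_3_eq_3)
    moreover have "vanish (n + 3) 0 (\<lambda>z. gamma \<theta> z $ l)" "vanish (n + 3) 0 (\<lambda>z. gamma \<theta>' z $ l)"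
      using N Suc.prems by (auto simp: normal_con_def intro: vanish_mono[of "Suc k + 2"])
    ultimately have "vanish (n + 3) 0 (\<lambda>z. gamma \<theta> z $ l - gamma \<theta>' z $ l - (gamma \<theta> z $ l - E2 z - gamma \<theta>' z $ l))"
      by (rule vanish_diff[OF vanish_diff, rotated 2])
    \<comment> \<open>Both connections are normal, so the contracted second derivatives of r vanish
      to one order more than known for r. To that order they are K r, so r itself gains the
      order.\<close>
    then have vE: "vanish (n + 3) 0 E2" by (simp add: algebra_simps)
    define K where "K = real (n + 2) * (n + 2) - (n + 2)"
    have K: "K > 0" by (simp add: K_def algebra_simps add_pos_nonneg)
    have "vanish (n + 3) 0 (\<lambda>z. E2 z - K * r z)"
      using euler2_vanish[OF vr] by (simp add: E2_def K_def numeral_3_eq_3)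
    from vanish_cmult[OF vanish_diff[OF vE this], of "1 / K"] have "vanish (n + 3) 0 r" using K by simp
    then show ?case by (simp add: r_def numeral_3_eq_3)
  qed
  have "vanish (Suc k + 2 - 1 - 1) 0 (pd i (pd j (\<lambda>z. g z $ l - z $ l)))" for i j l
    by (intro vanish_pd v) simp
  then have "con_eqv (Suc k) 0 (\<lambda>z. \<theta> z - second_derivs (\<lambda>z. g z - z) z) \<theta>"
    unfolding con_eqv_def second_derivs_nth
    using vanish_uminus[of "Suc k" 0 "pd _ (pd _ (\<lambda>z. g z $ _ - z $ _))"] by (simp add: second_derivs_nth)
  with key[of "Suc k"] v have "con_eqv (Suc k) 0 (transform g h \<theta>) \<theta>"
    by (blast intro: con_eqv_trans con_eqv_mono[where n = "Suc k + 1"] le_add1)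
  then show ?thesis using eq con_eqv_sym con_eqv_trans by blast
qed

text \<open>The orbit relation of the jet group on k-jets, stated for germs and remembering only the
  Jacobi matrix of the diffeomorphism. For A the identity it describes the orbits of the subgroup N;
  general A serves for equivariance.\<close>

definition reach :: "nat \<Rightarrow> real^'m^'m::finite \<Rightarrow> (real^'m \<Rightarrow> 'm chr) \<Rightarrow> (real^'m \<Rightarrow> 'm chr) \<Rightarrow> bool"
  where "reach k A \<theta> \<theta>' \<longleftrightarrow>
    (\<exists>g h. germ_diffeo 0 0 g h \<and> jacobian g (at 0) = A \<and> con_eqv (Suc k) 0 (transform g h \<theta>) \<theta>')"

lemma reach_GL: "reach k A \<theta> \<theta>' \<Longrightarrow> A \<in> GL"
  unfolding reach_def using germ_diffeo_jacobian matrix_inv_eq(2) by blast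

lemma reach_transform:
  "germ_diffeo 0 0 g h \<Longrightarrow> smooth_at 0 \<theta> \<Longrightarrow> reach k (jacobian g (at 0)) \<theta> (transform g h \<theta>)"
  unfolding reach_def using con_eqv_refl smooth_at_transform_germ by blast

lemma reach_con_eqv:
  assumes "con_eqv (Suc k) 0 \<theta> \<theta>'"
  shows "reach k (mat 1) \<theta> \<theta>'"
proof -
  have "germ_diffeo 0 0 (\<lambda>x. x) (\<lambda>x. x)" by (simp add: germ_diffeo_def smooth_at_ident)
  moreover have "transform (\<lambda>x. x) (\<lambda>x. x) \<theta> = \<theta>" by (simp add: fun_eq_iff transform_ident)
  ultimately show ?thesis unfolding reach_def using assms jacobian_ident by metis
qed

lemma reach_trans:
  assumes "reach k A \<theta> \<theta>'" "reach k B \<theta>' \<theta>''" "smooth_at 0 \<theta>"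
  shows "reach k (B ** A) \<theta> \<theta>''"
proof -
  obtain g1 h1 where 1: "germ_diffeo 0 0 g1 h1" "jacobian g1 (at 0) = A" "con_eqv (Suc k) 0 (transform g1 h1 \<theta>) \<theta>'"
    using assms(1) by (auto simp: reach_def)
  obtain g2 h2 where 2: "germ_diffeo 0 0 g2 h2" "jacobian g2 (at 0) = B" "con_eqv (Suc k) 0 (transform g2 h2 \<theta>') \<theta>''"
    using assms(2) by (auto simp: reach_def)
  note gd = germ_diffeo_compose[OF 1(1) 2(1)]
  have "con_eqv (Suc k) 0 (transform (\<lambda>u. g2 (g1 u)) (\<lambda>w. h1 (h2 w)) \<theta>) (transform g2 h2 (transform g1 h1 \<theta>))"
    by (rule con_eqv_eventually[OF smooth_at_transform_germ[OF gd assms(3)] transform_compose_eventually[OF 1(1) 2(1)]])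
  then have "con_eqv (Suc k) 0 (transform (\<lambda>u. g2 (g1 u)) (\<lambda>w. h1 (h2 w)) \<theta>) \<theta>''"
    using con_eqv_trans[OF _ con_eqv_trans[OF con_eqv_transform[OF 2(1) 1(3)] 2(3)]] by blast
  moreover have "jacobian (\<lambda>u. g2 (g1 u)) (at 0) = B ** A"
    using jacobian_compose[of 0 g1 g2] germ_diffeoD[OF 1(1)] germ_diffeoD[OF 2(1)] 1(2) 2(2) by simp
  ultimately show ?thesis using gd unfolding reach_def by blast
qed

lemma reach_sym:
  assumes "reach k A \<theta> \<theta>'" "smooth_at 0 \<theta>"
  shows "reach k (matrix_inv A) \<theta>' \<theta>"
proof -
  obtain g h where 1: "germ_diffeo 0 0 g h" "jacobian g (at 0) = A" "con_eqv (Suc k) 0 (transform g h \<theta>) \<theta>'"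
    using assms(1) by (auto simp: reach_def)
  note gd = germ_diffeo_sym[OF 1(1)]
  have "\<forall>\<^sub>F w in nhds 0. transform (\<lambda>u. h (g u)) (\<lambda>w. h (g w)) \<theta> w = \<theta> w"
  proof -
    have "\<forall>\<^sub>F w in nhds 0. \<forall>\<^sub>F w in nhds w. h (g w) = w" using germ_diffeoD(5)[OF 1(1)] by (simp add: eventually_eventually)
    then show ?thesis
    proof eventually_elim
      case (elim w)
      have "h (g w) = w" using elim by (rule eventually_nhds_x_imp_x)
      then have "transform (\<lambda>u. h (g u)) (\<lambda>w. h (g w)) \<theta> w = transform (\<lambda>x. x) (\<lambda>x. x) \<theta> w"
        using elim by (intro transform_cong) simp_all
      then show ?case by (simp add: transform_ident)
    qed
  qed
  moreover have "\<forall>\<^sub>F w in nhds 0. transform (\<lambda>u. h (g u)) (\<lambda>w. h (g w)) \<theta> w = transform h g (transform g h \<theta>) w"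
    by (rule transform_compose_eventually[OF 1(1) gd])
  ultimately have "\<forall>\<^sub>F w in nhds 0. \<theta> w = transform h g (transform g h \<theta>) w" by eventually_elim simp
  from con_eqv_eventually[OF assms(2) this] have "con_eqv (Suc k) 0 (transform h g \<theta>') \<theta>"
    using con_eqv_sym con_eqv_trans con_eqv_transform[OF gd 1(3)] by blast
  moreover have "jacobian h (at 0) = matrix_inv A"
    using matrix_inv_eq(1)[OF germ_diffeo_jacobian(2)[OF 1(1)]] 1(2) by simp
  ultimately show ?thesis using gd unfolding reach_def by blast
qed

lemma normal_con_C_prod: "c \<in> C_prod k \<Longrightarrow> normal_con n (con_poly k c)"
  by (simp add: normal_con_def gamma_C_prod vanish_zero)

lemma smooth_at_con_poly_C_prod: "c \<in> C_prod k \<Longrightarrow> smooth_at x (con_poly k c)"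
  by (intro smooth_at_con_poly) (rule C_prodD)

lemma jet_con_poly_C_prod: "c \<in> C_prod k \<Longrightarrow> jet k (con_poly k c) 0 = c"
  by (intro jet_con_poly) (auto dest: C_prodD)

lemma reach_tensor_act:
  assumes "A \<in> GL" "c \<in> C_prod k"
  shows "reach k A (con_poly k c) (con_poly k (\<lambda>n\<in>{..k}. tensor_act A (c n)))"
proof -
  have "tensor_act A (con_poly k c) = transform ((*v) A) ((*v) (matrix_inv A)) (con_poly k c)"
    by (simp add: fun_eq_iff tensor_act_transform)
  moreover have "germ_diffeo 0 0 ((*v) A) ((*v) (matrix_inv A))"
    using germ_diffeo_linear[OF assms(1), of 0] by simp
  ultimately show ?thesis
    using reach_transform[of "(*v) A" "(*v) (matrix_inv A)" "con_poly k c" k] smooth_at_con_poly_C_prod[OF assms(2)]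
    by (simp add: con_poly_tensor_act jacobian_linear)
qed

text \<open>Undoing the linear part first: the tensor action of A takes c to a normal form that is
  related to c' with the identity as Jacobi matrix, and there uniqueness applies.\<close>

lemma reach_C_prod:
  assumes "c \<in> C_prod k" "c' \<in> C_prod k" "reach k A (con_poly k c) (con_poly k c')"
  shows "c' = (\<lambda>n\<in>{..k}. tensor_act A (c n))"
proof -
  have A: "A \<in> GL" by (rule reach_GL[OF assms(3)])
  let ?d = "\<lambda>n\<in>{..k}. tensor_act A (c n)"
  have d: "?d \<in> C_prod k" by (rule tensor_act_C_prod[OF A assms(1)])
  have "reach k (matrix_inv A) (con_poly k ?d) (con_poly k c)"
    by (rule reach_sym[OF reach_tensor_act[OF A assms(1)] smooth_at_con_poly_C_prod[OF assms(1)]])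
  from reach_trans[OF this assms(3) smooth_at_con_poly_C_prod[OF d]]
  have "reach k (mat 1) (con_poly k ?d) (con_poly k c')" by (simp add: matrix_inv_GL[OF A])
  then have "con_eqv (Suc k) 0 (con_poly k ?d) (con_poly k c')"
    unfolding reach_def
    using normal_form_unique smooth_at_con_poly_C_prod[OF d] normal_con_C_prod[OF d] normal_con_C_prod[OF assms(2)] by blast
  from con_eqv_jet[OF this smooth_at_con_poly_C_prod[OF d]] show ?thesis
    by (simp add: jet_con_poly_C_prod[OF d] jet_con_poly_C_prod[OF assms(2)])
qed

lemma reach_C_prod_exists:
  assumes "smooth_at 0 \<theta>"
  obtains c where "c \<in> C_prod k" "reach k (mat 1) \<theta> (con_poly k c)"
proof -
  obtain g h where gd: "germ_diffeo 0 0 g h" and J: "jacobian g (at 0) = mat 1" and N: "normal_con (Suc k) (transform g h \<theta>)"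
    using normal_form_exists[OF assms] by blast
  have sm: "smooth_at 0 (transform g h \<theta>)" by (rule smooth_at_transform_germ[OF gd assms])
  have "jet k (transform g h \<theta>) 0 \<in> C_prod k"
    using N by (intro jet_in_C_prod[OF sm]) (simp add: normal_con_def numeral_3_eq_3)
  moreover have "reach k (mat 1) \<theta> (con_poly k (jet k (transform g h \<theta>) 0))"
    unfolding reach_def using gd J con_poly_jet_eqv[OF sm] by auto
  ultimately show thesis by (rule that)
qed

section \<open>Orbits of jets and the normal form map\<close>

lemma local_diffeo_germ_diffeo:
  assumes "local_diffeo_at_0 S g h"
  shows "germ_diffeo 0 0 g h"
proof -
  note 1 = assms[unfolded local_diffeo_at_0_def]
  have 0: "0 \<in> g ` S" using 1 by (metis imageI)
  have "\<forall>\<^sub>F z in nhds 0. h (g z) = z" using eventually_nhds_in_open[of S 0] 1 by (auto elim: eventually_mono)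
  moreover have "\<forall>\<^sub>F w in nhds 0. g (h w) = w" using eventually_nhds_in_open[OF _ 0] 1 by (auto elim!: eventually_mono)
  ultimately show ?thesis unfolding germ_diffeo_def
    using 1 0 smooth_atI[of S 0 g] smooth_atI[of "g ` S" 0 h] by metis
qed

lemma germ_diffeo_local_diffeo:
  assumes "germ_diffeo 0 0 g h"
  obtains S where "local_diffeo_at_0 S g h"
proof -
  note 1 = germ_diffeoD[OF assms]
  obtain T1 where T1: "open T1" "0 \<in> T1" "smooth_on T1 g" using 1 by (auto simp: smooth_at_def)
  obtain T2 where T2: "open T2" "0 \<in> T2" "\<And>z. z \<in> T2 \<Longrightarrow> h (g z) = z" using 1(5) by (auto simp: eventually_nhds)
  obtain W1 where W1: "open W1" "0 \<in> W1" "smooth_on W1 h" using 1 by (auto simp: smooth_at_def)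
  obtain W2 where W2: "open W2" "0 \<in> W2" "\<And>z. z \<in> W2 \<Longrightarrow> g (h z) = z" using 1(6) by (auto simp: eventually_nhds)
  let ?T = "T1 \<inter> T2" and ?W = "W1 \<inter> W2"
  have g: "smooth_on ?T g" and h: "smooth_on ?W h" using T1 W1 smooth_on_subset by blast+
  then have cg: "continuous_on ?T g" and ch: "continuous_on ?W h" by (metis Ck_on.simps(1) smooth_on_def)+
  let ?S = "?T \<inter> g -` ?W"
  have oS: "open ?S" using cg T1 T2 W1 W2 by (intro continuous_open_preimage) auto
  \<comment> \<open>Describing the image as a preimage under h shows that it is open.\<close>
  have im: "g ` ?S = ?W \<inter> h -` ?T"
  proof (intro equalityI subsetI)
    fix w assume "w \<in> g ` ?S"
    then show "w \<in> ?W \<inter> h -` ?T" using T2 by auto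
  next
    fix w assume w: "w \<in> ?W \<inter> h -` ?T"
    then have "g (h w) = w" using W2 by auto
    then show "w \<in> g ` ?S" using w by (intro image_eqI[of _ _ "h w"]) auto
  qed
  have oI: "open (g ` ?S)" unfolding im using ch T1 T2 W1 W2 by (intro continuous_open_preimage) auto
  have "local_diffeo_at_0 ?S g h"
    unfolding local_diffeo_at_0_def
  proof (intro conjI)
    show "0 \<in> ?S" using T1 T2 W1 W2 1 by simp
    show "smooth_on ?S g" by (rule smooth_on_subset[OF g]) auto
    show "smooth_on (g ` ?S) h" by (rule smooth_on_subset[OF h]) (auto simp: im)
  qed (use oS oI 1 T2 in auto)
  then show thesis by (rule that)
qed

text \<open>A normal form equals the jet of its polynomial, so equality of jets in the orbit can be
  replaced by congruence of germs.\<close>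

lemma N_orbit_C_prod:
  assumes "\<And>n. n \<le> k \<Longrightarrow> \<theta> n \<in> con_hom n"
  shows "c \<in> N_orbit k \<theta> \<inter> C_prod k \<longleftrightarrow> c \<in> C_prod k \<and> reach k (mat 1) (con_poly k \<theta>) (con_poly k c)"
proof -
  have sm: "smooth_at 0 (con_poly k \<theta>)" by (rule smooth_at_con_poly[OF assms])
  have *: "c = jet k (transform g h (con_poly k \<theta>)) 0 \<longleftrightarrow> con_eqv (Suc k) 0 (transform g h (con_poly k \<theta>)) (con_poly k c)"
    if "c \<in> C_prod k" "germ_diffeo 0 0 g h" for g h
    using con_poly_jet_eqv[OF smooth_at_transform_germ[OF that(2) sm], of k]
      con_eqv_jet[OF _ smooth_at_transform_germ[OF that(2) sm], of k "con_poly k c"] jet_con_poly_C_prod[OF that(1)] by auto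
  show ?thesis
  proof
    assume "c \<in> N_orbit k \<theta> \<inter> C_prod k"
    then obtain S g h where "c \<in> C_prod k" "local_diffeo_at_0 S g h" "jacobian g (at 0) = mat 1"
      "c = jet k (transform g h (con_poly k \<theta>)) 0"
      by (auto simp: N_orbit_def jet_act_def con_poly_def)
    then show "c \<in> C_prod k \<and> reach k (mat 1) (con_poly k \<theta>) (con_poly k c)"
      unfolding reach_def using * local_diffeo_germ_diffeo by blast
  next
    assume r: "c \<in> C_prod k \<and> reach k (mat 1) (con_poly k \<theta>) (con_poly k c)"
    then obtain g h where gd: "germ_diffeo 0 0 g h" "jacobian g (at 0) = mat 1" "con_eqv (Suc k) 0 (transform g h (con_poly k \<theta>)) (con_poly k c)"
      by (auto simp: reach_def)
    then have "c = jet_act k g h \<theta>" using * r by (simp add: jet_act_def con_poly_def)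
    moreover obtain S where "local_diffeo_at_0 S g h" using germ_diffeo_local_diffeo[OF gd(1)] .
    ultimately show "c \<in> N_orbit k \<theta> \<inter> C_prod k" using r gd(2) by (auto simp: N_orbit_def)
  qed
qed

lemma psi_tilde_reach:
  assumes "smooth_at x \<theta>"
  shows "psi_tilde k (jet k \<theta> x) \<in> C_prod k"
    "reach k (mat 1) (\<lambda>z. \<theta> (x + z)) (con_poly k (psi_tilde k (jet k \<theta> x)))"
    "reach k (mat 1) (con_poly k (jet k \<theta> x)) (con_poly k (psi_tilde k (jet k \<theta> x)))"
proof -
  let ?\<theta> = "jet k \<theta> x"
  have h: "?\<theta> n \<in> con_hom n" if "n \<le> k" for n by (rule jet_con_hom[OF that])
  have sm: "smooth_at 0 (con_poly k ?\<theta>)" by (rule smooth_at_con_poly[OF h])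
  obtain c where c: "c \<in> C_prod k" "reach k (mat 1) (con_poly k ?\<theta>) (con_poly k c)"
    using reach_C_prod_exists[OF sm] .
  \<comment> \<open>Without uniqueness \<open>the_elem\<close> in \<open>psi_tilde\<close> would say
    nothing. Extensionality of c removes the restriction left by the identity matrix.\<close>
  have "c' = c" if "c' \<in> C_prod k" "reach k (mat 1) (con_poly k ?\<theta>) (con_poly k c')" for c'
  proof -
    have "reach k (mat 1) (con_poly k c) (con_poly k c')"
      using reach_trans[OF reach_sym[OF c(2) sm] that(2) smooth_at_con_poly_C_prod[OF c(1)]] by (simp add: matrix_inv_mat1)
    from reach_C_prod[OF c(1) that(1) this] have "c' = (\<lambda>n\<in>{..k}. c n)" by (simp add: tensor_act_mat1)
    then show ?thesis using C_prodD(1)[OF c(1)] by (simp add: extensional_restrict)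
  qed
  then have "N_orbit k ?\<theta> \<inter> C_prod k = {c}"
    using c N_orbit_C_prod[of k ?\<theta>, OF h] by blast
  then have p: "psi_tilde k ?\<theta> = c" by (simp add: psi_tilde_def)
  show "psi_tilde k ?\<theta> \<in> C_prod k" "reach k (mat 1) (con_poly k ?\<theta>) (con_poly k (psi_tilde k ?\<theta>))" using c p by auto
  have "smooth_at 0 (\<lambda>z. \<theta> (x + z))" using assms by (intro smooth_at_shift) simp
  from reach_trans[OF reach_con_eqv[OF con_poly_jet_eqv[OF assms]] c(2) this]
  show "reach k (mat 1) (\<lambda>z. \<theta> (x + z)) (con_poly k (psi_tilde k ?\<theta>))" using p by simp
qed

text \<open>The two normal forms are linked through the two connections by changes with Jacobi
  matrices 1, A and 1. The arguments are shifted because \<open>reach\<close> concerns germs at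
  0.\<close>

lemma psi_tilde_equivariant:
  assumes "smooth_at x \<theta>" "smooth_at y \<theta>'" "reach k A (\<lambda>z. \<theta> (x + z)) (\<lambda>z. \<theta>' (y + z))"
  shows "psi_tilde k (jet k \<theta>' y) = (\<lambda>n\<in>{..k}. tensor_act A (psi_tilde k (jet k \<theta> x) n))"
proof -
  note 1 = psi_tilde_reach[OF assms(1), of k] and 2 = psi_tilde_reach[OF assms(2), of k]
  have sm: "smooth_at 0 (\<lambda>z. \<theta> (x + z))" using assms by (intro smooth_at_shift) simp
  note sc = smooth_at_con_poly_C_prod[OF 1(1)]
  have "reach k (mat 1 ** (A ** mat 1)) (con_poly k (psi_tilde k (jet k \<theta> x))) (con_poly k (psi_tilde k (jet k \<theta>' y)))"
    using reach_trans[OF reach_trans[OF reach_sym[OF 1(2) sm] assms(3) sc] 2(2) sc] by (simp add: matrix_inv_mat1)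
  then show ?thesis using reach_C_prod[OF 1(1) 2(1)] by simp
qed


section \<open>Polynomial maps into finite-dimensional spaces\<close>

text \<open>Coordinates in a finite-dimensional normed space are bounded. The point is that v has
  positive distance from the span of B: otherwise v would be a limit of combinations of B, whose
  coefficients are Cauchy by the induction hypothesis, and their limits would put v into the
  span.\<close>

lemma norm_lower_bound_independent:
  fixes B :: "'u::real_normed_vector set"
  assumes "finite B" "independent B"
  shows "\<exists>c>0. \<forall>a. c * (\<Sum>b\<in>B. \<bar>a b\<bar>) \<le> norm (\<Sum>b\<in>B. a b *\<^sub>R b)"
  using assms
proof (induction B rule: finite_induct)
  case empty
  then show ?case by (auto intro: exI[of _ 1])
next
  case (insert v B)
  then have "independent B" and v: "v \<notin> span B"
    by (auto simp: independent_insert)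
  then obtain c where c: "c > 0" "\<And>a. c * (\<Sum>b\<in>B. \<bar>a b\<bar>) \<le> norm (\<Sum>b\<in>B. a b *\<^sub>R b)"
    using insert.IH by blast
  have "\<exists>d>0. \<forall>a. d \<le> norm (v + (\<Sum>b\<in>B. a b *\<^sub>R b))"
  proof (rule ccontr)
    assume "\<not> ?thesis"
    then have "\<forall>n. \<exists>a. norm (v + (\<Sum>b\<in>B. a b *\<^sub>R b)) < inverse (real (Suc n))"
      by (metis inverse_positive_iff_positive not_le of_nat_0_less_iff zero_less_Suc)
    then obtain a where a: "\<And>n. norm (v + (\<Sum>b\<in>B. a n b *\<^sub>R b)) < inverse (real (Suc n))" by metis
    define s where "s n = (\<Sum>b\<in>B. a n b *\<^sub>R b)" for n
    have "(\<lambda>n. v + s n) \<longlonglongrightarrow> 0"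
      by (rule Lim_null_comparison[OF _ LIMSEQ_inverse_real_of_nat]) (use a in \<open>auto simp: s_def less_imp_le\<close>)
    then have "(\<lambda>n. (v + s n) - v) \<longlonglongrightarrow> 0 - v" by (intro tendsto_diff tendsto_const)
    then have s: "s \<longlonglongrightarrow> - v" by simp
    have "Cauchy (\<lambda>n. a n b)" if b: "b \<in> B" for b
    proof (rule metric_CauchyI)
      fix e :: real assume "e > 0"
      have "Cauchy s" using s by (simp add: LIMSEQ_imp_Cauchy)
      then obtain N where N: "\<And>m n. m \<ge> N \<Longrightarrow> n \<ge> N \<Longrightarrow> norm (s m - s n) < c * e"
        using \<open>e > 0\<close> c(1) unfolding Cauchy_def dist_norm by (metis mult_pos_pos)
      have "dist (a m b) (a n b) < e" if "m \<ge> N" "n \<ge> N" for m n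
      proof -
        have "c * \<bar>a m b - a n b\<bar> \<le> c * (\<Sum>b\<in>B. \<bar>a m b - a n b\<bar>)"
          using b c(1) insert.hyps(1) by (intro mult_left_mono member_le_sum) auto
        also have "\<dots> \<le> norm (\<Sum>b\<in>B. (a m b - a n b) *\<^sub>R b)" by (rule c(2))
        also have "(\<Sum>b\<in>B. (a m b - a n b) *\<^sub>R b) = s m - s n"
          by (simp add: s_def scaleR_diff_left sum_subtractf)
        also have "norm (s m - s n) < c * e" using N that by blast
        finally show ?thesis using c(1) by (simp add: dist_real_def)
      qed
      then show "\<exists>N. \<forall>m\<ge>N. \<forall>n\<ge>N. dist (a m b) (a n b) < e" by blast
    qed
    then have "\<forall>b\<in>B. \<exists>l. (\<lambda>n. a n b) \<longlonglongrightarrow> l" by (auto simp: Cauchy_convergent_iff convergent_def)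
    then obtain l where l: "\<And>b. b \<in> B \<Longrightarrow> (\<lambda>n. a n b) \<longlonglongrightarrow> l b" by metis
    have "s \<longlonglongrightarrow> (\<Sum>b\<in>B. l b *\<^sub>R b)"
      unfolding s_def by (intro tendsto_sum tendsto_scaleR l tendsto_const)
    then have "- v = (\<Sum>b\<in>B. l b *\<^sub>R b)" using s LIMSEQ_unique by blast
    then have "- v \<in> span B" by (simp add: span_sum span_scale span_base)
    then show False using v span_neg by fastforce
  qed
  then obtain d where d: "d > 0" "\<And>a. d \<le> norm (v + (\<Sum>b\<in>B. a b *\<^sub>R b))" by blast
  \<comment> \<open>K adds the bound T / d for the coefficient of v to the bound T (1 + norm v / d)
    / c for the sum of the others, with T factored out.\<close>
  define K where "K = 1 / d + (1 + norm v / d) / c"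
  have K: "K > 0" unfolding K_def using c(1) d(1) by (intro add_pos_nonneg) auto
  have "(1 / K) * (\<Sum>b\<in>insert v B. \<bar>a b\<bar>) \<le> norm (\<Sum>b\<in>insert v B. a b *\<^sub>R b)" for a
  proof -
    define S where "S = (\<Sum>b\<in>B. a b *\<^sub>R b)"
    define T where "T = norm (a v *\<^sub>R v + S)"
    have t: "\<bar>a v\<bar> * d \<le> T"
    proof (cases "a v = 0")
      case False
      have "a v *\<^sub>R v + S = a v *\<^sub>R (v + (\<Sum>b\<in>B. (a b / a v) *\<^sub>R b))"
        using False by (simp add: S_def scaleR_add_right scaleR_sum_right)
      then have "T = \<bar>a v\<bar> * norm (v + (\<Sum>b\<in>B. (a b / a v) *\<^sub>R b))" by (simp add: T_def)
      then show ?thesis using d(2) by (simp add: mult_left_mono)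
    qed (simp add: T_def)
    then have t': "\<bar>a v\<bar> \<le> T / d" using d(1) by (simp add: pos_le_divide_eq)
    have "c * (\<Sum>b\<in>B. \<bar>a b\<bar>) \<le> norm S" unfolding S_def by (rule c(2))
    also have "\<dots> \<le> T + \<bar>a v\<bar> * norm v"
      using norm_triangle_ineq4[of "a v *\<^sub>R v + S" "a v *\<^sub>R v"] by (simp add: T_def)
    also have "\<dots> \<le> T + T / d * norm v" using mult_right_mono[OF t', of "norm v"] by simp
    also have "\<dots> = T * (1 + norm v / d)" by (simp add: algebra_simps)
    finally have "(\<Sum>b\<in>B. \<bar>a b\<bar>) \<le> T * (1 + norm v / d) / c" using c(1) by (simp add: pos_le_divide_eq mult.commute)
    then have "(\<Sum>b\<in>insert v B. \<bar>a b\<bar>) \<le> T / d + T * (1 + norm v / d) / c"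
      using t' insert.hyps by simp
    also have "\<dots> = T * K" by (simp add: K_def distrib_left)
    finally have "(\<Sum>b\<in>insert v B. \<bar>a b\<bar>) \<le> T * K" .
    then have "(1 / K) * (\<Sum>b\<in>insert v B. \<bar>a b\<bar>) \<le> T" using K by (simp add: pos_divide_le_eq)
    then show ?thesis using insert.hyps by (simp add: T_def S_def)
  qed
  then show ?case using K by (intro exI[of _ "1 / K"]) simp
qed

text \<open>\<open>polynomial_map_in\<close> only speaks of bounded linear functionals, so values in
  U have to be recovered from them. The coordinate functionals of a basis are bounded by the
  preceding lemma.\<close>

lemma bounded_linear_separate:
  fixes u v :: "'u::real_normed_vector"
  assumes "finite B" "span B = (UNIV :: 'u set)" "\<And>l :: 'u \<Rightarrow> real. bounded_linear l \<Longrightarrow> l u = l v"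
  shows "u = v"
proof -
  obtain C where C: "C \<subseteq> B" "independent C" "B \<subseteq> span C"
    by (rule maximal_independent_subset[of B])
  have sp: "span C = UNIV" using C assms(2) by (metis span_mono span_span top.extremum_uniqueI)
  have fin: "finite C" using C assms(1) finite_subset by blast
  obtain c where c: "c > 0" "\<And>a. c * (\<Sum>b\<in>C. \<bar>a b\<bar>) \<le> norm (\<Sum>b\<in>C. a b *\<^sub>R b)"
    using norm_lower_bound_independent[OF fin C(2)] by blast
  have rep: "(\<Sum>b\<in>C. representation C w b *\<^sub>R b) = w" for w
    using sum_representation_eq[OF C(2) _ fin] sp by simp
  have "bounded_linear (\<lambda>w. representation C w b)" if b: "b \<in> C" for b
  proof (rule bounded_linear_intro[where K = "1 / c"])
    fix x y :: 'u and r :: real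
    show "representation C (x + y) b = representation C x b + representation C y b"
      by (simp add: representation_add C(2) sp)
    show "representation C (r *\<^sub>R x) b = r *\<^sub>R representation C x b"
      by (simp add: representation_scale C(2) sp)
    have "c * \<bar>representation C x b\<bar> \<le> c * (\<Sum>b\<in>C. \<bar>representation C x b\<bar>)"
      using b c(1) fin by (intro mult_left_mono member_le_sum) auto
    also have "\<dots> \<le> norm x" using c(2)[of "representation C x"] by (simp add: rep)
    finally show "norm (representation C x b) \<le> norm x * (1 / c)" using c(1) by (simp add: field_simps)
  qed
  then have "representation C u b = representation C v b" if "b \<in> C" for b using assms(3) that by blast
  then show ?thesis using rep[of u] rep[of v] by (metis (no_types, lifting) sum.cong)
qed

section \<open>Substitution into polynomial maps\<close>

lemma polynomial_in_cong: "polynomial_in X f \<Longrightarrow> (\<And>\<xi>. \<xi> \<in> X \<Longrightarrow> \<xi> a = \<xi> b) \<Longrightarrow> f a = f b"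
  by (induction rule: polynomial_in.induct) auto

lemma polynomial_in_substitute:
  assumes "polynomial_in X f" "\<And>\<xi>. \<xi> \<in> X \<Longrightarrow> polynomial_in Y (\<lambda>y. \<xi> (T y))"
  shows "polynomial_in Y (\<lambda>y. f (T y))"
  using assms by (induction rule: polynomial_in.induct) (auto intro: polynomial_in.intros)

text \<open>P takes a function on all index lists; being polynomial in the variables of order at
  most k, it ignores the longer ones.\<close>

lemma polynomial_map_deriv_vars_cong:
  fixes P :: "('m::finite list \<Rightarrow> 'm chr) \<Rightarrow> 'u::real_normed_vector"
  assumes "finite B" "span B = (UNIV :: 'u set)" "polynomial_map_in (deriv_vars k) P"
    and "\<And>is. length is \<le> k \<Longrightarrow> D is = D' is"
  shows "P D = P D'"
proof (rule bounded_linear_separate[OF assms(1,2)])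
  fix l :: "'u \<Rightarrow> real" assume "bounded_linear l"
  then have "polynomial_in (deriv_vars k) (l \<circ> P)" using assms(3) by (simp add: polynomial_map_in_def)
  then have "(l \<circ> P) D = (l \<circ> P) D'"
    by (rule polynomial_in_cong) (use assms(4) in \<open>auto simp: deriv_vars_def\<close>)
  then show "l (P D) = l (P D')" by simp
qed

text \<open>The substitution turns each variable in \<open>deriv_vars\<close> into a coordinate in
  \<open>jet_coords\<close>. It makes sense for every family c, whether or not it is a normal
  form.\<close>

lemma polynomial_map_jet_coords:
  fixes P :: "('m::finite list \<Rightarrow> 'm chr) \<Rightarrow> 'u::real_normed_vector"
  assumes "polynomial_map_in (deriv_vars k) P"
  shows "polynomial_map_in (jet_coords k) (\<lambda>c. P (\<lambda>is. pderivs is (c (length is)) 0))"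
  unfolding polynomial_map_in_def
proof (intro allI impI)
  fix l :: "'u \<Rightarrow> real" assume "bounded_linear l"
  then have "polynomial_in (deriv_vars k) (l \<circ> P)" using assms by (simp add: polynomial_map_in_def)
  then have "polynomial_in (jet_coords k) (\<lambda>c. (l \<circ> P) (\<lambda>is. pderivs is (c (length is)) 0))"
    by (rule polynomial_in_substitute)
      (auto simp: deriv_vars_def jet_coords_def intro!: polynomial_in.coord)
  then show "polynomial_in (jet_coords k) (l \<circ> (\<lambda>c. P (\<lambda>is. pderivs is (c (length is)) 0)))" by (simp add: o_def)
qed


section \<open>Charts and associated bundles\<close>

lemma is_chartD:
  assumes "is_chart X c"
  shows "openin X (fst c)" "inj_on (snd c) (fst c)" "\<And>V. openin X V \<Longrightarrow> V \<subseteq> fst c \<Longrightarrow> open (snd c ` V)"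
    "snd c \<in> extensional (fst c)"
proof -
  have hom: "homeomorphic_map (subtopology X (fst c)) (top_of_set (snd c ` fst c)) (snd c)"
    and o: "openin X (fst c)" and oi: "open (snd c ` fst c)"
    using assms by (auto simp: is_chart_def)
  have ts: "topspace (subtopology X (fst c)) = fst c" using openin_subset[OF o] by auto
  show "openin X (fst c)" by (rule o)
  show "inj_on (snd c) (fst c)" using homeomorphic_imp_injective_map[OF hom] ts by simp
  show "snd c \<in> extensional (fst c)" using assms by (simp add: is_chart_def)
  fix V assume V: "openin X V" "V \<subseteq> fst c"
  then have "openin (subtopology X (fst c)) V" by (simp add: openin_subset_topspace_eq openin_open_subtopology o)
  then have "openin (top_of_set (snd c ` fst c)) (snd c ` V)"
    using homeomorphic_imp_open_map[OF hom] by (simp add: open_map_def)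
  then show "open (snd c ` V)" using oi by (simp add: openin_open_eq)
qed

lemma transition_eq:
  assumes "is_chart X c" "p \<in> fst c"
  shows "transition c d (snd c p) = snd d p"
  using inv_into_f_f[OF is_chartD(2)[OF assms(1)] assms(2)] by (simp add: transition_def)

lemma open_chart_Int:
  assumes "is_chart X c" "is_chart X d"
  shows "open (snd c ` (fst c \<inter> fst d))"
  by (rule is_chartD(3)[OF assms(1)]) (auto intro: is_chartD(1) assms)

lemma germ_diffeo_transition:
  assumes c: "is_chart X c" and d: "is_chart X d" and "compatible c d" and p: "p \<in> fst c" "p \<in> fst d"
  shows "germ_diffeo (snd c p) (snd d p) (transition c d) (transition d c)"
proof -
  have o: "open (snd c ` (fst c \<inter> fst d))" "open (snd d ` (fst c \<inter> fst d))"
    using open_chart_Int[OF c d] open_chart_Int[OF d c] by (simp_all add: Int_commute)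
  have i: "snd c p \<in> snd c ` (fst c \<inter> fst d)" "snd d p \<in> snd d ` (fst c \<inter> fst d)" using p by auto
  have "\<forall>\<^sub>F z in nhds (snd c p). transition d c (transition c d z) = z"
    using eventually_nhds_in_open[OF o(1) i(1)]
    by eventually_elim (auto simp: transition_eq[OF c] transition_eq[OF d])
  moreover have "\<forall>\<^sub>F z in nhds (snd d p). transition c d (transition d c z) = z"
    using eventually_nhds_in_open[OF o(2) i(2)]
    by eventually_elim (auto simp: transition_eq[OF c] transition_eq[OF d])
  ultimately show ?thesis
    using assms(3) o i by (simp add: germ_diffeo_def compatible_def transition_eq[OF c p(1)] transition_eq[OF d p(2)] smooth_atI)
qed

lemma transition_compose:
  assumes c: "is_chart X c" and d: "is_chart X d" and e: "is_chart X e" and p: "p \<in> fst c" "p \<in> fst d" "p \<in> fst e"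
  shows "\<forall>\<^sub>F z in nhds (snd c p). transition d e (transition c d z) = transition c e z"
proof -
  have o: "open (snd c ` (fst c \<inter> fst d \<inter> fst e))"
    by (rule is_chartD(3)[OF c]) (auto intro: is_chartD(1) c d e)
  have "snd c p \<in> snd c ` (fst c \<inter> fst d \<inter> fst e)" using p by auto
  from eventually_nhds_in_open[OF o this] show ?thesis
    by eventually_elim (auto simp: transition_eq[OF c] transition_eq[OF d])
qed

lemma transition_refl:
  assumes c: "is_chart X c" and p: "p \<in> fst c"
  shows "\<forall>\<^sub>F z in nhds (snd c p). transition c c z = z"
proof -
  have o: "open (snd c ` fst c)" by (rule is_chartD(3)[OF c]) (auto intro: is_chartD(1) c)
  have "snd c p \<in> snd c ` fst c" using p by auto
  from eventually_nhds_in_open[OF o this] show ?thesis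
    by eventually_elim (auto simp: transition_eq[OF c])
qed

lemma manifoldD:
  assumes "manifold M"
  shows "c \<in> atlas M \<Longrightarrow> is_chart (top_of M) c" "c \<in> atlas M \<Longrightarrow> d \<in> atlas M \<Longrightarrow> compatible c d"
    "p \<in> points M \<Longrightarrow> \<exists>c\<in>atlas M. p \<in> fst c" "c \<in> atlas M \<Longrightarrow> fst c \<subseteq> points M"
proof -
  have 1: "\<forall>c\<in>atlas M. is_chart (top_of M) c" and 2: "\<forall>c\<in>atlas M. \<forall>d\<in>atlas M. compatible c d"
    and 3: "points M = (\<Union>c\<in>atlas M. fst c)"
    using assms unfolding manifold_def by blast+
  show "c \<in> atlas M \<Longrightarrow> is_chart (top_of M) c" using 1 by blast
  show "c \<in> atlas M \<Longrightarrow> d \<in> atlas M \<Longrightarrow> compatible c d" using 2 by blast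
  show "p \<in> points M \<Longrightarrow> \<exists>c\<in>atlas M. p \<in> fst c" "c \<in> atlas M \<Longrightarrow> fst c \<subseteq> points M"
    unfolding 3 by blast+
qed

lemma charts_atD:
  assumes "manifold M" "c \<in> charts_at M p"
  shows "is_chart (top_of M) c" "p \<in> fst c" "c \<in> atlas M"
  using assms(2) manifoldD(1)[OF assms(1), of c] by (simp_all add: charts_at_def)

lemma germ_diffeo_charts:
  assumes "manifold M" "c \<in> charts_at M p" "d \<in> charts_at M p"
  shows "germ_diffeo (snd c p) (snd d p) (transition c d) (transition d c)"
proof -
  note C = charts_atD[OF assms(1,2)] and D = charts_atD[OF assms(1,3)]
  show ?thesis
    by (rule germ_diffeo_transition[OF C(1) D(1) manifoldD(2)[OF assms(1) C(3) D(3)] C(2) D(2)])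
qed

lemma jac_refl:
  assumes "manifold M" "c \<in> charts_at M p"
  shows "jac c c p = mat 1"
  using jacobian_cong[OF transition_refl[OF charts_atD(1,2)[OF assms]]] by (simp add: jac_def jacobian_ident)

lemma jac_mult:
  assumes "manifold M" "c \<in> charts_at M p" "d \<in> charts_at M p" "e \<in> charts_at M p"
  shows "jac d e p ** jac c d p = jac c e p"
proof -
  note C = charts_atD[OF assms(1,2)] and D = charts_atD[OF assms(1,3)] and E = charts_atD[OF assms(1,4)]
  note gd = germ_diffeoD[OF germ_diffeo_charts[OF assms(1,2,3)]] and ge = germ_diffeoD[OF germ_diffeo_charts[OF assms(1,3,4)]]
  have "jac c e p = jacobian (\<lambda>z. transition d e (transition c d z)) (at (snd c p))"
    using jacobian_cong[OF transition_compose[OF C(1) D(1) E(1) C(2) D(2) E(2)]] by (simp add: jac_def)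
  also have "\<dots> = jac d e p ** jac c d p"
    using jacobian_compose[of "snd c p" "transition c d" "transition d e"] gd ge by (simp add: jac_def)
  finally show ?thesis by simp
qed

lemma jac_GL:
  assumes "manifold M" "c \<in> charts_at M p" "d \<in> charts_at M p"
  shows "jac c d p \<in> GL"
  using matrix_inv_eq(2)[of "jac c d p" "jac d c p"] jac_mult[OF assms(1,3,2,3)] jac_refl[OF assms(1,3)] by simp

section \<open>Frames and the fibres of associated bundles\<close>

lemma coord_frame_frames:
  assumes "manifold M" "c \<in> charts_at M p"
  shows "coord_frame M c p \<in> frames M p"
proof -
  have 1: "coord_frame M c p d \<in> GL" if "d \<in> charts_at M p" for d
    using jac_GL[OF assms that] that by (simp add: coord_frame_def)
  have 2: "coord_frame M c p e = jac d e p ** coord_frame M c p d"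
    if "d \<in> charts_at M p" "e \<in> charts_at M p" for d e
    using jac_mult[OF assms that] that by (simp add: coord_frame_def)
  have 3: "coord_frame M c p d = undefined" if "d \<notin> charts_at M p" for d
    using that by (simp add: coord_frame_def)
  show ?thesis unfolding frames_def by (intro CollectI conjI ballI PiE_I 1 2 3)
qed

lemma coord_frame_self: "manifold M \<Longrightarrow> c \<in> charts_at M p \<Longrightarrow> coord_frame M c p c = mat 1"
  by (simp add: coord_frame_def jac_refl)

lemma framesD:
  assumes "b \<in> frames M p"
  shows "c \<in> charts_at M p \<Longrightarrow> b c \<in> GL" "c \<in> charts_at M p \<Longrightarrow> d \<in> charts_at M p \<Longrightarrow> b d = jac c d p ** b c"
    "b \<in> extensional (charts_at M p)"
  using assms unfolding frames_def by (blast, blast, simp add: PiE_def)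

lemma GL_mult: "A \<in> GL \<Longrightarrow> B \<in> GL \<Longrightarrow> A ** B \<in> GL"
  using invertible_mult by (auto simp: GL_def)

lemma GL_inv: "A \<in> GL \<Longrightarrow> matrix_inv A \<in> GL"
  using matrix_inv_eq(3)[OF matrix_inv_GL(2)] by blast

text \<open>The algebraic laws of a module, relative to a subset U, so as to cover both \<sigma> on
  its whole type and \<open>tensor_act\<close> on \<open>C_space n\<close>.\<close>

definition GL_action :: "(real^'m^'m::finite \<Rightarrow> 'v \<Rightarrow> 'v) \<Rightarrow> 'v set \<Rightarrow> bool"
  where "GL_action \<sigma> U \<longleftrightarrow> (\<forall>A\<in>GL. \<forall>u\<in>U. \<sigma> A u \<in> U) \<and> (\<forall>u\<in>U. \<sigma> (mat 1) u = u) \<and>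
    (\<forall>A\<in>GL. \<forall>B\<in>GL. \<forall>u\<in>U. \<sigma> (A ** B) u = \<sigma> A (\<sigma> B u))"

text \<open>The element of the fibre whose component in the chart c is u, written as a graph over
  the frames at p: each frame occurs with exactly one vector.\<close>

definition chart_class :: "('p, 'm::finite) mfd \<Rightarrow> (real^'m^'m \<Rightarrow> 'v \<Rightarrow> 'v) \<Rightarrow> 'p \<Rightarrow> ('p, 'm) chart \<Rightarrow> 'v \<Rightarrow> (('p, 'm) frame \<times> 'v) set"
  where "chart_class M \<sigma> p c u = {(b, \<sigma> (matrix_inv (b c)) u) | b. b \<in> frames M p}"

text \<open>The frames at p form a single free orbit: b and b0 differ by one matrix A, which can be
  read off in the chart c and is then the same in every chart.\<close>

lemma ass_rel_Image:
  assumes M: "manifold M" and c: "c \<in> charts_at M p" and b0: "b0 \<in> frames M p" and \<sigma>: "GL_action \<sigma> U" and u: "u \<in> U"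
  shows "ass_rel M U \<sigma> p `` {(b0, u)} = chart_class M \<sigma> p c (\<sigma> (b0 c) u)"
proof (intro equalityI subsetI)
  fix x assume "x \<in> ass_rel M U \<sigma> p `` {(b0, u)}"
  then obtain b A where x: "x = (b, \<sigma> A u)" and b: "b \<in> frames M p" "A \<in> GL" and eq: "b0 = frame_act M p b A"
    by (auto simp: ass_rel_def)
  have "b0 c = b c ** A" using c by (simp add: eq frame_act_def)
  then have "A = matrix_inv (b c) ** b0 c"
    by (simp add: matrix_mul_assoc matrix_inv_GL[OF framesD(1)[OF b(1) c]])
  then have "\<sigma> A u = \<sigma> (matrix_inv (b c)) (\<sigma> (b0 c) u)"
    using \<sigma> u GL_inv[OF framesD(1)[OF b(1) c]] framesD(1)[OF b0 c] by (simp add: GL_action_def)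
  then show "x \<in> chart_class M \<sigma> p c (\<sigma> (b0 c) u)" using x b by (auto simp: chart_class_def)
next
  fix x assume "x \<in> chart_class M \<sigma> p c (\<sigma> (b0 c) u)"
  then obtain b where b: "b \<in> frames M p" and x: "x = (b, \<sigma> (matrix_inv (b c)) (\<sigma> (b0 c) u))"
    by (auto simp: chart_class_def)
  \<comment> \<open>The matrix with b A = b0, found in the chart c; the transition law of frames
    extends the equation to all other charts.\<close>
  define A where "A = matrix_inv (b c) ** b0 c"
  have A: "A \<in> GL" unfolding A_def by (intro GL_mult GL_inv framesD(1)[OF b c] framesD(1)[OF b0 c])
  have x': "x = (b, \<sigma> A u)"
    using x \<sigma> u GL_inv[OF framesD(1)[OF b c]] framesD(1)[OF b0 c] by (simp add: A_def GL_action_def)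
  have "frame_act M p b A = b0"
  proof (rule extensionalityI[of _ "charts_at M p"])
    fix d assume d: "d \<in> charts_at M p"
    have "b d ** A = jac c d p ** (b c ** matrix_inv (b c)) ** b0 c"
      by (simp add: framesD(2)[OF b c d] A_def matrix_mul_assoc)
    also have "\<dots> = b0 d" by (simp add: matrix_inv_GL[OF framesD(1)[OF b c]] framesD(2)[OF b0 c d])
    finally show "frame_act M p b A d = b0 d" using d by (simp add: frame_act_def)
  qed (use framesD(3)[OF b0] in \<open>auto simp: frame_act_def\<close>)
  then show "x \<in> ass_rel M U \<sigma> p `` {(b0, u)}" using x' b A u by (auto simp: ass_rel_def)
qed

text \<open>Both sides are the class of the coordinate frame of c with the vector u, evaluated in
  the charts d and c.\<close>

lemma chart_class_change:
  assumes M: "manifold M" and c: "c \<in> charts_at M p" and d: "d \<in> charts_at M p" and \<sigma>: "GL_action \<sigma> U" and u: "u \<in> U"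
  shows "chart_class M \<sigma> p d (\<sigma> (jac c d p) u) = chart_class M \<sigma> p c u"
proof -
  have "coord_frame M c p d = jac c d p" using d by (simp add: coord_frame_def)
  then show ?thesis
    using ass_rel_Image[OF M c coord_frame_frames[OF M c] \<sigma> u] ass_rel_Image[OF M d coord_frame_frames[OF M c] \<sigma> u] \<sigma> u
    by (simp add: coord_frame_self[OF M c] GL_action_def)
qed

lemma chart_class_coord_frame:
  assumes M: "manifold M" and c: "c \<in> charts_at M p" and \<sigma>: "GL_action \<sigma> U" and u: "u \<in> U"
  shows "(coord_frame M c p, u') \<in> chart_class M \<sigma> p c u \<longleftrightarrow> u' = u"
  using \<sigma> u coord_frame_frames[OF M c]
  by (auto simp: chart_class_def coord_frame_self[OF M c] matrix_inv_mat1 GL_action_def)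

lemma ass_fibre_chart_class:
  assumes M: "manifold M" and c: "c \<in> charts_at M p" and \<sigma>: "GL_action \<sigma> UNIV" and s: "s p \<in> ass_fibre M UNIV \<sigma> p"
  shows "s p = chart_class M \<sigma> p c (ass_comp M c s p)"
proof -
  obtain b0 u0 where "b0 \<in> frames M p" "s p = ass_rel M UNIV \<sigma> p `` {(b0, u0)}"
    using s by (auto simp: ass_fibre_def quotient_def)
  then have eq: "s p = chart_class M \<sigma> p c (\<sigma> (b0 c) u0)" using ass_rel_Image[OF M c _ \<sigma>] by simp
  have "ass_comp M c s p = \<sigma> (b0 c) u0"
    unfolding ass_comp_def eq using chart_class_coord_frame[OF M c \<sigma>] by simp
  then show ?thesis using eq by simp
qed

lemma ass_comp_change:
  assumes M: "manifold M" and c: "c \<in> charts_at M p" and d: "d \<in> charts_at M p"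
    and \<sigma>: "GL_action \<sigma> UNIV" and s: "s p \<in> ass_fibre M UNIV \<sigma> p"
  shows "ass_comp M d s p = \<sigma> (jac c d p) (ass_comp M c s p)"
proof -
  have "(coord_frame M d p, ass_comp M d s p) \<in> chart_class M \<sigma> p d (ass_comp M d s p)"
    using chart_class_coord_frame[OF M d \<sigma>] by simp
  also have "\<dots> = chart_class M \<sigma> p c (ass_comp M c s p)"
    using ass_fibre_chart_class[of M _ p \<sigma> s, OF M _ \<sigma> s] c d by metis
  also have "\<dots> = chart_class M \<sigma> p d (\<sigma> (jac c d p) (ass_comp M c s p))"
    using chart_class_change[OF M c d \<sigma>] by simp
  finally show ?thesis using chart_class_coord_frame[OF M d \<sigma>] by simp
qed

section \<open>Moving base points to the origin\<close>

lemma pd_shift_diff: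
  fixes f :: "real^'m::finite \<Rightarrow> real"
  assumes "smooth_at (x + z) f"
  shows "pd i (\<lambda>z. f (x + z) - c) z = pd i f (x + z)"
  using pd_diff[OF smooth_at_shift[OF assms] smooth_at_const] pd_shift[OF assms] by simp

lemma germ_diffeo_shift:
  assumes "germ_diffeo x y g h"
  shows "germ_diffeo 0 0 (\<lambda>z. g (x + z) - y) (\<lambda>w. h (y + w) - x)"
proof -
  note 1 = germ_diffeoD[OF assms]
  have "\<forall>\<^sub>F z in nhds 0. h (g (x + z)) - x = z"
    using eventually_shift[OF 1(5)] by eventually_elim simp
  moreover have "\<forall>\<^sub>F w in nhds 0. g (h (y + w)) - y = w"
    using eventually_shift[OF 1(6)] by eventually_elim simp
  moreover have "smooth_at 0 (\<lambda>z. g (x + z) - y)" "smooth_at 0 (\<lambda>w. h (y + w) - x)"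
    using 1 by (auto intro!: smooth_at_diff[OF smooth_at_shift smooth_at_const])
  ultimately show ?thesis using 1 by (simp add: germ_diffeo_def)
qed

lemma transform_shift:
  assumes "germ_diffeo (h (y + w)) (y + w) g h"
  shows "transform (\<lambda>z. g (x + z) - y) (\<lambda>w. h (y + w) - x) (\<lambda>z. \<theta> (x + z)) w = transform g h \<theta> (y + w)"
proof -
  note 1 = germ_diffeoD[OF assms]
  have sg: "smooth_at (x + (h (y + w) - x)) (\<lambda>z. g z $ l)" and sh: "smooth_at (y + w) (\<lambda>z. h z $ l)" for l
    using 1 by (simp_all add: smooth_at_vec_iff)
  have s: "smooth_at (h (y + w) - x) (\<lambda>z. g (x + z) - y)" "smooth_at w (\<lambda>w. h (y + w) - x)"
    using 1 by (auto intro!: smooth_at_diff[OF smooth_at_shift smooth_at_const])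
  have g: "pd a (\<lambda>z. (g (x + z) - y) $ l) (h (y + w) - x) = pd a (\<lambda>z. g z $ l) (h (y + w))" for a l
    using pd_shift_diff[OF sg] by simp
  have h: "pd a (\<lambda>w. (h (y + w) - x) $ l) w = pd a (\<lambda>z. h z $ l) (y + w)" for a l
    using pd_shift_diff[OF sh] by simp
  have hh: "pd i (pd j (\<lambda>w. (h (y + w) - x) $ l)) w = pd i (pd j (\<lambda>z. h z $ l)) (y + w)" for i j l
  proof -
    have "\<forall>\<^sub>F z in nhds w. smooth_at (y + z) (\<lambda>z. h z $ l)"
    proof -
      have "smooth_at w (\<lambda>z. y + z)" by (intro smooth_at_add smooth_at_const smooth_at_ident)
      from eventually_smooth_compose[OF this smooth_at_eventually[OF sh]] show ?thesis .
    qed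
    then have "\<forall>\<^sub>F z in nhds w. pd j (\<lambda>w. (h (y + w) - x) $ l) z = pd j (\<lambda>z. h z $ l) (y + z)"
    proof eventually_elim
      case (elim z)
      from pd_shift_diff[OF elim, where i = j and c = "x $ l"] show ?case by simp
    qed
    from pd_cong[OF this] show ?thesis using pd_shift[OF smooth_at_pd[OF sh]] by simp
  qed
  show ?thesis
    unfolding vec_eq_iff transform_nth[of "\<lambda>w. h (y + w) - x" w "\<lambda>z. g (x + z) - y", OF s] transform_nth[OF 1(1,2)]
    by (simp only: g h hh) simp
qed

text \<open>Recentring the transition map at 0 turns the compatibility of two presentations of a
  connection into the orbit relation of jets at the origin.\<close>

lemma reach_charts:
  assumes M: "manifold M" and \<theta>: "\<theta> \<in> Con M" and c: "c \<in> charts_at M p" and d: "d \<in> charts_at M p"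
  shows "reach k (jac c d p) (\<lambda>z. \<theta> c (snd c p + z)) (\<lambda>z. \<theta> d (snd d p + z))"
proof -
  let ?x = "snd c p" and ?y = "snd d p" and ?g = "transition c d" and ?h = "transition d c"
  note C = charts_atD[OF M c] and D = charts_atD[OF M d]
  have gd: "germ_diffeo ?x ?y ?g ?h" by (rule germ_diffeo_charts[OF M c d])
  note gd0 = germ_diffeo_shift[OF gd]
  have sm: "smooth_at ?x (\<theta> c)"
  proof (rule smooth_atI)
    show "open (snd c ` fst c)" by (rule is_chartD(3)[OF C(1)]) (auto intro: is_chartD(1) C)
    show "smooth_on (snd c ` fst c) (\<theta> c)" using \<theta> C by (auto simp: Con_def)
  qed (use C in auto)
  then have sm0: "smooth_at 0 (\<lambda>z. \<theta> c (?x + z))" by (intro smooth_at_shift) simp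
  have "\<forall>\<^sub>F w in nhds ?y. w \<in> snd d ` (fst c \<inter> fst d)"
    using open_chart_Int[OF D(1) C(1)] C(2) D(2) by (intro eventually_nhds_in_open) (auto simp: Int_commute)
  then have "\<forall>\<^sub>F w in nhds ?y. \<theta> d w = transform ?g ?h (\<theta> c) w"
    by eventually_elim (use \<theta> C(3) D(3) in \<open>auto simp: Con_def\<close>)
  with germ_diffeo_eventually[OF gd]
  have "\<forall>\<^sub>F w in nhds ?y. germ_diffeo (?h w) w ?g ?h \<and> \<theta> d w = transform ?g ?h (\<theta> c) w"
    by eventually_elim simp
  from eventually_shift[OF this]
  have "\<forall>\<^sub>F w in nhds 0. transform (\<lambda>z. ?g (?x + z) - ?y) (\<lambda>w. ?h (?y + w) - ?x) (\<lambda>z. \<theta> c (?x + z)) w = \<theta> d (?y + w)"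
    by eventually_elim (simp add: transform_shift)
  then have "con_eqv (Suc k) 0 (transform (\<lambda>z. ?g (?x + z) - ?y) (\<lambda>w. ?h (?y + w) - ?x) (\<lambda>z. \<theta> c (?x + z))) (\<lambda>z. \<theta> d (?y + z))"
    by (rule con_eqv_eventually[OF smooth_at_transform_germ[OF gd0 sm0]])
  moreover have "jacobian (\<lambda>z. ?g (?x + z) - ?y) (at 0) = jac c d p"
  proof -
    have sg: "smooth_at (?x + 0) (\<lambda>z. ?g z $ l)" for l using germ_diffeoD(1)[OF gd] by (simp add: smooth_at_vec_iff)
    have "pd a (\<lambda>z. ?g (?x + z) - ?y) 0 $ l = pd a ?g ?x $ l" for a l
      using pd_shift_diff[OF sg, where i = a and c = "?y $ l"] pd_vec_nth[OF germ_diffeoD(1)[OF gd0], of a l]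
        pd_vec_nth[OF germ_diffeoD(1)[OF gd], of a l] by simp
    then show ?thesis by (simp add: vec_eq_iff jac_def jacobian_nth)
  qed
  ultimately show ?thesis unfolding reach_def using gd0 by blast
qed

text \<open>A translation does not change the set of derivatives from which
  \<open>frechet_derivative\<close> chooses, so the equality also holds where no derivative
  exists.\<close>

lemma pderivs_shift:
  fixes f :: "real^'m::finite \<Rightarrow> 'b::real_normed_vector"
  shows "pderivs is (\<lambda>z. f (x + z)) = (\<lambda>z. pderivs is f (x + z))"
proof (induction "is")
  case (Cons i "is")
  have fs: "frechet_derivative (\<lambda>z. F (x + z)) (at z) = frechet_derivative F (at (x + z))" for F :: "real^'m \<Rightarrow> 'b" and z
  proof -
    have "((\<lambda>z. F (x + z)) has_derivative D) (at z) \<longleftrightarrow> (F has_derivative D) (at (x + z))" for D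
    proof
      assume D: "((\<lambda>z. F (x + z)) has_derivative D) (at z)"
      have "((\<lambda>w. w - x) has_derivative (\<lambda>w. w)) (at (x + z))" by (auto intro!: derivative_eq_intros)
      from diff_chain_at[OF this, of "\<lambda>z. F (x + z)" D] D show "(F has_derivative D) (at (x + z))" by (simp add: o_def)
    next
      assume D: "(F has_derivative D) (at (x + z))"
      from diff_chain_at[OF shift_has_derivative_id[of x "at z"] D] show "((\<lambda>z. F (x + z)) has_derivative D) (at z)" by (simp add: o_def)
    qed
    then show ?thesis by (simp add: frechet_derivative_def)
  qed
  show ?case by (simp add: Cons fs)
qed simp


section \<open>A model manifold with one global chart\<close>

text \<open>Points of the type outside the range of \<iota> do not belong to the space, so an
  injection of Euclidean space is enough.\<close>

definition model_top :: "(real^'m::finite \<Rightarrow> 'p) \<Rightarrow> 'p topology"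
  where "model_top \<iota> = pullback_topology (range \<iota>) (inv \<iota>) euclidean"

text \<open>A local diffeomorphism g on S becomes a chart whose transition from the standard chart
  is g itself. In this way arbitrary changes of coordinates are realised on the manifold.\<close>

definition model_chart :: "(real^'m::finite \<Rightarrow> 'p) \<Rightarrow> (real^'m) set \<Rightarrow> (real^'m \<Rightarrow> real^'m) \<Rightarrow> ('p, 'm) chart"
  where "model_chart \<iota> S g = (\<iota> ` S, restrict (g \<circ> inv \<iota>) (\<iota> ` S))"

definition std_chart :: "(real^'m::finite \<Rightarrow> 'p) \<Rightarrow> ('p, 'm) chart"
  where "std_chart \<iota> = model_chart \<iota> UNIV (\<lambda>x. x)"

text \<open>Compatibility with the one global chart already determines the maximal atlas.\<close>

definition model_mfd :: "(real^'m::finite \<Rightarrow> 'p) \<Rightarrow> ('p, 'm) mfd"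
  where "model_mfd \<iota> = \<lparr>top_of = model_top \<iota>, atlas = {c. is_chart (model_top \<iota>) c \<and> compatible (std_chart \<iota>) c}\<rparr>"

lemma openin_model_top:
  assumes "inj \<iota>"
  shows "openin (model_top \<iota>) V \<longleftrightarrow> (\<exists>U. open U \<and> V = \<iota> ` U)"
proof -
  have "inv \<iota> -` U \<inter> range \<iota> = \<iota> ` U" for U using assms by auto
  then show ?thesis by (simp add: model_top_def openin_pullback_topology)
qed

lemma topspace_model_top: "topspace (model_top \<iota>) = range \<iota>"
  by (simp add: model_top_def topspace_pullback_topology)

lemma snd_model_chart: "inj \<iota> \<Longrightarrow> x \<in> S \<Longrightarrow> snd (model_chart \<iota> S g) (\<iota> x) = g x"
  by (simp add: model_chart_def)

lemma fst_model_chart: "fst (model_chart \<iota> S g) = \<iota> ` S"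
  by (simp add: model_chart_def)

lemma image_model_chart: "inj \<iota> \<Longrightarrow> T \<subseteq> S \<Longrightarrow> snd (model_chart \<iota> S g) ` (\<iota> ` T) = g ` T"
  unfolding image_image by (rule image_cong) (auto simp: snd_model_chart subset_iff)

lemma is_chart_model_chart:
  assumes \<iota>: "inj \<iota>" and S: "open S" "open (g ` S)" and cont: "continuous_on S g" "continuous_on (g ` S) h"
    and h: "\<And>x. x \<in> S \<Longrightarrow> h (g x) = x"
  shows "is_chart (model_top \<iota>) (model_chart \<iota> S g)"
proof -
  let ?X = "model_top \<iota>" and ?f = "snd (model_chart \<iota> S g)"
  have oS: "openin ?X (\<iota> ` S)" using S by (auto simp: openin_model_top[OF \<iota>])
  have sub: "openin (subtopology ?X (\<iota> ` S)) V \<longleftrightarrow> (\<exists>U. open U \<and> U \<subseteq> S \<and> V = \<iota> ` U)" for V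
    using inj_image_subset_iff[OF \<iota>] by (auto simp: openin_open_subtopology[OF oS] openin_model_top[OF \<iota>])
  have ts: "topspace (subtopology ?X (\<iota> ` S)) = \<iota> ` S" by (auto simp: topspace_model_top)
  have im: "?f ` (\<iota> ` S) = g ` S" by (rule image_model_chart[OF \<iota> order_refl])
  have "homeomorphic_map (subtopology ?X (\<iota> ` S)) (top_of_set (g ` S)) ?f"
  proof (rule bijective_open_imp_homeomorphic_map)
    show "continuous_map (subtopology ?X (\<iota> ` S)) (top_of_set (g ` S)) ?f"
      unfolding continuous_map_def ts
    proof (intro conjI allI impI)
      show "?f \<in> \<iota> ` S \<rightarrow> topspace (top_of_set (g ` S))" using im by auto
      fix U assume "openin (top_of_set (g ` S)) U"
      then obtain T where T: "open T" "U = g ` S \<inter> T" by (auto simp: openin_open)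
      have "{x \<in> \<iota> ` S. ?f x \<in> U} = \<iota> ` (S \<inter> g -` T)" using T \<iota> by (auto simp: snd_model_chart)
      moreover have "open (S \<inter> g -` T)" using continuous_open_preimage[OF cont(1) S(1) T(1)] .
      ultimately show "openin (subtopology ?X (\<iota> ` S)) {x \<in> \<iota> ` S. ?f x \<in> U}" unfolding sub by blast
    qed
    show "open_map (subtopology ?X (\<iota> ` S)) (top_of_set (g ` S)) ?f"
      unfolding open_map_def
    proof (intro allI impI)
      fix V assume "openin (subtopology ?X (\<iota> ` S)) V"
      then obtain U where U: "open U" "U \<subseteq> S" "V = \<iota> ` U" by (auto simp: sub)
      have "g ` U = g ` S \<inter> h -` U" using U(2) h by (auto simp: image_iff)
      then have "open (g ` U)" using continuous_open_preimage[OF cont(2) S(2) U(1)] by simp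
      then show "openin (top_of_set (g ` S)) (?f ` V)"
        using U S(2) by (simp add: image_model_chart[OF \<iota> U(2)] openin_open_eq image_mono)
    qed
    show "?f ` topspace (subtopology ?X (\<iota> ` S)) = topspace (top_of_set (g ` S))" unfolding ts by (simp add: im)
    show "inj_on ?f (topspace (subtopology ?X (\<iota> ` S)))"
      unfolding ts by (rule inj_onI) (use h in \<open>auto simp: snd_model_chart[OF \<iota>], metis\<close>)
  qed
  then show ?thesis
    using oS S(2) im by (simp add: is_chart_def fst_model_chart) (simp add: model_chart_def)
qed

lemma is_chart_std: "inj \<iota> \<Longrightarrow> is_chart (model_top \<iota>) (std_chart \<iota>)"
  unfolding std_chart_def by (rule is_chart_model_chart[where h = "\<lambda>x. x"]) auto

lemma fst_std_chart: "fst (std_chart \<iota>) = range \<iota>"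
  by (simp add: std_chart_def fst_model_chart)

lemma snd_std_chart: "inj \<iota> \<Longrightarrow> snd (std_chart \<iota>) (\<iota> x) = x"
  by (simp add: std_chart_def snd_model_chart)

lemma transition_std_model_chart:
  assumes "inj \<iota>" "x \<in> S"
  shows "transition (std_chart \<iota>) (model_chart \<iota> S g) x = g x"
proof -
  have "transition (std_chart \<iota>) (model_chart \<iota> S g) (snd (std_chart \<iota>) (\<iota> x)) = snd (model_chart \<iota> S g) (\<iota> x)"
    by (rule transition_eq[OF is_chart_std[OF assms(1)]]) (simp add: fst_std_chart)
  then show ?thesis using assms by (simp add: snd_std_chart snd_model_chart)
qed

lemma transition_model_std_chart:
  assumes "inj \<iota>" "x \<in> S" and c: "is_chart (model_top \<iota>) (model_chart \<iota> S g)"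
  shows "transition (model_chart \<iota> S g) (std_chart \<iota>) (g x) = x"
proof -
  have "transition (model_chart \<iota> S g) (std_chart \<iota>) (snd (model_chart \<iota> S g) (\<iota> x)) = snd (std_chart \<iota>) (\<iota> x)"
    by (rule transition_eq[OF c]) (simp add: fst_model_chart assms)
  then show ?thesis using assms by (simp add: snd_std_chart snd_model_chart)
qed

lemma smooth_on_cong:
  assumes "open S" "smooth_on S f" "\<And>x. x \<in> S \<Longrightarrow> f x = g x"
  shows "smooth_on S g"
  using assms(2) Ck_on_cong[OF assms(1,3)] by (auto simp: smooth_on_def)

lemma model_chart_atlas:
  assumes \<iota>: "inj \<iota>" and S: "open S" "open (g ` S)" and sm: "smooth_on S g" "smooth_on (g ` S) h"
    and h: "\<And>x. x \<in> S \<Longrightarrow> h (g x) = x"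
  shows "model_chart \<iota> S g \<in> atlas (model_mfd \<iota>)"
proof -
  have cont: "continuous_on S g" "continuous_on (g ` S) h"
    using sm by (metis Ck_on.simps(1) smooth_on_def)+
  have c: "is_chart (model_top \<iota>) (model_chart \<iota> S g)"
    by (rule is_chart_model_chart[OF \<iota> S cont h])
  have eq: "range \<iota> \<inter> \<iota> ` S = \<iota> ` S" by auto
  have im: "snd (std_chart \<iota>) ` (\<iota> ` S) = S" "snd (model_chart \<iota> S g) ` (\<iota> ` S) = g ` S"
    using image_model_chart[OF \<iota> subset_UNIV, of "\<lambda>x. x" S] image_model_chart[OF \<iota> order_refl] by (simp_all add: std_chart_def)
  have "smooth_on S (transition (std_chart \<iota>) (model_chart \<iota> S g))"
    by (rule smooth_on_cong[OF S(1) sm(1)]) (simp add: transition_std_model_chart[OF \<iota>])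
  moreover have "smooth_on (g ` S) (transition (model_chart \<iota> S g) (std_chart \<iota>))"
    by (rule smooth_on_cong[OF S(2) sm(2)]) (auto simp: transition_model_std_chart[OF \<iota> _ c] h)
  ultimately show ?thesis
    using c by (simp add: model_mfd_def compatible_def fst_std_chart fst_model_chart eq im)
qed

lemma compatible_sym: "compatible c d \<Longrightarrow> compatible d c"
  by (simp add: compatible_def Int_commute)

text \<open>All transitions factor through the global chart s, whose domain contains every
  point.\<close>

lemma compatible_through:
  assumes c: "is_chart X c" and d: "is_chart X d" and s: "is_chart X s" and sub: "topspace X \<subseteq> fst s"
    and cs: "compatible c s" and sd: "compatible s d"
  shows "smooth_on (snd c ` (fst c \<inter> fst d)) (transition c d)"
  unfolding smooth_on_iff_smooth_at[OF open_chart_Int[OF c d]]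
proof
  fix z assume "z \<in> snd c ` (fst c \<inter> fst d)"
  then obtain p where z: "z = snd c p" and p: "p \<in> fst c" "p \<in> fst d" by auto
  have ps: "p \<in> fst s" using p(1) sub openin_subset[OF is_chartD(1)[OF c]] by blast
  note g1 = germ_diffeoD[OF germ_diffeo_transition[OF c s cs p(1) ps]]
    and g2 = germ_diffeoD[OF germ_diffeo_transition[OF s d sd ps p(2)]]
  have "smooth_at (snd c p) (\<lambda>w. transition s d (transition c s w))"
    by (rule smooth_at_compose[OF g1(1)]) (simp only: g1(3) g2(1))
  then show "smooth_at z (transition c d)"
    unfolding z by (rule smooth_at_cong[OF _ transition_compose[OF c s d p(1) ps p(2)]])
qed

lemma second_countable_euclidean: "second_countable (euclidean :: 'a::second_countable_topology topology)"
proof -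
  obtain B :: "'a set set" where B: "countable B" "topological_basis B" using ex_countable_basis by blast
  then show ?thesis
    unfolding second_countable_def
    by (intro exI[of _ B]) (metis open_openin topological_basisE topological_basis_open)
qed

lemma manifold_model_mfd:
  assumes \<iota>: "inj \<iota>"
  shows "manifold (model_mfd \<iota>)"
proof -
  let ?X = "model_top \<iota>" and ?s = "std_chart \<iota>"
  have s: "is_chart ?X ?s" by (rule is_chart_std[OF \<iota>])
  have sA: "?s \<in> atlas (model_mfd \<iota>)"
    unfolding std_chart_def by (rule model_chart_atlas[where h = "\<lambda>x. x", OF \<iota>])
      (auto simp: smooth_on_iff_smooth_at smooth_at_ident)
  have "subtopology ?X (range \<iota>) = ?X" using subtopology_topspace[of ?X] by (simp add: topspace_model_top)
  moreover have "snd ?s ` range \<iota> = UNIV"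
    using image_model_chart[OF \<iota> order_refl[of UNIV], where g = "\<lambda>x. x"] by (simp add: std_chart_def)
  ultimately have "homeomorphic_map ?X euclidean (snd ?s)"
    using s by (simp add: is_chart_def fst_std_chart)
  then have hs: "?X homeomorphic_space (euclidean :: (real^'a) topology)"
    by (rule homeomorphic_map_imp_homeomorphic_space)
  have sub: "topspace ?X \<subseteq> fst ?s" by (simp add: fst_std_chart topspace_model_top)
  show ?thesis
    unfolding manifold_def
  proof (intro conjI ballI allI impI)
    show "Hausdorff_space (top_of (model_mfd \<iota>))"
      using homeomorphic_Hausdorff_space[OF hs] by (simp add: model_mfd_def)
    show "second_countable (top_of (model_mfd \<iota>))"
      using homeomorphic_space_second_countability[OF hs] second_countable_euclidean by (simp add: model_mfd_def)
    show "points (model_mfd \<iota>) = (\<Union>c\<in>atlas (model_mfd \<iota>). fst c)"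
    proof
      show "points (model_mfd \<iota>) \<subseteq> (\<Union>c\<in>atlas (model_mfd \<iota>). fst c)"
        using sA sub by (auto simp: model_mfd_def)
      show "(\<Union>c\<in>atlas (model_mfd \<iota>). fst c) \<subseteq> points (model_mfd \<iota>)"
        by (auto simp: model_mfd_def dest!: is_chartD(1) openin_subset)
    qed
  next
    fix c assume "c \<in> atlas (model_mfd \<iota>)"
    then show "is_chart (top_of (model_mfd \<iota>)) c" by (simp add: model_mfd_def)
  next
    fix c d assume "c \<in> atlas (model_mfd \<iota>)" "d \<in> atlas (model_mfd \<iota>)"
    then have c: "is_chart ?X c" "compatible ?s c" and d: "is_chart ?X d" "compatible ?s d"
      by (auto simp: model_mfd_def)
    show "compatible c d"
      using compatible_through[OF c(1) d(1) s sub compatible_sym[OF c(2)] d(2)]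
        compatible_through[OF d(1) c(1) s sub compatible_sym[OF d(2)] c(2)]
      by (simp add: compatible_def Int_commute)
  next
    fix c assume c: "is_chart (top_of (model_mfd \<iota>)) c \<and> (\<forall>d\<in>atlas (model_mfd \<iota>). compatible c d)"
    then have "compatible ?s c" using sA compatible_sym by blast
    then show "c \<in> atlas (model_mfd \<iota>)" using c by (simp add: model_mfd_def)
  qed
qed

definition model_con :: "(real^'m::finite \<Rightarrow> 'p) \<Rightarrow> (real^'m \<Rightarrow> 'm chr) \<Rightarrow> ('p, 'm) connection"
  where "model_con \<iota> \<theta> = (\<lambda>c\<in>atlas (model_mfd \<iota>).
    restrict (transform (transition (std_chart \<iota>) c) (transition c (std_chart \<iota>)) \<theta>) (snd c ` fst c))"

text \<open>The presentations in all charts are transported from the standard one; their mutual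
  compatibility is the composition law for \<open>transform\<close>.\<close>

lemma model_con_Con:
  assumes \<iota>: "inj \<iota>" and sm: "\<And>x. smooth_at x \<theta>"
  shows "model_con \<iota> \<theta> \<in> Con (model_mfd \<iota>)"
proof -
  let ?A = "atlas (model_mfd \<iota>)" and ?X = "model_top \<iota>" and ?s = "std_chart \<iota>"
  have s: "is_chart ?X ?s" by (rule is_chart_std[OF \<iota>])
  have A: "is_chart ?X c" "compatible ?s c" if "c \<in> ?A" for c using that by (auto simp: model_mfd_def)
  have ps: "p \<in> fst ?s" if "c \<in> ?A" "p \<in> fst c" for c p
    using openin_subset[OF is_chartD(1)[OF A(1)[OF that(1)]]] that(2) by (auto simp: topspace_model_top fst_std_chart)
  have gs: "germ_diffeo (snd ?s p) (snd c p) (transition ?s c) (transition c ?s)" if "c \<in> ?A" "p \<in> fst c" for c p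
    using germ_diffeo_transition[OF s A(1)[OF that(1)] A(2)[OF that(1)] ps[OF that] that(2)] .
  have o: "open (snd c ` fst c)" if "c \<in> ?A" for c
    using A(1)[OF that] by (simp add: is_chart_def)
  have mc: "model_con \<iota> \<theta> c y = transform (transition ?s c) (transition c ?s) \<theta> y" if "c \<in> ?A" "y \<in> snd c ` fst c" for c y
    using that by (simp add: model_con_def)
  have "smooth_on (snd c ` fst c) (model_con \<iota> \<theta> c)" if c: "c \<in> ?A" for c
    unfolding smooth_on_iff_smooth_at[OF o[OF c]]
  proof
    fix y assume y: "y \<in> snd c ` fst c"
    then obtain p where p: "p \<in> fst c" "y = snd c p" by auto
    have "smooth_at y (transform (transition ?s c) (transition c ?s) \<theta>)"
      using smooth_at_transform_germ[OF gs[OF c p(1)] sm] p(2) by simp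
    then show "smooth_at y (model_con \<iota> \<theta> c)"
      by (rule smooth_at_cong) (use eventually_nhds_in_open[OF o[OF c] y] in eventually_elim, simp add: mc c)
  qed
  moreover have "model_con \<iota> \<theta> d y = transform (transition c d) (transition d c) (model_con \<iota> \<theta> c) y"
    if c: "c \<in> ?A" and d: "d \<in> ?A" and y: "y \<in> snd d ` (fst c \<inter> fst d)" for c d y
  proof -
    obtain p where p: "p \<in> fst c" "p \<in> fst d" and y': "y = snd d p" using y by auto
    note C = A[OF c] and D = A[OF d]
    have "compatible c d" using manifoldD(2)[OF manifold_model_mfd[OF \<iota>]] c d by blast
    then have gd: "germ_diffeo (snd c p) y (transition c d) (transition d c)"
      using germ_diffeo_transition[OF C(1) D(1) _ p] y' by simp
    have hc: "transition d c y = snd c p" using transition_eq[OF D(1) p(2)] y' by simp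
    have hs: "transition d ?s y = snd ?s p" using transition_eq[OF D(1) p(2)] y' by simp
    have "model_con \<iota> \<theta> d y = transform (transition ?s d) (transition d ?s) \<theta> y"
      using mc[OF d] p y' by simp
    also have "\<dots> = transform (\<lambda>u. transition c d (transition ?s c u)) (\<lambda>w. transition c ?s (transition d c w)) \<theta> y"
    proof (rule transform_cong)
      show "\<forall>\<^sub>F z in nhds (transition d ?s y). transition ?s d z = transition c d (transition ?s c z)"
        unfolding hs using transition_compose[OF s C(1) D(1) ps[OF c p(1)] p] by eventually_elim simp
      show "\<forall>\<^sub>F w in nhds y. transition d ?s w = transition c ?s (transition d c w)"
        unfolding y' using transition_compose[OF D(1) C(1) s p(2,1) ps[OF c p(1)]] by eventually_elim simp
    qed simp
    also have "\<dots> = transform (transition c d) (transition d c) (transform (transition ?s c) (transition c ?s) \<theta>) y"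
      by (rule transform_compose[OF gs[OF c p(1)] gd])
    also have "\<dots> = transform (transition c d) (transition d c) (model_con \<iota> \<theta> c) y"
      by (rule transform_cong) (use mc[OF c] p hc in auto)
    finally show ?thesis .
  qed
  moreover have "model_con \<iota> \<theta> \<in> (\<Pi>\<^sub>E c\<in>?A. extensional (snd c ` fst c))"
    by (auto simp: model_con_def)
  ultimately show ?thesis unfolding Con_def by blast
qed

text \<open>The image of a chart contains a ball, the whole of Euclidean space is homeomorphic to
  that ball, and the inverse of the chart carries it injectively into the type of points.\<close>

lemma manifold_model_injection:
  fixes M :: "('p, 'm::finite) mfd"
  assumes "manifold M" "points M \<noteq> {}"
  shows "\<exists>\<iota> :: real^'m \<Rightarrow> 'p. inj \<iota>"
proof -
  obtain p c where c: "c \<in> atlas M" "p \<in> fst c" using assms manifoldD(3)[OF assms(1)] by blast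
  note ch = manifoldD(1)[OF assms(1) c(1)]
  have "open (snd c ` fst c)" using ch by (simp add: is_chart_def)
  then obtain e where e: "e > 0" "ball (snd c p) e \<subseteq> snd c ` fst c"
    using c(2) by (meson imageI openE)
  obtain f :: "real^'m \<Rightarrow> real^'m" where f: "inj f" "range f \<subseteq> ball (snd c p) e"
  proof -
    obtain f g where fg: "homeomorphism (UNIV :: (real^'m) set) (ball (snd c p) e) f g"
      using homeomorphic_ball_UNIV[OF e(1), of "snd c p"] homeomorphic_sym unfolding homeomorphic_def by blast
    have "inj f" by (rule inj_on_inverseI[of _ g]) (simp add: homeomorphism_apply1[OF fg])
    then show thesis using that homeomorphism_image1[OF fg] by blast
  qed
  have "inj (inv_into (fst c) (snd c) \<circ> f)"
    by (rule comp_inj_on[OF f(1)]) (rule inj_on_inv_into, use e f in blast)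
  then show ?thesis by blast
qed


section \<open>The reduction theorem\<close>

lemma GL_module_action: "GL_module \<sigma> \<Longrightarrow> GL_action \<sigma> UNIV"
  by (simp add: GL_module_def GL_action_def)

lemma tensor_act_action: "GL_action tensor_act (C_space n)"
  unfolding GL_action_def
  by (auto simp: C_space_def tensor_act_con_hom tensor_act_mult tensor_act_mat1 gamma_tensor_act fun_eq_iff)

text \<open>F is applied to one connection on the model manifold, and the result is read at one
  point in two charts: the standard chart, which shows \<theta>, and the chart given by g, which
  shows \<open>transform g h \<theta>\<close> near 0. The two components of the section differ by
  the Jacobi matrix.\<close>

lemma natural_operation_equivariant:
  fixes F :: "('p, 'm::finite) mfd \<Rightarrow> ('p, 'm) connection \<Rightarrow> ('p, 'm, 'u::real_normed_vector) ass_section"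
    and \<iota> :: "real^'m \<Rightarrow> 'p"
  assumes \<sigma>: "GL_action \<sigma> UNIV" and \<iota>: "inj \<iota>"
    and sec: "\<And>M \<theta>. manifold M \<Longrightarrow> \<theta> \<in> Con M \<Longrightarrow> F M \<theta> \<in> smooth_sections M \<sigma>"
    and P: "\<And>M \<theta> c p. manifold M \<Longrightarrow> \<theta> \<in> Con M \<Longrightarrow> c \<in> atlas M \<Longrightarrow> p \<in> fst c \<Longrightarrow>
      ass_comp M c (F M \<theta>) p = P (\<lambda>is. pderivs is (\<theta> c) (snd c p))"
    and sm: "\<And>x. smooth_at x \<theta>" and gd: "germ_diffeo 0 0 g h"
  shows "P (\<lambda>is. pderivs is (transform g h \<theta>) 0) = \<sigma> (jacobian g (at 0)) (P (\<lambda>is. pderivs is \<theta> 0))"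
proof -
  obtain S where S: "local_diffeo_at_0 S g h" using germ_diffeo_local_diffeo[OF gd] .
  have oS: "open S" "0 \<in> S" "open (g ` S)" "smooth_on S g" "smooth_on (g ` S) h" and hg: "\<And>x. x \<in> S \<Longrightarrow> h (g x) = x"
    and g0: "g 0 = 0"
    using S by (auto simp: local_diffeo_at_0_def)
  let ?M = "model_mfd \<iota>" and ?c = "std_chart \<iota>" and ?d = "model_chart \<iota> S g" and ?p = "\<iota> 0" and ?\<Theta> = "model_con \<iota> \<theta>"
  have M: "manifold ?M" by (rule manifold_model_mfd[OF \<iota>])
  have \<Theta>: "?\<Theta> \<in> Con ?M" by (rule model_con_Con[OF \<iota> sm])
  have cA: "?c \<in> atlas ?M"
    unfolding std_chart_def by (rule model_chart_atlas[where h = "\<lambda>x. x", OF \<iota>])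
      (auto simp: smooth_on_iff_smooth_at smooth_at_ident)
  have dA: "?d \<in> atlas ?M" by (rule model_chart_atlas[OF \<iota> oS(1,3,4,5) hg])
  have pc: "?p \<in> fst ?c" by (simp add: fst_std_chart)
  have pd: "?p \<in> fst ?d" using oS(2) by (simp add: fst_model_chart)
  have c: "?c \<in> charts_at ?M ?p" and d: "?d \<in> charts_at ?M ?p" using cA dA pc pd by (simp_all add: charts_at_def)
  note ch = charts_atD(1)[OF M c] charts_atD(1)[OF M d]
  have sc: "snd ?c ?p = 0" by (rule snd_std_chart[OF \<iota>])
  have sd: "snd ?d ?p = 0" using snd_model_chart[OF \<iota> oS(2)] g0 by simp
  have tcd: "transition ?c ?d z = g z" if "z \<in> S" for z by (rule transition_std_model_chart[OF \<iota> that])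
  have dch: "is_chart (model_top \<iota>) ?d" using dA by (simp add: model_mfd_def)
  have tdc: "transition ?d ?c z = h z" if "z \<in> g ` S" for z
    using that transition_model_std_chart[OF \<iota> _ dch] hg by auto
  have jac: "jac ?c ?d ?p = jacobian g (at 0)"
    unfolding jac_def sc by (rule jacobian_cong) (use eventually_nhds_in_open[OF oS(1,2)] in eventually_elim, rule tcd)
  have ic: "snd ?c ` fst ?c = UNIV"
    using image_model_chart[OF \<iota> order_refl[of UNIV], where g = "\<lambda>x. x"] by (simp add: std_chart_def fst_model_chart)
  have id: "snd ?d ` fst ?d = g ` S" using image_model_chart[OF \<iota> order_refl] by (simp add: fst_model_chart)
  have tcc: "transition ?c ?c z = z" for z
    using transition_std_model_chart[OF \<iota> UNIV_I, of "\<lambda>x. x" z] by (simp add: std_chart_def)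
  have \<Theta>c: "?\<Theta> ?c = \<theta>"
  proof
    fix z
    have "transition ?c ?c = (\<lambda>x. x)" using tcc by blast
    then show "?\<Theta> ?c z = \<theta> z" using cA ic by (simp add: model_con_def transform_ident)
  qed
  have "\<forall>\<^sub>F y in nhds 0. ?\<Theta> ?d y = transform g h \<theta> y"
  proof -
    have "0 \<in> g ` S" using oS(2) g0 by (metis imageI)
    from eventually_nhds_in_open[OF oS(3) this] show ?thesis
    proof eventually_elim
      case (elim y)
      then obtain x where x: "x \<in> S" "y = g x" by auto
      have hy: "transition ?d ?c y = x" "h y = x" using tdc[OF elim] hg x by auto
      have "transform (transition ?c ?d) (transition ?d ?c) \<theta> y = transform g h \<theta> y"
      proof (rule transform_cong)
        show "\<forall>\<^sub>F z in nhds (transition ?d ?c y). transition ?c ?d z = g z"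
          unfolding hy using eventually_nhds_in_open[OF oS(1) x(1)] by eventually_elim (rule tcd)
        show "\<forall>\<^sub>F w in nhds y. transition ?d ?c w = h w"
          using eventually_nhds_in_open[OF oS(3) elim] by eventually_elim (rule tdc)
      qed simp
      then show ?case using dA id elim by (simp add: model_con_def)
    qed
  qed
  then have "pderivs is (?\<Theta> ?d) 0 = pderivs is (transform g h \<theta>) 0" for "is"
    by (intro eventually_nhds_x_imp_x[OF pderivs_cong])
  then have "P (\<lambda>is. pderivs is (transform g h \<theta>) 0) = ass_comp ?M ?d (F ?M ?\<Theta>) ?p"
    using P[OF M \<Theta> dA pd] sd by simp
  also have "\<dots> = \<sigma> (jac ?c ?d ?p) (ass_comp ?M ?c (F ?M ?\<Theta>) ?p)"
  proof (rule ass_comp_change[OF M c d \<sigma>])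
    have "?p \<in> points ?M" by (simp add: model_mfd_def topspace_model_top)
    then show "F ?M ?\<Theta> ?p \<in> ass_fibre ?M UNIV \<sigma> ?p" using sec[OF M \<Theta>] by (auto simp: smooth_sections_def)
  qed
  also have "ass_comp ?M ?c (F ?M ?\<Theta>) ?p = P (\<lambda>is. pderivs is \<theta> 0)"
    using P[OF M \<Theta> cA pc] sc \<Theta>c by simp
  finally show ?thesis by (simp add: jac)
qed

text \<open>All members of the union defining \<open>Psi\<close> coincide: from c to d the normal
  form changes by the tensor action of the Jacobi matrix, which is precisely how the component of a
  fixed class changes.\<close>

lemma Psi_chart_class:
  assumes M: "manifold M" and \<theta>: "\<theta> \<in> Con M" and c: "c \<in> charts_at M p" and n: "n \<le> k"
  shows "Psi k n M \<theta> p = chart_class M tensor_act p c (psi_tilde k (jet k (\<theta> c) (snd c p)) n)"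
proof -
  have p: "p \<in> points M" using manifoldD(4)[OF M] charts_atD[OF M c] by blast
  have sm: "smooth_at (snd d p) (\<theta> d)" if "d \<in> charts_at M p" for d
  proof (rule smooth_atI)
    note D = charts_atD[OF M that]
    show "open (snd d ` fst d)" using D(1) by (simp add: is_chart_def)
    show "smooth_on (snd d ` fst d) (\<theta> d)" using \<theta> D by (auto simp: Con_def)
    show "snd d p \<in> snd d ` fst d" using D by simp
  qed
  let ?u = "\<lambda>d. psi_tilde k (jet k (\<theta> d) (snd d p)) n"
  have u: "?u d \<in> C_space n" if "d \<in> charts_at M p" for d
    using psi_tilde_reach(1)[OF sm[OF that], of k] n by (auto simp: C_prod_def)
  have "ass_rel M (C_space n) tensor_act p `` {(coord_frame M d p, psi k n (jet k (\<theta> d) (snd d p)))} = chart_class M tensor_act p c (?u c)"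
    if d: "d \<in> charts_at M p" for d
  proof -
    have "?u d = tensor_act (jac c d p) (?u c)"
      using psi_tilde_equivariant[OF sm[OF c] sm[OF d] reach_charts[OF M \<theta> c d]] n by simp
    moreover have "ass_rel M (C_space n) tensor_act p `` {(coord_frame M d p, ?u d)} = chart_class M tensor_act p d (?u d)"
      using ass_rel_Image[OF M d coord_frame_frames[OF M d] tensor_act_action u[OF d]]
      by (simp add: coord_frame_self[OF M d] tensor_act_mat1)
    ultimately show ?thesis using chart_class_change[OF M c d tensor_act_action u[OF c]] by (simp add: psi_def)
  qed
  then have "Psi k n M \<theta> p = (\<Union>d\<in>charts_at M p. chart_class M tensor_act p c (?u c))"
    using p by (simp add: Psi_def)
  then show ?thesis using c by blast
qed

theorem theorem5p3:
  fixes \<sigma> :: "real^'m^'m::finite \<Rightarrow> 'u::real_normed_vector \<Rightarrow> 'u"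
    and k :: nat
    and F :: "('p, 'm) mfd \<Rightarrow> ('p, 'm) connection \<Rightarrow> ('p, 'm, 'u) ass_section"
  assumes "GL_module \<sigma>"
    and "natural_operation k \<sigma> F"
  shows "\<exists>f :: (nat \<Rightarrow> real^'m \<Rightarrow> 'm chr) \<Rightarrow> 'u.
           polynomial_map_in (jet_coords k) f \<and>
           (\<forall>A\<in>GL. \<forall>c\<in>C_prod k. f (\<lambda>n\<in>{..k}. tensor_act A (c n)) = \<sigma> A (f c)) \<and>
           (\<forall>M. manifold M \<longrightarrow>
              (\<forall>\<theta>\<in>Con M. F M \<theta> = induced k f M (\<lambda>n. Psi k n M \<theta>)))"
proof -
  have \<sigma>: "GL_action \<sigma> UNIV" by (rule GL_module_action[OF assms(1)])
  have sec: "F M \<theta> \<in> smooth_sections M \<sigma>" if "manifold M" "\<theta> \<in> Con M" for M \<theta>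
    using assms(2) that unfolding natural_operation_def by blast
  \<comment> \<open>Sections are extensional, so outside the manifold both sides take the same
    default value.\<close>
  have undef: "F M \<theta> p = induced k f M s p" if "manifold M" "\<theta> \<in> Con M" "p \<notin> points M" for M \<theta> p f s
  proof -
    have "F M \<theta> \<in> (\<Pi>\<^sub>E p\<in>points M. ass_fibre M UNIV \<sigma> p)"
      using sec[OF that(1,2)] unfolding smooth_sections_def by blast
    from PiE_arb[OF this that(3)] show ?thesis using that(3) by (simp add: induced_def)
  qed
  obtain P where Pp: "polynomial_map_in (deriv_vars k) P"
    and P': "\<forall>M. manifold M \<longrightarrow> (\<forall>\<theta>\<in>Con M. \<forall>c\<in>atlas M. \<forall>p\<in>fst c.
      ass_comp M c (F M \<theta>) p = P (\<lambda>is. pderivs is (\<theta> c) (snd c p)))"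
    using assms(2) unfolding natural_operation_def by (elim conjE exE) (rule that)
  have P: "\<And>M \<theta> c p. manifold M \<Longrightarrow> \<theta> \<in> Con M \<Longrightarrow> c \<in> atlas M \<Longrightarrow> p \<in> fst c \<Longrightarrow>
      ass_comp M c (F M \<theta>) p = P (\<lambda>is. pderivs is (\<theta> c) (snd c p))"
    using P' by blast
  obtain B :: "'u set" where B: "finite B" "span B = UNIV"
    using assms(1) unfolding GL_module_def by blast
  note Pcong = polynomial_map_deriv_vars_cong[OF B Pp]
  show ?thesis
  proof (cases "\<exists>\<iota> :: real^'m \<Rightarrow> 'p. inj \<iota>")
    case False
    then have "points M = {}" if "manifold M" for M :: "('p, 'm) mfd"
      using manifold_model_injection[OF that] by blast
    \<comment> \<open>With no points at all only the default values remain to be compared, and the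
      zero map serves as f.\<close>
    then have "F M \<theta> = induced k (\<lambda>_. 0) M (\<lambda>n. Psi k n M \<theta>)" if "manifold M" "\<theta> \<in> Con M" for M \<theta>
      using undef that by (intro ext) simp
    moreover have "polynomial_map_in (jet_coords k) (\<lambda>_. 0 :: 'u)"
      by (auto simp: polynomial_map_in_def o_def intro: polynomial_in.const)
    moreover have "\<sigma> A 0 = 0" if "A \<in> GL" for A
      using assms(1) that linear_0 by (auto simp: GL_module_def)
    ultimately show ?thesis by (intro exI[of _ "\<lambda>_. 0"]) simp
  next
    case True
    then obtain \<iota> :: "real^'m \<Rightarrow> 'p" where \<iota>: "inj \<iota>" by blast
    \<comment> \<open>Derivatives of order n are taken from the n-th part. Hence f is polynomial in
      \<open>jet_coords\<close> on all families, and by \<open>fP\<close> it equals P at the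
      polynomial connection whenever the parts are homogeneous.\<close>
    define f where "f c = P (\<lambda>is. pderivs is (c (length is)) 0)" for c
    have fP: "f c = P (\<lambda>is. pderivs is (con_poly k c) 0)" if "\<And>n. n \<le> k \<Longrightarrow> c n \<in> con_hom n" for c
      unfolding f_def by (rule Pcong) (simp add: pderivs_con_poly that)
    \<comment> \<open>Used twice: with the tensor action for equivariance on normal forms, and with
      the identity matrix to replace a jet by its normal form. The latter is why c need not be
      normal here.\<close>
    have reach_f: "f c' = \<sigma> A (f c)"
      if c: "\<And>n. n \<le> k \<Longrightarrow> c n \<in> con_hom n" and c': "\<And>n. n \<le> k \<Longrightarrow> c' n \<in> con_hom n"
        and r: "reach k A (con_poly k c) (con_poly k c')" for c c' A
    proof -
      obtain g h where gd: "germ_diffeo 0 0 g h" and A: "jacobian g (at 0) = A"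
        and eq: "con_eqv (Suc k) 0 (transform g h (con_poly k c)) (con_poly k c')"
        using r by (auto simp: reach_def)
      have sm: "smooth_at x (con_poly k c)" for x by (rule smooth_at_con_poly[OF c])
      have e: "f c = P (\<lambda>is. pderivs is (con_poly k c) 0)" "f c' = P (\<lambda>is. pderivs is (con_poly k c') 0)"
        by (rule fP, rule c, assumption, rule fP, rule c', assumption)
      have "f c' = P (\<lambda>is. pderivs is (transform g h (con_poly k c)) 0)"
        unfolding e(2)
        by (rule Pcong) (simp add: con_eqv_pderivs[OF eq smooth_at_transform_germ[OF gd sm]])
      also have "\<dots> = \<sigma> A (f c)"
        unfolding e(1) A[symmetric]
        by (rule natural_operation_equivariant[OF \<sigma> \<iota> sec P sm gd])
      finally show ?thesis .
    qed
    have equiv: "f (\<lambda>n\<in>{..k}. tensor_act A (c n)) = \<sigma> A (f c)" if "A \<in> GL" "c \<in> C_prod k" for A c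
      by (rule reach_f[OF _ _ reach_tensor_act[OF that]])
        (use C_prodD(2)[OF that(2)] C_prodD(2)[OF tensor_act_C_prod[OF that]] in auto)
    have "F M \<theta> p = induced k f M (\<lambda>n. Psi k n M \<theta>) p" if M: "manifold M" and \<theta>: "\<theta> \<in> Con M" for M \<theta> p
    proof (cases "p \<in> points M")
      case False
      then show ?thesis by (rule undef[OF M \<theta>])
    next
      case True
      then obtain c where cA: "c \<in> atlas M" "p \<in> fst c" using manifoldD(3)[OF M] by blast
      then have c: "c \<in> charts_at M p" by (simp add: charts_at_def)
      define x where "x = snd c p"
      define v where "v = psi_tilde k (jet k (\<theta> c) x)"
      have sm: "smooth_at x (\<theta> c)"
      proof (rule smooth_atI)
        show "open (snd c ` fst c)" using charts_atD(1)[OF M c] by (simp add: is_chart_def)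
        show "smooth_on (snd c ` fst c) (\<theta> c)" using \<theta> cA by (auto simp: Con_def)
        show "x \<in> snd c ` fst c" using cA by (simp add: x_def)
      qed
      have v: "v \<in> C_prod k" unfolding v_def by (rule psi_tilde_reach(1)[OF sm])
      have "ass_comp M c (F M \<theta>) p = P (\<lambda>is. pderivs is (\<theta> c) x)"
        unfolding x_def by (rule P[OF M \<theta> cA])
      also have "\<dots> = f (jet k (\<theta> c) x)"
      proof -
        have "smooth_at 0 (\<lambda>z. \<theta> c (x + z))" using sm by (intro smooth_at_shift) simp
        from con_eqv_pderivs[OF con_poly_jet_eqv[OF sm] this]
        have "pderivs is (\<theta> c) x = pderivs is (con_poly k (jet k (\<theta> c) x)) 0" if "length is \<le> k" for "is"
          using that by (simp add: pderivs_shift)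
        then have "P (\<lambda>is. pderivs is (\<theta> c) x) = P (\<lambda>is. pderivs is (con_poly k (jet k (\<theta> c) x)) 0)"
          by (rule Pcong)
        also have "\<dots> = f (jet k (\<theta> c) x)" by (rule fP[symmetric]) (rule jet_con_hom)
        finally show ?thesis .
      qed
      also have "\<dots> = f v"
      proof -
        have "f v = \<sigma> (mat 1) (f (jet k (\<theta> c) x))"
          by (rule reach_f[OF _ _ psi_tilde_reach(3)[OF sm, of k, folded v_def]]) (auto intro: jet_con_hom C_prodD(2)[OF v])
        then show ?thesis using \<sigma> by (simp add: GL_action_def)
      qed
      finally have comp: "ass_comp M c (F M \<theta>) p = f v" .
      have "F M \<theta> p \<in> ass_fibre M UNIV \<sigma> p" using sec[OF M \<theta>] True by (auto simp: smooth_sections_def)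
      from ass_fibre_chart_class[where s = "F M \<theta>", OF M c \<sigma> this]
      have "F M \<theta> p = {(b, \<sigma> (matrix_inv (b c)) (f v)) | b. b \<in> frames M p}"
        by (simp add: comp chart_class_def)
      also have "\<dots> = {(b, f (\<lambda>n\<in>{..k}. tensor_act (matrix_inv (b c)) (v n))) | b. b \<in> frames M p}"
      proof -
        have "f (\<lambda>n\<in>{..k}. tensor_act (matrix_inv (b c)) (v n)) = \<sigma> (matrix_inv (b c)) (f v)" if "b \<in> frames M p" for b
          by (rule equiv[OF GL_inv[OF framesD(1)[OF that c]] v])
        then show ?thesis by force
      qed
      also have "\<dots> = {(b, f u) | b u. b \<in> frames M p \<and> u \<in> extensional {..k} \<and> (\<forall>n\<le>k. (b, u n) \<in> Psi k n M \<theta> p)}"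
      proof -
        \<comment> \<open>Over a given frame each class contains exactly one vector, so the tuple is
          forced in degrees up to k; extensionality fixes it beyond k.\<close>
        have W: "u \<in> extensional {..k} \<and> (\<forall>n\<le>k. (b, u n) \<in> Psi k n M \<theta> p) \<longleftrightarrow> u = (\<lambda>n\<in>{..k}. tensor_act (matrix_inv (b c)) (v n))"
          if "b \<in> frames M p" for b u
        proof -
          have mem: "(b, u n) \<in> Psi k n M \<theta> p \<longleftrightarrow> u n = tensor_act (matrix_inv (b c)) (v n)" if "n \<le> k" for n
            using Psi_chart_class[OF M \<theta> c that] \<open>b \<in> frames M p\<close> by (auto simp: chart_class_def v_def x_def)
          show ?thesis
          proof
            assume u: "u \<in> extensional {..k} \<and> (\<forall>n\<le>k. (b, u n) \<in> Psi k n M \<theta> p)"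
            show "u = (\<lambda>n\<in>{..k}. tensor_act (matrix_inv (b c)) (v n))"
              by (rule extensionalityI[of _ "{..k}"]) (use u mem in simp_all)
          next
            assume u: "u = (\<lambda>n\<in>{..k}. tensor_act (matrix_inv (b c)) (v n))"
            show "u \<in> extensional {..k} \<and> (\<forall>n\<le>k. (b, u n) \<in> Psi k n M \<theta> p)"
              using mem by (simp add: u)
          qed
        qed
        show ?thesis
        proof (intro Collect_cong iffI; elim exE conjE)
          fix x b assume x: "x = (b, f (\<lambda>n\<in>{..k}. tensor_act (matrix_inv (b c)) (v n)))" and b: "b \<in> frames M p"
          from W[OF b, THEN iffD2, OF refl] x b
          show "\<exists>b u. x = (b, f u) \<and> b \<in> frames M p \<and> u \<in> extensional {..k} \<and> (\<forall>n\<le>k. (b, u n) \<in> Psi k n M \<theta> p)"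
            by blast
        next
          fix x b u assume x: "x = (b, f u)" and b: "b \<in> frames M p"
            and u: "u \<in> extensional {..k}" "\<forall>n\<le>k. (b, u n) \<in> Psi k n M \<theta> p"
          from W[OF b, THEN iffD1, OF conjI[OF u]] x b
          show "\<exists>b. x = (b, f (\<lambda>n\<in>{..k}. tensor_act (matrix_inv (b c)) (v n))) \<and> b \<in> frames M p"
            by blast
        qed
      qed
      also have "\<dots> = induced k f M (\<lambda>n. Psi k n M \<theta>) p" using True by (simp add: induced_def)
      finally show ?thesis .
    qed
    then have "F M \<theta> = induced k f M (\<lambda>n. Psi k n M \<theta>)" if "manifold M" "\<theta> \<in> Con M" for M \<theta> using that by blast
    moreover have "polynomial_map_in (jet_coords k) f"
      unfolding f_def[abs_def] by (rule polynomial_map_jet_coords[OF Pp])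
    ultimately show ?thesis using equiv by blast
  qed
qed

end
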